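(* Suppose $t_0\in[-\pi,\pi]$. Then $t_0$ is Schnorr random if and only if $\{\sigma_N(f)(t_0)\}_{N\in\mathbb{N}}$ converges to the canonical value of $f(t_0)$ whenever $f$ is a computable vector in $L^1[-\pi,\pi]$.
   Context: $L^1[-\pi,\pi]$ is the complex space of integrable $f:[-\pi,\pi]\to\mathbb{C}$ (modulo a.e. equality), with its usual norm $\|\cdot\|_1$. For $n\in\mathbb{Z}$ let $e_n(t)=e^{int}$, and for $f\in L^1[-\pi,\pi]$ let $c_n(f)=\frac{1}{2\pi}\int_{-\pi}^{\pi}f(t)e^{-int}\,dt$, $S_N(f)=\sum_{n=-N}^{N}c_n(f)e_n$, and let $\sigma_N(f)=\frac{1}{N+1}\sum_{M=0}^{N}S_M(f)$ be the Cesàro means. A trigonometric polynomial is a finite complex linear combination of the functions $e_n$, $n\in\mathbb{Z}$; it is rational if all its coefficients are rational points (complex numbers with rational real and imaginary parts). A real $x$ is computable if there is an algorithm that, given $k\in\mathbb{N}$, outputs a rational $q$ with $|q-x|<2^{-k}$; a sequence of numbers is computable if its terms are computable uniformly in the index. $f\in L^1[-\pi,\pi]$ is a computable vector if there is an algorithm that, given $k\in\mathbb{N}$, outputs a rational trigonometric polynomial $\tau$ with $\|f-\tau\|_1<2^{-k}$. A Cauchy name of $f\in L^1[-\pi,\pi]$ is a sequence $\{\tau_n\}_{n\in\mathbb{N}}$ of rational trigonometric polynomials with $\lim_n\|\tau_n-f\|_1=0$ and $\|\tau_n-\tau_{n+1}\|_1<2^{-(n+1)}$ for all $n$; it is computable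 if the degree and coefficients of $\tau_n$ can be computed from $n$. A vector is computable iff it has a computable Cauchy name. If $\{\tau_n\}$ is a computable Cauchy name of $f$ and $\{\tau_{2n}(t)\}_{n\in\mathbb{N}}$ converges to $\alpha\in\mathbb{C}$, then $\{\tau_n\}$ assigns the value $\alpha$ to $f(t)$. If $f$ is a computable vector and $t_0$ is Schnorr random, every computable Cauchy name of $f$ assigns a value to $f(t_0)$, and all of them assign the same value. When $t_0$ is Schnorr random, the canonical value of $f(t_0)$ is the value assigned to $f(t_0)$ by a computable Cauchy name of $f$. An open set $U\subseteq\mathbb{R}$ is computably open if the set of closed intervals with rational endpoints included in $U$ is computably enumerable; a sequence $\{U_n\}_{n\in\mathbb{N}}$ of open sets is computable if $U_n$ is computably open uniformly in $n$. Let $\mu$ be Lebesgue measure. A Schnorr test is a computable sequence $\{V_n\}_{n\in\mathbb{N}}$ of open sets of reals such that $\mu(V_n)\le 2^{-n}$ for all $n$ and the sequence $\{\mu(V_n)\}_{n\in\mathbb{N}}$ is computable. A real $x$ is Schnorr random if $x\notin\bigcap_n V_n$ for every Schnorr test $\{V_n\}_{n\in\mathbb{N}}$. *)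

theory Defs
  imports "HOL-Analysis.Analysis" "HOL-Library.Poly_Mapping" "HOL-Library.Nat_Bijection"
begin

text \<open>Algorithms are Kleene's partial recursive functions, given by program terms and a big-step
  semantics: \<open>computes p xs y\<close> says that \<open>p\<close> halts on the argument list \<open>xs\<close> with value \<open>y\<close>.\<close>

datatype recf =
    Zero
  | Succ
  | Proj nat
  | Comp recf "recf list"
  | PrimRec recf recf
  | Mu recf

inductive computes :: "recf \<Rightarrow> nat list \<Rightarrow> nat \<Rightarrow> bool" where
  zero: "computes Zero xs 0"
| succ: "computes Succ [x] (Suc x)"
| proj: "i < length xs \<Longrightarrow> computes (Proj i) xs (xs ! i)"
| comp: "list_all2 (\<lambda>g y. computes g xs y) gs ys \<Longrightarrow> computes f ys z
    \<Longrightarrow> computes (Comp f gs) xs z"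
| primrec_0: "computes f xs y \<Longrightarrow> computes (PrimRec f g) (0 # xs) y"
| primrec_Suc: "computes (PrimRec f g) (n # xs) y \<Longrightarrow> computes g (n # y # xs) z
    \<Longrightarrow> computes (PrimRec f g) (Suc n # xs) z"
| mu: "computes f (n # xs) 0 \<Longrightarrow> (\<forall>m<n. \<exists>y. computes f (m # xs) (Suc y))
    \<Longrightarrow> computes (Mu f) xs n"

lemma computes_deterministic:
  "computes p xs y \<Longrightarrow> computes p xs z \<Longrightarrow> y = z"
proof (induction arbitrary: z rule: computes.induct)
  case (zero xs)
  then show ?case by cases auto
next
  case (succ x)
  then show ?case by cases auto
next
  case (proj i xs)
  then show ?case by (auto elim: computes.cases)
next
  case (comp xs gs ys f z z')
  from comp.prems obtain ys' where ys': "list_all2 (\<lambda>g y. computes g xs y) gs ys'"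
    and z': "computes f ys' z'" by cases auto
  have "ys = ys'"
    using comp.IH(1) ys' by (auto simp: list_all2_conv_all_nth intro!: nth_equalityI)
  then show ?case using comp.IH(2) z' by blast
next
  case (primrec_0 f xs y g)
  from primrec_0.prems show ?case by cases (use primrec_0.IH in auto)
next
  case (primrec_Suc f g n xs y z)
  from primrec_Suc.prems show ?case
    by cases (use primrec_Suc.IH in blast)+
next
  case (mu f n xs n')
  from mu.prems have *: "computes f (n' # xs) 0" "\<forall>m<n'. \<exists>y. computes f (m # xs) (Suc y)"
    by (cases; simp)+
  show ?case
  proof (cases n n' rule: linorder_cases)
    case less
    then obtain y where "computes f (n # xs) (Suc y)" using *(2) by blast
    then show ?thesis using mu.IH(1) by blast
  next
    case greater
    then show ?thesis using mu.IH(2) *(1) by blast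
  qed auto
qed

definition computable :: "(nat \<Rightarrow> nat) \<Rightarrow> bool" where
  "computable f \<longleftrightarrow> (\<exists>p. \<forall>n. computes p [n] (f n))"

definition computable2 :: "(nat \<Rightarrow> nat \<Rightarrow> nat) \<Rightarrow> bool" where
  "computable2 f \<longleftrightarrow> (\<exists>p. \<forall>m n. computes p [m, n] (f m n))"

definition computably_enumerable :: "nat set \<Rightarrow> bool" where
  "computably_enumerable A \<longleftrightarrow> A = {} \<or> (\<exists>f. computable f \<and> A = range f)"

definition uniformly_computably_enumerable :: "(nat \<Rightarrow> nat set) \<Rightarrow> bool" where
  "uniformly_computably_enumerable A \<longleftrightarrow>
    computably_enumerable {prod_encode (n, m) | n m. m \<in> A n}"

text \<open>Rational numbers are represented by their codes under the library's effective surjection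
  \<^const>\<open>nat_to_rat_surj\<close>, which reads \<open>n\<close> as a pair (numerator, denominator) of coded integers.\<close>

definition computable_rat2 :: "(nat \<Rightarrow> nat \<Rightarrow> rat) \<Rightarrow> bool" where
  "computable_rat2 q \<longleftrightarrow> (\<exists>f. computable2 f \<and> (\<forall>m n. q m n = nat_to_rat_surj (f m n)))"

definition computable_real_seq :: "(nat \<Rightarrow> real) \<Rightarrow> bool" where
  "computable_real_seq x \<longleftrightarrow>
    (\<exists>q. computable_rat2 q \<and> (\<forall>n k. \<bar>real_of_rat (q n k) - x n\<bar> < 1 / 2 ^ k))"

definition rat_interval_codes :: "real set \<Rightarrow> nat set" where
  "rat_interval_codes U = {prod_encode (i, j) | i j.
     nat_to_rat_surj i \<le> nat_to_rat_surj j \<and>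
     {real_of_rat (nat_to_rat_surj i)..real_of_rat (nat_to_rat_surj j)} \<subseteq> U}"

definition computable_open_seq :: "(nat \<Rightarrow> real set) \<Rightarrow> bool" where
  "computable_open_seq U \<longleftrightarrow>
    (\<forall>n. open (U n)) \<and> uniformly_computably_enumerable (\<lambda>n. rat_interval_codes (U n))"

definition schnorr_test :: "(nat \<Rightarrow> real set) \<Rightarrow> bool" where
  "schnorr_test V \<longleftrightarrow> computable_open_seq V \<and>
    (\<forall>n. emeasure lebesgue (V n) \<le> ennreal (1 / 2 ^ n)) \<and>
    computable_real_seq (\<lambda>n. measure lebesgue (V n))"

definition schnorr_random :: "real \<Rightarrow> bool" where
  "schnorr_random x \<longleftrightarrow> (\<forall>V. schnorr_test V \<longrightarrow> x \<notin> (\<Inter>n. V n))"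

text \<open>Vectors of $L^1[-\pi,\pi]$ are given by representatives \<open>f :: real \<Rightarrow> complex\<close>; everything
  below depends only on the a.e. class of \<open>f\<close> on $[-\pi,\pi]$.\<close>

abbreviation L1 :: "(real \<Rightarrow> complex) set" where
  "L1 \<equiv> {f. integrable (lebesgue_on {-pi..pi}) f}"

definition L1_norm :: "(real \<Rightarrow> complex) \<Rightarrow> real" where
  "L1_norm f = (LINT t|lebesgue_on {-pi..pi}. norm (f t))"

definition trig_e :: "int \<Rightarrow> real \<Rightarrow> complex" where
  "trig_e n t = exp (\<i> * of_int n * of_real t)"

definition fourier_coeff :: "(real \<Rightarrow> complex) \<Rightarrow> int \<Rightarrow> complex" where
  "fourier_coeff f n =
    1 / (2 * of_real pi) * (LINT t|lebesgue_on {-pi..pi}. f t * exp (- \<i> * of_int n * of_real t))"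

definition fourier_sum :: "nat \<Rightarrow> (real \<Rightarrow> complex) \<Rightarrow> real \<Rightarrow> complex" where
  "fourier_sum N f t = (\<Sum>n = - int N..int N. fourier_coeff f n * trig_e n t)"

definition cesaro_mean :: "nat \<Rightarrow> (real \<Rightarrow> complex) \<Rightarrow> real \<Rightarrow> complex" where
  "cesaro_mean N f t = 1 / (of_nat N + 1) * (\<Sum>M = 0..N. fourier_sum M f t)"

text \<open>A trigonometric polynomial is represented by its finitely supported coefficient family.\<close>

type_synonym trig_poly = "int \<Rightarrow>\<^sub>0 complex"

definition trig_eval :: "trig_poly \<Rightarrow> real \<Rightarrow> complex" where
  "trig_eval \<tau> t = (\<Sum>n\<in>Poly_Mapping.keys \<tau>. Poly_Mapping.lookup \<tau> n * trig_e n t)"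

definition trig_degree :: "trig_poly \<Rightarrow> nat" where
  "trig_degree \<tau> = Max (insert 0 ((\<lambda>n. nat \<bar>n\<bar>) ` Poly_Mapping.keys \<tau>))"

definition rational_trig_poly :: "trig_poly \<Rightarrow> bool" where
  "rational_trig_poly \<tau> \<longleftrightarrow>
    (\<forall>n. Re (Poly_Mapping.lookup \<tau> n) \<in> \<rat> \<and> Im (Poly_Mapping.lookup \<tau> n) \<in> \<rat>)"

text \<open>An algorithm outputs a rational trigonometric polynomial by outputting its degree and its
  coefficients; coefficient indices are coded by \<^const>\<open>int_decode\<close>.\<close>

definition computable_trig_poly_seq :: "(nat \<Rightarrow> trig_poly) \<Rightarrow> bool" where
  "computable_trig_poly_seq \<tau> \<longleftrightarrow>
    (\<forall>n. rational_trig_poly (\<tau> n)) \<and>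
    computable (\<lambda>n. trig_degree (\<tau> n)) \<and>
    (\<exists>a b. computable_rat2 a \<and> computable_rat2 b \<and>
      (\<forall>n j. Poly_Mapping.lookup (\<tau> n) (int_decode j) =
        Complex (real_of_rat (a n j)) (real_of_rat (b n j))))"

definition computable_vector :: "(real \<Rightarrow> complex) \<Rightarrow> bool" where
  "computable_vector f \<longleftrightarrow> f \<in> L1 \<and>
    (\<exists>\<tau>. computable_trig_poly_seq \<tau> \<and>
      (\<forall>k. L1_norm (\<lambda>t. f t - trig_eval (\<tau> k) t) < 1 / 2 ^ k))"

definition cauchy_name :: "(nat \<Rightarrow> trig_poly) \<Rightarrow> (real \<Rightarrow> complex) \<Rightarrow> bool" where
  "cauchy_name \<tau> f \<longleftrightarrow>
    (\<forall>n. rational_trig_poly (\<tau> n)) \<and>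
    (\<lambda>n. L1_norm (\<lambda>t. trig_eval (\<tau> n) t - f t)) \<longlonglongrightarrow> 0 \<and>
    (\<forall>n. L1_norm (\<lambda>t. trig_eval (\<tau> n) t - trig_eval (\<tau> (n + 1)) t) < 1 / 2 ^ (n + 1))"

definition computable_cauchy_name :: "(nat \<Rightarrow> trig_poly) \<Rightarrow> (real \<Rightarrow> complex) \<Rightarrow> bool" where
  "computable_cauchy_name \<tau> f \<longleftrightarrow> cauchy_name \<tau> f \<and> computable_trig_poly_seq \<tau>"

definition assigns_value :: "(nat \<Rightarrow> trig_poly) \<Rightarrow> real \<Rightarrow> complex \<Rightarrow> bool" where
  "assigns_value \<tau> t \<alpha> \<longleftrightarrow> (\<lambda>n. trig_eval (\<tau> (2 * n)) t) \<longlonglongrightarrow> \<alpha>"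

text \<open>\<open>canonical_value f t \<alpha>\<close>: \<open>\<alpha>\<close> is the value assigned to $f(t)$ by a computable Cauchy name
  of \<open>f\<close>. The second conjunct makes this well defined at Schnorr random \<open>t\<close>, where all computable
  Cauchy names must assign that value. At other points different names of the same \<open>f\<close> may assign
  different values or none. There the first conjunct alone is required: making canonical values
  unavailable at such points, or demanding agreement of all names there, would let the convergence
  condition fail for reasons that have nothing to do with Fourier series.\<close>

definition canonical_value :: "(real \<Rightarrow> complex) \<Rightarrow> real \<Rightarrow> complex \<Rightarrow> bool" where
  "canonical_value f t \<alpha> \<longleftrightarrow>
    (\<exists>\<tau>. computable_cauchy_name \<tau> f \<and> assigns_value \<tau> t \<alpha>) \<and>
    (schnorr_random t \<longrightarrow> (\<forall>\<tau>. computable_cauchy_name \<tau> f \<longrightarrow> assigns_value \<tau> t \<alpha>))"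

end

theory Submission
  imports Defs
begin

text \<open>Both directions go through a Solovay form of Schnorr tests, in which a point is captured by
  infinitely many stages of an effective sequence of finite unions of dyadic cells with
  geometrically small total length.

  If \<open>\<tau>\<close> is a computable Cauchy name, then \<open>p n = \<tau> (2 * n + 2) - \<tau> (2 * n)\<close> has norm at most \<open>4 ^ - n\<close>.
  The Cesaro means of \<open>p n\<close> at \<open>t\<close> are all dominated by a maximal function of \<open>p n\<close> at \<open>t\<close>, because the
  Fejer kernel is dominated by indicators of dyadically growing intervals. Replacing \<open>\<bar>p n\<bar>\<close> by a
  rational step function and intervals by dyadic ones makes the set where the maximal function
  exceeds \<open>2 ^ - n\<close> a finite union of cells computed from \<open>n\<close>, of measure \<open>O(2 ^ - n)\<close>. Hence at a
  Schnorr random point the values and all Cesaro means of \<open>p n\<close> are \<open>O(2 ^ - n)\<close> for large \<open>n\<close>, and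
  the sum over \<open>n\<close> gives the convergence of values and means to the same limit. The same argument
  applied to the difference of two names shows that they assign the same value.

  Conversely, each cell of a test carries a trigonometric polynomial with rational coefficients, a
  slightly perturbed Fejer kernel, whose real part is nonnegative everywhere and at least \<open>1 / 4\<close> on
  the cell, and whose norm is of the order of the length of the cell. The sum of all of them is a
  computable vector, and positivity of the Fejer kernel makes its Cesaro means unbounded at every
  point that lies in infinitely many cells.\<close>

section \<open>Effective functions\<close>

text \<open>What separates a Schnorr test from an arbitrary effective null set is that its measures
  are computable, and this shapes both directions. The exceptional set of a stage cannot merely be
  enumerated; it is decided exactly, cell by cell. All comparisons are therefore made between
  rational numbers: moduli give way to \<open>\<bar>Re\<bar> + \<bar>Im\<bar>\<close>, exponentials
  to rational powers, suprema over radii to finitely many dyadic blocks. In the opposite direction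
  the known measure tells when an inner approximation of a test component is nearly complete, so
  that whatever is added later is small.

  The even members of a name are used because a difference of norm \<open>O(4 ^ - n)\<close> against
  a threshold \<open>2 ^ - n\<close> leaves, by a weak type bound, a set of measure
  \<open>O(2 ^ - n)\<close>, which is summable.

  The windows are generous: \<open>\<bar>t\<bar> \<le> pi < 4\<close>, covering cells are kept in
  \<open>[-7, 7)\<close>, their neighbours in \<open>[-8, 8)\<close>, and the latter lies inside the
  three periods \<open>[- 3 * pi, 3 * pi]\<close>.\<close>

lemma computes_comp1: "computes g xs y \<Longrightarrow> computes f [y] z \<Longrightarrow> computes (Comp f [g]) xs z"
  by (rule computes.comp[of _ _ "[y]"]) auto

lemma computes_comp2:
  "computes g xs y \<Longrightarrow> computes h xs y' \<Longrightarrow> computes f [y, y'] z \<Longrightarrow> computes (Comp f [g, h]) xs z"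
  by (rule computes.comp[of _ _ "[y, y']"]) auto

lemma computes_proj: "i < length xs \<Longrightarrow> y = xs ! i \<Longrightarrow> computes (Proj i) xs y"
  by (simp add: computes.proj)

lemma computes_const: "\<exists>p. \<forall>xs. computes p xs k"
proof (induction k)
  case 0
  show ?case using computes.zero by blast
next
  case (Suc k)
  then obtain p where "\<forall>xs. computes p xs k" by blast
  then have "\<forall>xs. computes (Comp Succ [p]) xs (Suc k)"
    by (auto intro: computes_comp1 computes.succ)
  then show ?case by blast
qed

lemma computes_rec_nat:
  assumes "computes f xs a" "\<And>m y. computes g (m # y # xs) (b m y)"
  shows "computes (PrimRec f g) (n # xs) (rec_nat a b n)"
  using assms by (induction n) (auto intro: computes.primrec_0 computes.primrec_Suc)

section \<open>Total computable functions on natural numbers\<close>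

lemma computable_const: "computable (\<lambda>x. k)"
  unfolding computable_def using computes_const by blast

lemma computable_id: "computable (\<lambda>x. x)"
  unfolding computable_def by (intro exI[of _ "Proj 0"] allI computes_proj) auto

lemma computable_Suc: "computable Suc"
  unfolding computable_def by (auto intro: exI[of _ Succ] computes.succ)

lemma computable_compose: "computable f \<Longrightarrow> computable g \<Longrightarrow> computable (\<lambda>x. f (g x))"
  unfolding computable_def by (blast intro: computes_comp1)

lemma computable2_compose:
  "computable2 f \<Longrightarrow> computable g \<Longrightarrow> computable h \<Longrightarrow> computable (\<lambda>x. f (g x) (h x))"
  unfolding computable_def computable2_def by (blast intro: computes_comp2)

lemma computable2_const: "computable2 (\<lambda>x y. k)"
  unfolding computable2_def using computes_const by blast

lemma computable2_fst: "computable2 (\<lambda>x y. x)"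
  unfolding computable2_def by (intro exI[of _ "Proj 0"] allI computes_proj) auto

lemma computable2_snd: "computable2 (\<lambda>x y. y)"
  unfolding computable2_def by (intro exI[of _ "Proj 1"] allI computes_proj) auto

lemma computable2_compose1: "computable f \<Longrightarrow> computable2 g \<Longrightarrow> computable2 (\<lambda>x y. f (g x y))"
  unfolding computable_def computable2_def by (blast intro: computes_comp1)

lemma computable2_compose2:
  "computable2 f \<Longrightarrow> computable2 g \<Longrightarrow> computable2 h \<Longrightarrow> computable2 (\<lambda>x y. f (g x y) (h x y))"
proof -
  assume "computable2 f" "computable2 g" "computable2 h"
  then obtain p q r where "\<And>x y. computes p [x, y] (f x y)" "\<And>x y. computes q [x, y] (g x y)"
    "\<And>x y. computes r [x, y] (h x y)"
    unfolding computable2_def by blast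
  then have "computes (Comp p [q, r]) [x, y] (f (g x y) (h x y))" for x y
    by (blast intro: computes_comp2)
  then show ?thesis unfolding computable2_def by blast
qed

lemma computable_rec_nat: "computable2 b \<Longrightarrow> computable (rec_nat a b)"
  unfolding computable_def computable2_def using computes_const[of a]
  by (blast intro: computes_rec_nat)

lemma computable2_iterate:
  assumes "computable a" "computable b"
  shows "computable2 (\<lambda>n e. (b ^^ n) (a e))"
proof -
  from assms obtain p q where p: "\<And>e. computes p [e] (a e)" and q: "\<And>y. computes q [y] (b y)"
    unfolding computable_def by blast
  have "computes (PrimRec p (Comp q [Proj 1])) [n, e] (rec_nat (a e) (\<lambda>m y. b y) n)" for n e
    by (rule computes_rec_nat[OF p]) (rule computes_comp1[OF computes_proj q]; simp)
  moreover have "rec_nat (a e) (\<lambda>m y. b y) n = (b ^^ n) (a e)" for n e by (induction n) auto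
  ultimately show ?thesis unfolding computable2_def by auto
qed

lemma computable2_add: "computable2 (+)"
proof -
  have "(\<lambda>n e. (Suc ^^ n) e) = (+)" by (intro ext) simp
  then show ?thesis using computable2_iterate[OF computable_id computable_Suc] by simp
qed

lemma computable_pred: "computable (\<lambda>n. n - 1)"
proof -
  have "rec_nat 0 (\<lambda>m y. m) = (\<lambda>n. n - 1)" by (rule ext, case_tac n) auto
  then show ?thesis using computable_rec_nat[OF computable2_fst, of 0] by simp
qed

lemma computable2_diff: "computable2 (-)"
proof -
  have "((\<lambda>n. n - 1) ^^ n) e = e - n" for n e :: nat by (induction n) auto
  then have "computable2 (\<lambda>n e. e - n)"
    using computable2_iterate[OF computable_id computable_pred] by simp
  from computable2_compose2[OF this computable2_snd computable2_fst] show ?thesis by simp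
qed

lemma computable_triangle: "computable triangle"
proof -
  have "rec_nat 0 (\<lambda>m y. y + Suc m) n = triangle n" for n by (induction n) auto
  then have "rec_nat 0 (\<lambda>m y. y + Suc m) = triangle" by (rule ext)
  moreover have "computable (rec_nat 0 (\<lambda>m y. y + Suc m))"
    by (intro computable_rec_nat computable2_compose2[OF computable2_add] computable2_snd
        computable2_compose1[OF computable_Suc] computable2_fst)
  ultimately show ?thesis by simp
qed

lemma computable2_prod_encode: "computable2 (\<lambda>m n. prod_encode (m, n))"
  unfolding prod_encode_def prod.case
  by (intro computable2_compose2[OF computable2_add] computable2_compose1[OF computable_triangle]
      computable2_fst computable2_snd)

lemma prod_decode_diagonal:
  assumes "triangle s \<le> n" "n < triangle (Suc s)"
  shows "prod_decode n = (n - triangle s, s - (n - triangle s))"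
proof -
  have "prod_encode (n - triangle s, s - (n - triangle s)) = n"
    using assms by (simp add: prod_encode_def)
  then show ?thesis by (metis prod_encode_inverse)
qed

lemma computable_prod_decode:
  shows computable_fst_prod_decode: "computable (\<lambda>n. fst (prod_decode n))"
    and computable_snd_prod_decode: "computable (\<lambda>n. snd (prod_decode n))"
proof -
  \<comment> \<open>\<open>s n\<close> is the index of the antidiagonal on which \<open>n\<close>
    lies. It grows by one exactly when \<open>Suc m\<close> reaches the next triangle number: just
    then the inner truncated difference is \<open>0\<close>.\<close>
  define s where "s = rec_nat 0 (\<lambda>m y. y + (1 - (triangle (Suc y) - Suc m)))"
  have s: "computable s"
    unfolding s_def
    by (intro computable_rec_nat computable2_compose2[OF computable2_add]
        computable2_compose2[OF computable2_diff] computable2_const computable2_snd computable2_fst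
        computable2_compose1[OF computable_triangle] computable2_compose1[OF computable_Suc])
  have s_Suc: "s (Suc n) = (if triangle (Suc (s n)) \<le> Suc n then Suc (s n) else s n)" for n
    by (simp add: s_def del: triangle_Suc)
  have "triangle (s n) \<le> n \<and> n < triangle (Suc (s n))" for n
  proof (induction n)
    case 0
    show ?case by (simp add: s_def)
  next
    case (Suc n)
    then show ?case unfolding s_Suc by auto
  qed
  then have *: "prod_decode n = (n - triangle (s n), s n - (n - triangle (s n)))" for n
    by (blast intro: prod_decode_diagonal)
  show "computable (\<lambda>n. fst (prod_decode n))" "computable (\<lambda>n. snd (prod_decode n))"
    unfolding * fst_conv snd_conv
    by (intro computable2_compose[OF computable2_diff] computable_compose[OF computable_triangle]
        s computable_id)+
qed

text \<open>Parameter, counter and previous value are packed into one number, so that recursion with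
  a parameter is available for a unary step function.\<close>

lemma computable_rec_nat_param:
  assumes "computable a" "computable b" "computable N"
  shows "computable (\<lambda>x. rec_nat (a x) (\<lambda>m y. b (prod_encode (x, prod_encode (m, y)))) (N x))"
proof -
  from assms(1,2) computable2_prod_encode obtain p q r where
    p: "\<And>e. computes p [e] (a e)" and q: "\<And>y. computes q [y] (b y)"
    and r: "\<And>m n. computes r [m, n] (prod_encode (m, n))"
    unfolding computable_def computable2_def by blast
  have "computes (PrimRec p (Comp q [Comp r [Proj 2, Comp r [Proj 0, Proj 1]]])) [n, x]
    (rec_nat (a x) (\<lambda>m y. b (prod_encode (x, prod_encode (m, y)))) n)" for n x
    by (rule computes_rec_nat[OF p])
       (rule computes_comp1[OF computes_comp2[OF _ computes_comp2 r] q]; auto intro: computes_proj r)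
  then have "computable2 (\<lambda>n x. rec_nat (a x) (\<lambda>m y. b (prod_encode (x, prod_encode (m, y)))) n)"
    unfolding computable2_def by blast
  from computable2_compose[OF this assms(3) computable_id] show ?thesis .
qed

text \<open>Totality of \<open>F\<close> is what \<open>Mu\<close> asks for: every test before the
  least zero halts with a positive value.\<close>

lemma computable_Least:
  assumes "computable2 F" "\<And>e. \<exists>m. F m e = 0"
  shows "computable (\<lambda>e. LEAST m. F m e = 0)"
proof -
  from assms(1) obtain p where p: "\<And>m n. computes p [m, n] (F m n)"
    unfolding computable2_def by blast
  have "computes (Mu p) [e] (LEAST m. F m e = 0)" for e
  proof (rule computes.mu)
    show "computes p ((LEAST m. F m e = 0) # [e]) 0"
      using p[of "LEAST m. F m e = 0" e] LeastI_ex[OF assms(2)[of e]] by simp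
    show "\<forall>m<LEAST m. F m e = 0. \<exists>y. computes p (m # [e]) (Suc y)"
    proof (intro allI impI)
      fix m assume "m < (LEAST m. F m e = 0)"
      then have "F m e \<noteq> 0" by (rule not_less_Least)
      then show "\<exists>y. computes p (m # [e]) (Suc y)" using p[of m e] by (auto simp: gr0_conv_Suc)
    qed
  qed
  then show ?thesis unfolding computable_def by blast
qed


section \<open>Effective functions between coded types\<close>

class coded =
  fixes enc :: "'a \<Rightarrow> nat"
  assumes inj_enc: "inj enc"

instantiation nat :: coded
begin
definition enc_nat :: "nat \<Rightarrow> nat" where [simp]: "enc_nat n = n"
instance by standard (simp add: inj_def)
end

instantiation int :: coded
begin
definition enc_int :: "int \<Rightarrow> nat" where "enc_int = int_encode"
instance by standard (simp add: enc_int_def inj_int_encode)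
end

instantiation bool :: coded
begin
definition enc_bool :: "bool \<Rightarrow> nat" where [simp]: "enc_bool b = of_bool b"
instance by standard (simp add: inj_def)
end

instantiation prod :: (coded, coded) coded
begin
definition enc_prod :: "'a \<times> 'b \<Rightarrow> nat" where
  [simp]: "enc_prod x = prod_encode (enc (fst x), enc (snd x))"
instance by standard (auto simp: inj_def inj_eq[OF inj_enc])
end

text \<open>The tracking function is total on all numbers but unconstrained off the codes. Functions
  of several arguments are treated as functions on pairs, which is why the closure rules speak of
  \<open>fst x\<close> and \<open>snd x\<close>.\<close>

definition effective :: "('a::coded \<Rightarrow> 'b::coded) \<Rightarrow> bool" where
  "effective f \<longleftrightarrow> (\<exists>g. computable g \<and> (\<forall>x. g (enc x) = enc (f x)))"

named_theorems eff

lemma effectiveI: "computable g \<Longrightarrow> (\<And>x. g (enc x) = enc (f x)) \<Longrightarrow> effective f"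
  unfolding effective_def by blast

lemma effective_const [eff]: "effective (\<lambda>e. k)"
  by (rule effectiveI[OF computable_const]) simp

lemma effective_id [eff]: "effective (\<lambda>e. e)"
  by (rule effectiveI[OF computable_id]) simp

lemma effective_compose:
  assumes "effective f" "effective g"
  shows "effective (\<lambda>e. f (g e))"
proof -
  from assms obtain F G where "computable F" "\<And>x. F (enc x) = enc (f x)"
    "computable G" "\<And>x. G (enc x) = enc (g x)"
    unfolding effective_def by blast
  then show ?thesis by (auto intro!: effectiveI[OF computable_compose, of F G])
qed

lemma effective_fst [eff]: "effective f \<Longrightarrow> effective (\<lambda>e. fst (f e))"
  by (rule effective_compose[of fst]) (auto intro: effectiveI[OF computable_fst_prod_decode])

lemma effective_snd [eff]: "effective f \<Longrightarrow> effective (\<lambda>e. snd (f e))"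
  by (rule effective_compose[of snd]) (auto intro: effectiveI[OF computable_snd_prod_decode])

lemma effective_Pair [eff]:
  assumes "effective f" "effective g"
  shows "effective (\<lambda>e. (f e, g e))"
proof -
  from assms obtain F G where "computable F" "\<And>x. F (enc x) = enc (f x)"
    "computable G" "\<And>x. G (enc x) = enc (g x)"
    unfolding effective_def by blast
  then show ?thesis
    by (intro effectiveI[OF computable2_compose[OF computable2_prod_encode], of F G]) auto
qed

lemma effective_compose2:
  assumes "effective (\<lambda>x. f (fst x) (snd x))" "effective a" "effective b"
  shows "effective (\<lambda>e. f (a e) (b e))"
  using effective_compose[OF assms(1) effective_Pair[OF assms(2,3)]] by simp

lemma effective_rec_nat [eff]:
  assumes "effective a" "effective N" "effective (\<lambda>x. b (fst x) (fst (snd x)) (snd (snd x)))"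
  shows "effective (\<lambda>e. rec_nat (a e) (b e) (N e))"
proof -
  from assms obtain A M B where 1: "computable A" "\<And>x. A (enc x) = enc (a x)"
    "computable M" "\<And>x. M (enc x) = enc (N x)" "computable B"
    and B: "\<And>x. B (enc x) = enc (b (fst x) (fst (snd x)) (snd (snd x)))"
    unfolding effective_def by blast
  have B': "B (prod_encode (enc e, prod_encode (m, enc y))) = enc (b e m y)" for e m y
    using B[of "(e, m, y)"] by simp
  have "rec_nat (enc (a e)) (\<lambda>m y. B (prod_encode (enc e, prod_encode (m, y)))) n
      = enc (rec_nat (a e) (b e) n)" for e n
    by (induction n) (auto simp: B')
  then show ?thesis
    by (intro effectiveI[OF computable_rec_nat_param[OF 1(1,5,3)]]) (simp add: 1)
qed

lemma effective_computable: "computable f \<Longrightarrow> effective a \<Longrightarrow> effective (\<lambda>e. f (a e))"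
  by (rule effective_compose[of f]) (auto intro: effectiveI)

lemma effective_computable2:
  assumes "computable2 f" "effective a" "effective b"
  shows "effective (\<lambda>e. f (a e) (b e))"
proof (rule effective_compose2[OF _ assms(2,3)])
  have "computable (\<lambda>n. f (fst (prod_decode n)) (snd (prod_decode n)))"
    by (intro computable2_compose[OF assms(1)] computable_prod_decode)
  then show "effective (\<lambda>x. f (fst x) (snd x))" by (rule effectiveI) simp
qed

lemma effective_imp_computable: "effective f \<Longrightarrow> computable f"
  for f :: "nat \<Rightarrow> nat"
  unfolding effective_def by (metis enc_nat_def ext)

lemma effective_imp_computable2:
  fixes f :: "nat \<Rightarrow> nat \<Rightarrow> nat"
  assumes "effective (\<lambda>x. f (fst x) (snd x))"
  shows "computable2 f"
proof -
  from assms obtain g where g: "computable g" "\<And>x. g (enc x) = f (fst x) (snd x)"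
    unfolding effective_def by auto
  have "g (prod_encode (m, n)) = f m n" for m n using g(2)[of "(m, n)"] by simp
  then show ?thesis using computable2_compose1[OF g(1) computable2_prod_encode] by simp
qed

lemma effective_Suc [eff]: "effective a \<Longrightarrow> effective (\<lambda>e. Suc (a e))"
  by (rule effective_computable[OF computable_Suc])

lemma effective_add_nat [eff]: "effective a \<Longrightarrow> effective b \<Longrightarrow> effective (\<lambda>e. a e + b e :: nat)"
  by (rule effective_computable2[OF computable2_add])

lemma effective_diff_nat [eff]: "effective a \<Longrightarrow> effective b \<Longrightarrow> effective (\<lambda>e. a e - b e :: nat)"
  by (rule effective_computable2[OF computable2_diff])

lemma effective_mult_nat [eff]:
  assumes "effective a" "effective b"
  shows "effective (\<lambda>e. a e * b e :: nat)"
proof -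
  have "rec_nat 0 (\<lambda>_ y. y + n) m = m * n" for m n :: nat by (induction m) auto
  moreover have "effective (\<lambda>e. rec_nat 0 (\<lambda>_ y. y + b e) (a e))"
    by (intro eff assms effective_compose[OF assms(2)])
  ultimately show ?thesis by simp
qed

lemma effective_power_nat [eff]:
  assumes "effective a" "effective b"
  shows "effective (\<lambda>e. a e ^ b e :: nat)"
proof -
  have "rec_nat 1 (\<lambda>_ y. y * n) m = n ^ m" for m n :: nat by (induction m) auto
  moreover have "effective (\<lambda>e. rec_nat 1 (\<lambda>_ y. y * a e) (b e))"
    by (intro eff assms effective_compose[OF assms(1)])
  ultimately show ?thesis by simp
qed

text \<open>The conditional is a recursion of length \<open>of_bool (c e)\<close>: no step returns
  \<open>g e\<close>, one step replaces it by \<open>f e\<close>.\<close>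

lemma effective_if [eff]:
  assumes "effective c" "effective f" "effective g"
  shows "effective (\<lambda>e. if c e then f e else g e)"
proof -
  from assms(1) have "effective (\<lambda>e. of_bool (c e) :: nat)" by (simp add: effective_def)
  from effective_rec_nat[OF assms(3) this, of "\<lambda>e m y. f e"]
  have "effective (\<lambda>e. rec_nat (g e) (\<lambda>m y. f e) (of_bool (c e)))"
    by (simp add: effective_compose[OF assms(2)] eff)
  then show ?thesis by (rule back_subst[of effective]) auto
qed

lemma effective_le_nat [eff]:
  assumes "effective a" "effective b"
  shows "effective (\<lambda>e. a e \<le> (b e :: nat))"
proof -
  have "effective (\<lambda>e. 1 - (a e - b e))" by (intro eff assms)
  moreover have "1 - (a e - b e) = of_bool (a e \<le> b e)" for e by auto
  ultimately show ?thesis by (simp add: effective_def)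
qed

lemma effective_less_nat [eff]:
  "effective a \<Longrightarrow> effective b \<Longrightarrow> effective (\<lambda>e. a e < (b e :: nat))"
  unfolding Suc_le_eq[symmetric] by (intro eff)

lemma effective_not [eff]:
  assumes "effective c"
  shows "effective (\<lambda>e. \<not> c e)"
proof -
  have "(\<lambda>e. \<not> c e) = (\<lambda>e. if c e then False else True)" by auto
  then show ?thesis by (simp only: effective_if assms effective_const)
qed

lemma effective_conj [eff]:
  assumes "effective c" "effective d"
  shows "effective (\<lambda>e. c e \<and> d e)"
proof -
  have "(\<lambda>e. c e \<and> d e) = (\<lambda>e. if c e then d e else False)" by auto
  then show ?thesis by (simp only: effective_if assms effective_const)
qed

lemma effective_disj [eff]:
  assumes "effective c" "effective d"
  shows "effective (\<lambda>e. c e \<or> d e)"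
proof -
  have "(\<lambda>e. c e \<or> d e) = (\<lambda>e. if c e then True else d e)" by auto
  then show ?thesis by (simp only: effective_if assms effective_const)
qed

lemma effective_imp [eff]: "effective c \<Longrightarrow> effective d \<Longrightarrow> effective (\<lambda>e. c e \<longrightarrow> d e)"
  unfolding imp_conv_disj by (intro eff)

lemma effective_eq_nat [eff]:
  "effective a \<Longrightarrow> effective b \<Longrightarrow> effective (\<lambda>e. a e = (b e :: nat))"
  unfolding eq_iff by (intro eff)

lemma effective_ex_less [eff]:
  fixes P :: "'a::coded \<Rightarrow> nat \<Rightarrow> bool"
  assumes "effective N" "effective (\<lambda>x. P (fst x) (snd x))"
  shows "effective (\<lambda>e. \<exists>i<N e. P e i)"
proof -
  have "rec_nat False (\<lambda>m y. y \<or> P e m) n = (\<exists>i<n. P e i)" for e n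
    by (induction n) (auto simp: less_Suc_eq)
  moreover have "effective (\<lambda>e. rec_nat False (\<lambda>m y. y \<or> P e m) (N e))"
    by (intro eff assms effective_compose2[OF assms(2)])
  ultimately show ?thesis by simp
qed

lemma effective_ex_le [eff]:
  "effective N \<Longrightarrow> effective (\<lambda>x. P (fst x) (snd x)) \<Longrightarrow> effective (\<lambda>e. \<exists>i\<le>N e. P e i)"
  for P :: "'a::coded \<Rightarrow> nat \<Rightarrow> bool"
  unfolding less_Suc_eq_le[symmetric] by (intro eff)

lemma effective_all_less [eff]:
  fixes P :: "'a::coded \<Rightarrow> nat \<Rightarrow> bool"
  assumes "effective N" "effective (\<lambda>x. P (fst x) (snd x))"
  shows "effective (\<lambda>e. \<forall>i<N e. P e i)"
proof -
  have "effective (\<lambda>e. \<not> (\<exists>i<N e. \<not> P e i))" by (intro eff assms)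
  then show ?thesis by simp
qed

lemma effective_sum_nat [eff]:
  fixes f :: "'a::coded \<Rightarrow> nat \<Rightarrow> nat"
  assumes "effective N" "effective (\<lambda>x. f (fst x) (snd x))"
  shows "effective (\<lambda>e. \<Sum>i<N e. f e i)"
proof -
  have "rec_nat 0 (\<lambda>m y. y + f e m) n = (\<Sum>i<n. f e i)" for e n by (induction n) auto
  moreover have "effective (\<lambda>e. rec_nat 0 (\<lambda>m y. y + f e m) (N e))"
    by (intro eff assms effective_compose2[OF assms(2)])
  ultimately show ?thesis by simp
qed

text \<open>Surjectivity of the encoding matters in \<open>effective_Least\<close>: on a number that is not a code the
  unbounded search might not terminate, whereas \<^const>\<open>effective\<close> asks for a total function.\<close>

lemma surj_enc_nat_nat: "surj (enc :: nat \<times> nat \<Rightarrow> nat)"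
  using surj_prod_encode by (simp add: surj_def)

lemma effective_Least:
  fixes P :: "'a::coded \<Rightarrow> nat \<Rightarrow> bool"
  assumes "surj (enc :: 'a \<Rightarrow> nat)"
    and "effective (\<lambda>x. P (fst x) (snd x))" "\<And>e. \<exists>n. P e n"
  shows "effective (\<lambda>e. LEAST n. P e n)"
proof -
  have "effective (\<lambda>x. \<not> P (fst x) (snd x))" by (intro eff assms)
  then obtain g where g: "computable g" "\<And>x. g (enc x) = enc (\<not> P (fst x) (snd x))"
    unfolding effective_def by blast
  have g': "g (prod_encode (enc e, n)) = 0 \<longleftrightarrow> P e n" for e n using g(2)[of "(e, n)"] by simp
  have "computable (\<lambda>c. LEAST n. g (prod_encode (c, n)) = 0)"
  proof (rule computable_Least)
    show "computable2 (\<lambda>n c. g (prod_encode (c, n)))"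
      by (intro computable2_compose1[OF g(1)] computable2_compose2[OF computable2_prod_encode]
          computable2_fst computable2_snd)
    fix c
    obtain e :: 'a where "c = enc e" using assms(1) by (metis surjD)
    then show "\<exists>n. g (prod_encode (c, n)) = 0" using assms(3)[of e] by (auto simp: g')
  qed
  then show ?thesis by (rule effectiveI) (simp add: g')
qed

text \<open>The quotient is found by search for the least \<open>q\<close> with
  \<open>m < Suc q * n\<close>. The disjunct \<open>n = 0\<close> keeps the search finite and
  reproduces \<open>m div 0 = 0\<close>.\<close>

lemma effective_div_nat [eff]:
  assumes "effective a" "effective b"
  shows "effective (\<lambda>e. a e div b e :: nat)"
proof (rule effective_compose2[OF _ assms])
  have "m div n = (LEAST q. n = 0 \<or> m < Suc q * n)" for m n :: nat
  proof (cases "n = 0")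
    case False
    show ?thesis
    proof (rule Least_equality[symmetric])
      show "n = 0 \<or> m < Suc (m div n) * n" using False dividend_less_div_times[of n m] by simp
      fix q assume "n = 0 \<or> m < Suc q * n"
      then have "m div n < Suc q" using False by (simp add: less_mult_imp_div_less)
      then show "m div n \<le> q" by simp
    qed
  qed simp
  moreover have "effective (\<lambda>x. LEAST q. snd x = 0 \<or> fst x < Suc q * snd x)"
  proof (rule effective_Least[OF surj_enc_nat_nat])
    fix x :: "nat \<times> nat"
    have "snd x = 0 \<or> fst x < Suc (fst x) * snd x" by (cases "snd x") auto
    then show "\<exists>q. snd x = 0 \<or> fst x < Suc q * snd x" by blast
  qed (intro eff)
  ultimately show "effective (\<lambda>x. fst x div snd x :: nat)" by simp
qed

lemma effective_enc_iff: "effective (\<lambda>x. enc (f x)) \<longleftrightarrow> effective f"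
  by (simp add: effective_def)

text \<open>Integer arithmetic is reduced to naturals by splitting into positive and negative parts,
  which are reassembled here. Under \<open>int_encode\<close> even numbers code the nonnegative
  integers and odd numbers the negative ones.\<close>

lemma effective_int_diff:
  assumes "effective a" "effective b"
  shows "effective (\<lambda>e. int (a e) - int (b e))"
proof -
  have "enc (int m - int n) = (if n \<le> m then 2 * (m - n) else 2 * (n - m) - 1)" for m n
    by (auto simp: enc_int_def int_encode_def sum_encode_def nat_diff_distrib of_nat_diff)
  then have "effective (\<lambda>e. enc (int (a e) - int (b e)))" by (simp only:) (intro eff assms)
  then show ?thesis by (simp add: effective_enc_iff)
qed

lemma effective_of_nat_int [eff]: "effective a \<Longrightarrow> effective (\<lambda>e. int (a e))"
  using effective_int_diff[of a "\<lambda>e. 0"] effective_const by auto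

lemma effective_nat [eff]:
  assumes "effective a"
  shows "effective (\<lambda>e. nat (a e))"
proof (rule effective_compose[OF _ assms])
  have "computable (\<lambda>c. if c - 2 * (c div 2) = 0 then c div 2 else 0)"
    by (rule effective_imp_computable) (intro eff)
  then show "effective nat"
    by (rule effectiveI) (auto simp: enc_int_def int_encode_def sum_encode_def)
qed

lemma effective_nat_uminus:
  assumes "effective a"
  shows "effective (\<lambda>e. nat (- a e))"
proof (rule effective_compose[OF _ assms])
  have "computable (\<lambda>c. if c - 2 * (c div 2) = 0 then 0 else Suc (c div 2))"
    by (rule effective_imp_computable) (intro eff)
  then show "effective (\<lambda>i. nat (- i))"
    by (rule effectiveI) (auto simp: enc_int_def int_encode_def sum_encode_def)
qed

lemma effective_add_int [eff]:
  assumes "effective a" "effective b"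
  shows "effective (\<lambda>e. a e + b e :: int)"
proof -
  have "a e + b e = int (nat (a e) + nat (b e)) - int (nat (- a e) + nat (- b e))" for e by simp
  then show ?thesis
    by (simp only:) (intro eff effective_int_diff effective_nat_uminus assms)
qed

lemma effective_uminus_int [eff]:
  assumes "effective a"
  shows "effective (\<lambda>e. - a e :: int)"
proof -
  have "effective (\<lambda>e. int (nat (- a e)) - int (nat (a e)))"
    by (intro eff effective_int_diff effective_nat_uminus assms)
  then show ?thesis by (rule back_subst[of effective]) auto
qed

lemma effective_diff_int [eff]:
  "effective a \<Longrightarrow> effective b \<Longrightarrow> effective (\<lambda>e. a e - b e :: int)"
  unfolding diff_conv_add_uminus by (intro eff)

lemma effective_mult_int [eff]:
  assumes "effective a" "effective b"
  shows "effective (\<lambda>e. a e * b e :: int)"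
proof -
  have "a e * b e = int (nat (a e) * nat (b e) + nat (- a e) * nat (- b e))
      - int (nat (a e) * nat (- b e) + nat (- a e) * nat (b e))" for e
    by (cases "a e \<ge> 0"; cases "b e \<ge> 0") (simp_all add: algebra_simps)
  then show ?thesis
    by (simp only:) (intro eff effective_int_diff effective_nat_uminus assms)
qed

lemma effective_le_int [eff]:
  assumes "effective a" "effective b"
  shows "effective (\<lambda>e. a e \<le> (b e :: int))"
proof -
  have "a e \<le> b e \<longleftrightarrow> nat (a e - b e) = 0" for e by simp
  then show ?thesis by (simp only:) (intro eff assms)
qed

lemma effective_less_int [eff]:
  "effective a \<Longrightarrow> effective b \<Longrightarrow> effective (\<lambda>e. a e < (b e :: int))"
  unfolding not_le[symmetric] by (intro eff)

lemma effective_eq_int [eff]: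
  "effective a \<Longrightarrow> effective b \<Longrightarrow> effective (\<lambda>e. a e = (b e :: int))"
  unfolding eq_iff by (intro eff)

lemma effective_power_int [eff]:
  assumes "effective a" "effective b"
  shows "effective (\<lambda>e. a e ^ b e :: int)"
proof -
  have "rec_nat 1 (\<lambda>_ y. y * n) m = n ^ m" for m and n :: int by (induction m) auto
  moreover have "effective (\<lambda>e. rec_nat 1 (\<lambda>_ y. y * a e) (b e))"
    by (intro eff assms effective_compose[OF assms(1)])
  ultimately show ?thesis by simp
qed

lemma effective_abs_int [eff]: "effective a \<Longrightarrow> effective (\<lambda>e. \<bar>a e :: int\<bar>)"
  unfolding abs_if by (intro eff)

lemma effective_sgn_int [eff]: "effective a \<Longrightarrow> effective (\<lambda>e. sgn (a e :: int))"
  unfolding sgn_if by (intro eff)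

lemma effective_int_decode [eff]: "effective a \<Longrightarrow> effective (\<lambda>e. int_decode (a e))"
  using effective_enc_iff[of "\<lambda>e. int_decode (a e)"] by (simp add: enc_int_def)

lemma effective_int_encode [eff]: "effective a \<Longrightarrow> effective (\<lambda>e. int_encode (a e))"
  using effective_enc_iff[of a] by (simp add: enc_int_def)

lemma effective_prod_encode [eff]:
  "effective a \<Longrightarrow> effective (\<lambda>e. prod_encode (a e))"
  by (rule effective_compose[of prod_encode])
     (auto intro!: effectiveI[OF computable_id])

lemma effective_prod_decode [eff]: "effective a \<Longrightarrow> effective (\<lambda>e. prod_decode (a e))"
  by (rule effective_compose[of prod_decode])
     (auto intro!: effectiveI[OF computable_id])

section \<open>Exact rational arithmetic\<close>

text \<open>The second component stores the denominator minus one, so that every coded pair is a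
  legitimate fraction. Fractions are never reduced.\<close>

definition ratio :: "int \<times> nat \<Rightarrow> real" where
  "ratio p = of_int (fst p) / real (Suc (snd p))"

text \<open>Only rational-valued functions are \<open>effective_real\<close>: their values are computed exactly, which keeps
  comparisons decidable.\<close>

definition effective_real :: "('a::coded \<Rightarrow> real) \<Rightarrow> bool" where
  "effective_real F \<longleftrightarrow> (\<exists>g. effective g \<and> (\<forall>e. F e = ratio (g e)))"

lemma effective_realI:
  assumes "effective a" "effective b" "\<And>e. b e > 0" "\<And>e. F e = of_int (a e) / real (b e)"
  shows "effective_real F"
proof -
  have "effective (\<lambda>e. (a e, b e - 1))" by (intro eff assms)
  moreover have "F e = ratio (a e, b e - 1)" for e using assms(3,4)[of e] by (simp add: ratio_def)
  ultimately show ?thesis unfolding effective_real_def by blast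
qed

lemma effective_realE:
  assumes "effective_real F"
  obtains a b where "effective a" "effective b" "\<And>e. b e > 0" "\<And>e. F e = of_int (a e) / real (b e)"
proof -
  from assms obtain g where "effective g" "\<And>e. F e = ratio (g e)"
    unfolding effective_real_def by blast
  then show ?thesis using that[of "\<lambda>e. fst (g e)" "\<lambda>e. Suc (snd (g e))"]
    by (auto simp: ratio_def eff)
qed

lemma effective_real_compose:
  assumes "effective_real F" "effective g"
  shows "effective_real (\<lambda>e. F (g e))"
proof -
  from assms(1) obtain h where "effective h" "\<And>e. F e = ratio (h e)"
    unfolding effective_real_def by blast
  then show ?thesis unfolding effective_real_def using effective_compose[OF _ assms(2)] by blast
qed

lemma effective_real_compose2:
  assumes "effective_real (\<lambda>x. F (fst x) (snd x))" "effective a" "effective b"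
  shows "effective_real (\<lambda>e. F (a e) (b e))"
  using effective_real_compose[OF assms(1) effective_Pair[OF assms(2,3)]] by simp

lemma effective_real_of_int [eff]: "effective a \<Longrightarrow> effective_real (\<lambda>e. of_int (a e))"
  by (rule effective_realI[of a "\<lambda>e. 1"]) (auto simp: eff)

lemma effective_real_of_nat [eff]: "effective a \<Longrightarrow> effective_real (\<lambda>e. real (a e))"
  using effective_real_of_int[of "\<lambda>e. int (a e)"] by (simp add: eff)

lemma effective_real_numerals [eff]:
  "effective_real (\<lambda>e. 0)" "effective_real (\<lambda>e. 1)" "effective_real (\<lambda>e. numeral k)"
  using effective_real_of_nat[of "\<lambda>e. 0"] effective_real_of_nat[of "\<lambda>e. 1"]
    effective_real_of_nat[of "\<lambda>e. numeral k"] by (simp_all add: eff)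

lemma effective_real_add [eff]:
  assumes "effective_real F" "effective_real G"
  shows "effective_real (\<lambda>e. F e + G e)"
proof -
  obtain a b where 1: "effective a" "effective b" "\<And>e. b e > 0" "\<And>e. F e = of_int (a e) / real (b e)"
    using assms(1) by (rule effective_realE) (rule that; simp)
  obtain c d where 2: "effective c" "effective d" "\<And>e. d e > 0" "\<And>e. G e = of_int (c e) / real (d e)"
    using assms(2) by (rule effective_realE) (rule that; simp)
  show ?thesis
    by (rule effective_realI[of "\<lambda>e. a e * int (d e) + c e * int (b e)" "\<lambda>e. b e * d e"])
       (intro eff 1 2 | use 1(3) 2(3) in \<open>simp add: 1(4) 2(4) add_frac_eq\<close>)+
qed

lemma effective_real_mult [eff]:
  assumes "effective_real F" "effective_real G"
  shows "effective_real (\<lambda>e. F e * G e)"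
proof -
  obtain a b where 1: "effective a" "effective b" "\<And>e. b e > 0" "\<And>e. F e = of_int (a e) / real (b e)"
    using assms(1) by (rule effective_realE) (rule that; simp)
  obtain c d where 2: "effective c" "effective d" "\<And>e. d e > 0" "\<And>e. G e = of_int (c e) / real (d e)"
    using assms(2) by (rule effective_realE) (rule that; simp)
  show ?thesis
    by (rule effective_realI[of "\<lambda>e. a e * c e" "\<lambda>e. b e * d e"])
       (intro eff 1 2 | use 1(3) 2(3) in \<open>simp add: 1(4) 2(4)\<close>)+
qed

lemma effective_real_uminus [eff]: "effective_real F \<Longrightarrow> effective_real (\<lambda>e. - F e)"
  using effective_real_mult[OF effective_real_of_int[OF effective_const[of "-1"]], of F] by simp

lemma effective_real_diff [eff]:
  "effective_real F \<Longrightarrow> effective_real G \<Longrightarrow> effective_real (\<lambda>e. F e - G e)"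
  unfolding diff_conv_add_uminus by (intro eff)

text \<open>The sign moves to the numerator; at zero the fraction \<open>0 / 1\<close> reproduces
  \<open>inverse 0 = 0\<close>.\<close>

lemma effective_real_inverse [eff]:
  assumes "effective_real F"
  shows "effective_real (\<lambda>e. inverse (F e))"
proof -
  obtain a b where 1: "effective a" "effective b" "\<And>e. b e > 0" "\<And>e. F e = of_int (a e) / real (b e)"
    using assms(1) by (rule effective_realE) (rule that; simp)
  have "inverse (F e) = of_int (sgn (a e) * int (b e)) / real (if a e = 0 then 1 else nat \<bar>a e\<bar>)" for e
    by (auto simp: 1(4) sgn_if)
  then show ?thesis
    by (intro effective_realI[of "\<lambda>e. sgn (a e) * int (b e)" "\<lambda>e. if a e = 0 then 1 else nat \<bar>a e\<bar>"] eff 1)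
      auto
qed

lemma effective_real_divide [eff]:
  "effective_real F \<Longrightarrow> effective_real G \<Longrightarrow> effective_real (\<lambda>e. F e / G e)"
  unfolding divide_inverse by (intro eff)

lemma effective_real_power [eff]:
  assumes "effective_real F" "effective n"
  shows "effective_real (\<lambda>e. F e ^ n e)"
proof -
  obtain a b where 1: "effective a" "effective b" "\<And>e. b e > 0" "\<And>e. F e = of_int (a e) / real (b e)"
    using assms(1) by (rule effective_realE) (rule that; simp)
  show ?thesis
    by (rule effective_realI[of "\<lambda>e. a e ^ n e" "\<lambda>e. b e ^ n e"])
       (intro eff 1 assms(2) | use 1(3) in \<open>simp add: 1(4) power_divide\<close>)+
qed

lemma effective_real_if [eff]:
  assumes "effective c" "effective_real F" "effective_real G"
  shows "effective_real (\<lambda>e. if c e then F e else G e)"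
proof -
  have "effective_real (\<lambda>e. real (if c e then 1 else 0) * F e + real (if c e then 0 else 1) * G e)"
    by (intro eff assms)
  then show ?thesis by (rule back_subst[of effective_real]) auto
qed

lemma effective_le_real [eff]:
  assumes "effective_real F" "effective_real G"
  shows "effective (\<lambda>e. F e \<le> G e)"
proof -
  obtain a b where 1: "effective a" "effective b" "\<And>e. b e > 0" "\<And>e. F e = of_int (a e) / real (b e)"
    using assms(1) by (rule effective_realE) (rule that; simp)
  obtain c d where 2: "effective c" "effective d" "\<And>e. d e > 0" "\<And>e. G e = of_int (c e) / real (d e)"
    using assms(2) by (rule effective_realE) (rule that; simp)
  have "F e \<le> G e \<longleftrightarrow> a e * int (d e) \<le> c e * int (b e)" for e
  proof -
    have "F e \<le> G e \<longleftrightarrow> of_int (a e) * real (d e) \<le> of_int (c e) * real (b e)"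
      using 1(3)[of e] 2(3)[of e] by (simp add: 1(4) 2(4) field_simps)
    also have "\<dots> \<longleftrightarrow> real_of_int (a e * int (d e)) \<le> real_of_int (c e * int (b e))" by simp
    finally show ?thesis by (simp only: of_int_le_iff)
  qed
  then show ?thesis by (simp only:) (intro eff 1 2)
qed

lemma effective_less_real [eff]:
  "effective_real F \<Longrightarrow> effective_real G \<Longrightarrow> effective (\<lambda>e. F e < G e)"
  unfolding not_le[symmetric] by (intro eff)

lemma effective_eq_real [eff]:
  "effective_real F \<Longrightarrow> effective_real G \<Longrightarrow> effective (\<lambda>e. F e = G e)"
  unfolding eq_iff by (intro eff)

lemma effective_real_abs [eff]: "effective_real F \<Longrightarrow> effective_real (\<lambda>e. \<bar>F e\<bar>)"
  unfolding abs_if by (intro eff)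

lemma effective_real_sum [eff]:
  fixes F :: "'a::coded \<Rightarrow> nat \<Rightarrow> real"
  assumes "effective N" "effective_real (\<lambda>x. F (fst x) (snd x))"
  shows "effective_real (\<lambda>e. \<Sum>i<N e. F e i)"
proof -
  from assms(2) obtain g where g: "effective g" and g': "\<And>x. F (fst x) (snd x) = ratio (g x)"
    unfolding effective_real_def by blast
  \<comment> \<open>Recursion needs a coded type, so partial sums are accumulated as fractions and
    evaluated by \<open>ratio\<close> only at the end.\<close>
  define add :: "int \<times> nat \<Rightarrow> int \<times> nat \<Rightarrow> int \<times> nat" where
    "add p q = (fst p * int (Suc (snd q)) + fst q * int (Suc (snd p)), Suc (snd p) * Suc (snd q) - 1)" for p q
  have add: "ratio (add p q) = ratio p + ratio q" for p q
    by (simp add: add_def ratio_def add_frac_eq) (simp add: algebra_simps)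
  have "(\<Sum>i<n. F e i) = ratio (rec_nat (0, 0) (\<lambda>m y. add y (g (e, m))) n)" for e n
    using g'[of "(e, _)"] by (induction n) (auto simp: add ratio_def[of "(0, 0)"])
  moreover have "effective (\<lambda>e. rec_nat (0, 0) (\<lambda>m y. add y (g (e, m))) (N e))"
    unfolding add_def by (intro eff assms(1) effective_compose[OF g])
  ultimately show ?thesis unfolding effective_real_def by blast
qed

section \<open>Arithmetic of complex numbers with rational parts\<close>

definition effective_complex :: "('a::coded \<Rightarrow> complex) \<Rightarrow> bool" where
  "effective_complex F \<longleftrightarrow> effective_real (\<lambda>e. Re (F e)) \<and> effective_real (\<lambda>e. Im (F e))"

lemma effective_complex_compose: 
  "effective_complex F \<Longrightarrow> effective g \<Longrightarrow> effective_complex (\<lambda>e. F (g e))"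
  unfolding effective_complex_def by (auto dest: effective_real_compose[of _ g])

lemma effective_complex_compose2:
  assumes "effective_complex (\<lambda>x. F (fst x) (snd x))" "effective a" "effective b"
  shows "effective_complex (\<lambda>e. F (a e) (b e))"
  using effective_complex_compose[OF assms(1) effective_Pair[OF assms(2,3)]] by simp

lemma effective_complex_of_real [eff]:
  "effective_real F \<Longrightarrow> effective_complex (\<lambda>e. of_real (F e))"
  by (simp add: effective_complex_def eff)

lemma effective_complex_Complex [eff]:
  "effective_real F \<Longrightarrow> effective_real G \<Longrightarrow> effective_complex (\<lambda>e. Complex (F e) (G e))"
  by (simp add: effective_complex_def)

lemma effective_complex_add [eff]:
  "effective_complex F \<Longrightarrow> effective_complex G \<Longrightarrow> effective_complex (\<lambda>e. F e + G e)"
  by (simp add: effective_complex_def eff)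

lemma effective_complex_diff [eff]:
  "effective_complex F \<Longrightarrow> effective_complex G \<Longrightarrow> effective_complex (\<lambda>e. F e - G e)"
  by (simp add: effective_complex_def eff)

lemma effective_complex_mult [eff]:
  "effective_complex F \<Longrightarrow> effective_complex G \<Longrightarrow> effective_complex (\<lambda>e. F e * G e)"
  by (simp add: effective_complex_def eff)

lemma effective_complex_if [eff]:
  "effective c \<Longrightarrow> effective_complex F \<Longrightarrow> effective_complex G
    \<Longrightarrow> effective_complex (\<lambda>e. if c e then F e else G e)"
  by (simp add: effective_complex_def if_distrib[of Re] if_distrib[of Im] eff)

lemma effective_complex_sum [eff]:
  fixes F :: "'a::coded \<Rightarrow> nat \<Rightarrow> complex"
  shows "effective N \<Longrightarrow> effective_complex (\<lambda>x. F (fst x) (snd x))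
    \<Longrightarrow> effective_complex (\<lambda>e. \<Sum>i<N e. F e i)"
  by (simp add: effective_complex_def eff)

lemma effective_Re [eff]: "effective_complex F \<Longrightarrow> effective_real (\<lambda>e. Re (F e))"
  and effective_Im [eff]: "effective_complex F \<Longrightarrow> effective_real (\<lambda>e. Im (F e))"
  by (auto simp: effective_complex_def)

text \<open>As for sums, the recursion runs on codes: pairs of fractions with the multiplication of
  complex numbers.\<close>

lemma effective_complex_power [eff]:
  assumes "effective_complex F" "effective n"
  shows "effective_complex (\<lambda>e. F e ^ n e)"
proof -
  from assms(1) obtain g h where g: "effective g" "\<And>e. Re (F e) = ratio (g e)"
    and h: "effective h" "\<And>e. Im (F e) = ratio (h e)"
    unfolding effective_complex_def effective_real_def by blast
  define val where "val p = Complex (ratio (fst p)) (ratio (snd p))" for p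
  define add :: "int \<times> nat \<Rightarrow> int \<times> nat \<Rightarrow> int \<times> nat" where
    "add p q = (fst p * int (Suc (snd q)) + fst q * int (Suc (snd p)), Suc (snd p) * Suc (snd q) - 1)" for p q
  define mul :: "int \<times> nat \<Rightarrow> int \<times> nat \<Rightarrow> int \<times> nat" where
    "mul p q = (fst p * fst q, Suc (snd p) * Suc (snd q) - 1)" for p q
  define neg :: "int \<times> nat \<Rightarrow> int \<times> nat" where "neg p = (- fst p, snd p)" for p
  have "ratio (add p q) = ratio p + ratio q" for p q
    by (simp add: add_def ratio_def add_frac_eq) (simp add: algebra_simps)
  moreover have "ratio (mul p q) = ratio p * ratio q" "ratio (neg p) = - ratio p" for p q
    by (simp_all add: mul_def neg_def ratio_def) (simp add: algebra_simps)
  ultimately have ops: "val (add (mul p r) (neg (mul q s)), add (mul p s) (mul q r)) = val (p, q) * val (r, s)" for p q r s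
    by (simp add: val_def complex_eq_iff)
  define G where "G e = rec_nat ((1, 0), (0, 0)) (\<lambda>m y.
      (add (mul (fst y) (g e)) (neg (mul (snd y) (h e))), add (mul (fst y) (h e)) (mul (snd y) (g e)))) (n e)" for e
  have "F e ^ m = val (rec_nat ((1, 0), (0, 0)) (\<lambda>m y.
      (add (mul (fst y) (g e)) (neg (mul (snd y) (h e))), add (mul (fst y) (h e)) (mul (snd y) (g e)))) m)" for e m
  proof (induction m)
    case 0
    show ?case by (simp add: val_def ratio_def complex_eq_iff)
  next
    case (Suc m)
    have "F e = val (g e, h e)" by (simp add: val_def complex_eq_iff g(2) h(2))
    with Suc show ?case by (simp add: ops mult.commute)
  qed
  then have G: "F e ^ n e = val (G e)" for e by (simp add: G_def)
  have "effective G"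
    unfolding G_def add_def mul_def neg_def
    by (intro eff assms(2) effective_compose[OF g(1)] effective_compose[OF h(1)])
  then have "effective (\<lambda>e. fst (G e))" "effective (\<lambda>e. snd (G e))" by (intro eff; assumption)+
  then show ?thesis
    unfolding effective_complex_def effective_real_def G val_def complex.sel by blast
qed

section \<open>Coded rationals, integer division, counting and enumerability\<close>

lemma nat_to_rat_surj_eq:
  "real_of_rat (nat_to_rat_surj c) =
    of_int (int_decode (fst (prod_decode c))) / of_int (int_decode (snd (prod_decode c)))"
  by (cases "int_decode (snd (prod_decode c)) = 0")
     (auto simp: nat_to_rat_surj_def case_prod_beta of_rat_rat rat_number_collapse)

lemma effective_nat_to_rat_surj [eff]:
  "effective c \<Longrightarrow> effective_real (\<lambda>e. real_of_rat (nat_to_rat_surj (c e)))"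
  unfolding nat_to_rat_surj_eq by (intro eff)

lemma computable_rat2_iff:
  "computable_rat2 q \<longleftrightarrow> effective_real (\<lambda>x. real_of_rat (q (fst x) (snd x)))"
proof
  assume "computable_rat2 q"
  then obtain f where "computable2 f" "\<And>m n. q m n = nat_to_rat_surj (f m n)"
    unfolding computable_rat2_def by blast
  then show "effective_real (\<lambda>x. real_of_rat (q (fst x) (snd x)))"
    by (simp only:) (intro eff effective_computable2[of f])
next
  assume "effective_real (\<lambda>x. real_of_rat (q (fst x) (snd x)))"
  then obtain a b where 1: "effective a" "effective b" "\<And>e. b e > 0"
    and 2: "\<And>x. real_of_rat (q (fst x) (snd x)) = of_int (a x) / real (b x)"
    by (rule effective_realE) (rule that; simp)
  define f where "f m n = prod_encode (int_encode (a (m, n)), int_encode (int (b (m, n))))" for m n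
  have "computable2 f"
    unfolding f_def
    by (rule effective_imp_computable2) (intro eff effective_compose[OF 1(1)] effective_compose[OF 1(2)])
  moreover have "q m n = nat_to_rat_surj (f m n)" for m n
  proof -
    have "real_of_rat (q m n) = real_of_rat (nat_to_rat_surj (f m n))"
      using 2[of "(m, n)"] by (simp add: nat_to_rat_surj_eq f_def)
    then show ?thesis by simp
  qed
  ultimately show "computable_rat2 q" unfolding computable_rat2_def by blast
qed

lemma effective_real_Rats: "effective_real F \<Longrightarrow> F e \<in> \<rat>"
  by (erule effective_realE) (metis Rats_divide Rats_of_int Rats_of_nat)

lemma effective_div_int [eff]:
  assumes "effective a" "effective b"
  shows "effective (\<lambda>e. a e div int (b e))"
proof -
  \<comment> \<open>For negative \<open>i\<close> the quotient rounds away from zero: with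
    \<open>i = - j\<close> it is minus the ceiling of \<open>j / n\<close>.\<close>
  have "i div int n = (if 0 \<le> i then int (nat i div n) else - int ((nat (- i) + n - 1) div n))" for i n
  proof (cases "0 \<le> i \<or> n = 0")
    case True
    then show ?thesis by (auto simp: zdiv_int)
  next
    case False
    define j where "j = nat (- i)"
    with False have i: "i = - int j" and n: "n > 0" "j > 0" by auto
    have "- int ((j + n - 1) div n) = i div int n"
    proof (rule sym, rule int_div_pos_eq)
      define d where "d = (j + n - 1) div n"
      have 1: "d * n \<le> j + n - 1" "j + n - 1 < d * n + n"
        unfolding d_def using n dividend_less_div_times[of n "j + n - 1"] by (auto simp: add.commute)
      show "i = int n * - int ((j + n - 1) div n) + (int (d * n) - int j)"
        unfolding i d_def[symmetric] by simp
      show "0 \<le> int (d * n) - int j" "int (d * n) - int j < int n"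
        using 1 n by linarith+
    qed
    with False show ?thesis by (simp add: j_def)
  qed
  then show ?thesis by (simp only:) (intro eff effective_nat_uminus assms)
qed

lemma effective_div_power2 [eff]:
  assumes "effective a" "effective b"
  shows "effective (\<lambda>e. a e div 2 ^ b e :: int)"
proof -
  have "effective (\<lambda>e. a e div int (2 ^ b e))" by (intro eff assms)
  then show ?thesis by simp
qed

lemma card_int_Collect:
  assumes "\<And>c. P c \<Longrightarrow> - int R \<le> c \<and> c < int R"
  shows "card {c. P c} = (\<Sum>i<2 * R. if P (int i - int R) then 1 else 0)"
proof -
  have "bij_betw (\<lambda>i. int i - int R) {i\<in>{..<2 * R}. P (int i - int R)} {c. P c}"
    by (rule bij_betw_byWitness[where f' = "\<lambda>c. nat (c + int R)"]) (use assms in force)+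
  then have "card {c. P c} = card {i\<in>{..<2 * R}. P (int i - int R)}"
    by (simp add: bij_betw_same_card)
  then show ?thesis by (simp add: sum.If_cases Collect_conj_eq lessThan_def Int_commute)
qed

lemma effective_card_int:
  fixes P :: "'a::coded \<Rightarrow> int \<Rightarrow> bool"
  assumes "effective (\<lambda>x. P (fst x) (snd x))" "effective R"
    and "\<And>e c. P e c \<Longrightarrow> - int (R e) \<le> c \<and> c < int (R e)"
  shows "effective (\<lambda>e. card {c. P e c})"
proof -
  have "effective (\<lambda>e. \<Sum>i<2 * R e. if P e (int i - int (R e)) then 1 else 0 :: nat)"
    by (intro eff effective_compose2[OF assms(1)] effective_compose[OF assms(2)] assms(2))
  moreover have "card {c. P e c} = (\<Sum>i<2 * R e. if P e (int i - int (R e)) then 1 else 0 :: nat)" for e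
    by (rule card_int_Collect) (rule assms(3))
  ultimately show ?thesis by simp
qed

text \<open>Witness and element are dovetailed through \<open>prod_encode\<close>; a pair that fails
  the test outputs the fixed member \<open>z0\<close> instead.\<close>

lemma computably_enumerable_projection:
  assumes "effective (\<lambda>x. P (fst x) (snd x))"
  shows "computably_enumerable {z::nat. \<exists>w::nat. P w z}"
proof (cases "{z. \<exists>w. P w z} = {}")
  case True
  then show ?thesis by (simp add: computably_enumerable_def)
next
  case False
  then obtain w0 z0 where "P w0 z0" by blast
  define f where "f c = (if P (fst (prod_decode c)) (snd (prod_decode c)) then snd (prod_decode c) else z0)" for c
  have "computable f"
    unfolding f_def by (rule effective_imp_computable) (intro eff effective_compose2[OF assms])
  moreover have "range f = {z. \<exists>w. P w z}"
  proof
    show "range f \<subseteq> {z. \<exists>w. P w z}" using \<open>P w0 z0\<close> by (auto simp: f_def)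
    show "{z. \<exists>w. P w z} \<subseteq> range f"
    proof
      fix z assume "z \<in> {z. \<exists>w. P w z}"
      then obtain w where "P w z" by blast
      then have "f (prod_encode (w, z)) = z" by (simp add: f_def)
      then show "z \<in> range f" by (metis rangeI)
    qed
  qed
  ultimately show ?thesis unfolding computably_enumerable_def by metis
qed

section \<open>Schnorr tests and dyadic cells\<close>

text \<open>The right-hand side is semidecidable in the end points; this is what makes the interval codes of
  an effective union of intervals enumerable.\<close>

lemma Icc_subset_UN_open_iff:
  fixes a b :: real and l u :: "nat \<Rightarrow> real"
  assumes "a \<le> b"
  shows "{a..b} \<subseteq> (\<Union>i. {l i<..<u i}) \<longleftrightarrow>
    (\<exists>K M. \<forall>k<Suc K. \<exists>i<M. l i < a + (b - a) * real k / real (Suc K) \<and>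
      a + (b - a) * real (Suc k) / real (Suc K) < u i)"
proof
  assume sub: "{a..b} \<subseteq> (\<Union>i. {l i<..<u i})"
  obtain d where d: "0 < d"
    "\<And>T. T \<subseteq> {a..b} \<Longrightarrow> diameter T < d \<Longrightarrow> \<exists>B\<in>range (\<lambda>i. {l i<..<u i}). T \<subseteq> B"
    by (rule Lebesgue_number_lemma[of "{a..b}" "range (\<lambda>i. {l i<..<u i})"]) (use sub in auto)
  obtain K where K: "(b - a) / d < real (Suc K)" by (metis less_SucI of_nat_less_iff order_less_trans reals_Archimedean2 lessI)
  define p where "p k = a + (b - a) * real k / real (Suc K)" for k
  have step: "p (Suc k) = p k + (b - a) / real (Suc K)" for k
    unfolding p_def of_nat_Suc[of k] distrib_left add_divide_distrib by simp
  have mono: "p k \<le> p l" if "k \<le> l" for k l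
    unfolding p_def using assms that by (intro add_left_mono divide_right_mono mult_left_mono) auto
  have ends: "p 0 = a" "p (Suc K) = b" by (simp_all add: p_def)
  have "\<exists>i. l i < p k \<and> p (Suc k) < u i" if "k < Suc K" for k
  proof -
    have "{p k..p (Suc k)} \<subseteq> {a..b}" using mono[of 0 k] mono[of "Suc k" "Suc K"] that ends by auto
    moreover have "diameter {p k..p (Suc k)} < d"
      using K d(1) assms mono[of k "Suc k"] by (simp add: diameter_closed_interval step field_simps del: of_nat_Suc)
    ultimately obtain i where "{p k..p (Suc k)} \<subseteq> {l i<..<u i}" using d(2) by blast
    then have "p k \<in> {l i<..<u i}" "p (Suc k) \<in> {l i<..<u i}" using mono[of k "Suc k"] by auto
    then show ?thesis by auto
  qed
  then obtain i where i: "\<And>k. k < Suc K \<Longrightarrow> l (i k) < p k \<and> p (Suc k) < u (i k)" by metis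
  \<comment> \<open>The sum of the finitely many chosen indices dominates each of them and serves as
    \<open>M\<close>, up to one.\<close>
  have "\<forall>k<Suc K. \<exists>j<Suc (\<Sum>k<Suc K. i k). l j < p k \<and> p (Suc k) < u j"
  proof (intro allI impI)
    fix k assume k: "k < Suc K"
    then have "i k \<le> (\<Sum>k<Suc K. i k)" by (intro member_le_sum) auto
    with i[OF k] show "\<exists>j<Suc (\<Sum>k<Suc K. i k). l j < p k \<and> p (Suc k) < u j"
      by (intro exI[of _ "i k"]) auto
  qed
  then show "\<exists>K M. \<forall>k<Suc K. \<exists>i<M. l i < a + (b - a) * real k / real (Suc K) \<and>
      a + (b - a) * real (Suc k) / real (Suc K) < u i"
    unfolding p_def by blast
next
  assume "\<exists>K M. \<forall>k<Suc K. \<exists>i<M. l i < a + (b - a) * real k / real (Suc K) \<and>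
      a + (b - a) * real (Suc k) / real (Suc K) < u i"
  then obtain K M where *: "\<And>k. k < Suc K \<Longrightarrow> \<exists>i<M. l i < a + (b - a) * real k / real (Suc K) \<and>
      a + (b - a) * real (Suc k) / real (Suc K) < u i" by blast
  show "{a..b} \<subseteq> (\<Union>i. {l i<..<u i})"
  proof
    fix x assume x: "x \<in> {a..b}"
    define p where "p k = a + (b - a) * real k / real (Suc K)" for k
    have "\<exists>k<Suc K. p k \<le> x \<and> x \<le> p (Suc k)"
    proof -
      have "x \<le> p (Suc K)" using x by (simp add: p_def)
      define k where "k = (LEAST k. x \<le> p (Suc k))"
      have k: "x \<le> p (Suc k)" "k \<le> K"
        unfolding k_def using \<open>x \<le> p (Suc K)\<close> by (rule LeastI Least_le)+
      have "p k \<le> x"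
      proof (cases k)
        case 0
        then show ?thesis using x by (simp add: p_def)
      next
        case (Suc m)
        then have "\<not> x \<le> p (Suc m)" unfolding k_def by (metis lessI not_less_Least)
        then show ?thesis using Suc by simp
      qed
      with k show ?thesis by (intro exI[of _ k]) simp
    qed
    then obtain k where "k < Suc K" "p k \<le> x" "x \<le> p (Suc k)" by blast
    with *[of k] obtain i where "l i < p k" "p (Suc k) < u i" unfolding p_def by blast
    then have "x \<in> {l i<..<u i}" using \<open>p k \<le> x\<close> \<open>x \<le> p (Suc k)\<close> by simp
    then show "x \<in> (\<Union>i. {l i<..<u i})" by blast
  qed
qed

lemma computable_open_seq_UN:
  fixes l u :: "nat \<Rightarrow> nat \<Rightarrow> real"
  assumes l: "effective_real (\<lambda>x. l (fst x) (snd x))"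
    and u: "effective_real (\<lambda>x. u (fst x) (snd x))"
  shows "computable_open_seq (\<lambda>n. \<Union>i. {l n i<..<u n i})" (is "computable_open_seq ?V")
proof -
  define a where "a z = real_of_rat (nat_to_rat_surj (fst (prod_decode (snd (prod_decode z)))))" for z
  define b where "b z = real_of_rat (nat_to_rat_surj (snd (prod_decode (snd (prod_decode z)))))" for z
  define N where "N z = fst (prod_decode z)" for z
  define Q where "Q w z \<longleftrightarrow> a z \<le> b z \<and> (\<forall>k<Suc (fst (prod_decode w)). \<exists>i<snd (prod_decode w).
      l (N z) i < a z + (b z - a z) * real k / real (Suc (fst (prod_decode w))) \<and>
      a z + (b z - a z) * real (Suc k) / real (Suc (fst (prod_decode w))) < u (N z) i)" for w z
  have "effective (\<lambda>x. Q (fst x) (snd x))"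
    unfolding Q_def a_def b_def N_def
    by (intro eff effective_real_compose2[OF l] effective_real_compose2[OF u])
  then have "computably_enumerable {z. \<exists>w. Q w z}" by (rule computably_enumerable_projection)
  moreover have "{z. \<exists>w. Q w z} = {prod_encode (n, m) | n m. m \<in> rat_interval_codes (?V n)}"
  proof -
    have 1: "(\<exists>w. Q w z) \<longleftrightarrow> a z \<le> b z \<and> {a z..b z} \<subseteq> ?V (N z)" for z
    proof (cases "a z \<le> b z")
      case True
      show ?thesis unfolding Icc_subset_UN_open_iff[OF True] Q_def
        using True by (metis prod_encode_inverse fst_conv snd_conv)
    qed (simp add: Q_def)
    have 2: "z \<in> {prod_encode (n, m) | n m. m \<in> rat_interval_codes (?V n)} \<longleftrightarrow>
        a z \<le> b z \<and> {a z..b z} \<subseteq> ?V (N z)" for z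
    proof -
      obtain n i j where z: "z = prod_encode (n, prod_encode (i, j))"
        by (metis prod_decode_inverse surj_pair)
      show ?thesis by (auto simp: z rat_interval_codes_def a_def b_def N_def of_rat_less_eq)
    qed
    show ?thesis by (rule set_eqI) (simp only: 2, simp only: mem_Collect_eq 1)
  qed
  ultimately have "uniformly_computably_enumerable (\<lambda>n. rat_interval_codes (?V n))"
    unfolding uniformly_computably_enumerable_def by (simp only:)
  moreover have "open (?V n)" for n by (intro open_UN ballI open_greaterThanLessThan)
  ultimately show ?thesis unfolding computable_open_seq_def by blast
qed

section \<open>Dyadic cells and their measure\<close>

definition cells :: "nat \<Rightarrow> int set \<Rightarrow> real set" where
  "cells s A = {x. \<lfloor>x * 2 ^ s\<rfloor> \<in> A}"

text \<open>Passing to a coarser level is integer division of the cell index. This lets cells of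
  different levels be compared and counted at one common level.\<close>

lemma floor_div_power2: "s \<le> S \<Longrightarrow> \<lfloor>x * 2 ^ S\<rfloor> div 2 ^ (S - s) = \<lfloor>x * 2 ^ s\<rfloor>" for x :: real
proof -
  assume "s \<le> S"
  then have "x * 2 ^ S / real_of_int (2 ^ (S - s)) = x * 2 ^ s"
    by (simp add: field_simps flip: power_add)
  then show ?thesis using floor_divide_real_eq_div[of "2 ^ (S - s)" "x * 2 ^ S"] by simp
qed

lemma cells_eq_UN: "cells s A = (\<Union>c\<in>A. {real_of_int c / 2 ^ s..<(real_of_int c + 1) / 2 ^ s})"
proof -
  have "\<lfloor>x * 2 ^ s\<rfloor> = c \<longleftrightarrow> x \<in> {real_of_int c / 2 ^ s..<(real_of_int c + 1) / 2 ^ s}" for x c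
    by (auto simp: floor_eq_iff field_simps)
  then have "x \<in> cells s A \<longleftrightarrow> x \<in> (\<Union>c\<in>A. {real_of_int c / 2 ^ s..<(real_of_int c + 1) / 2 ^ s})" for x
    unfolding cells_def mem_Collect_eq UN_iff by metis
  then show ?thesis by (rule set_eqI)
qed

lemma
  assumes "finite A"
  shows sets_cells: "cells s A \<in> sets lebesgue"
    and emeasure_cells: "emeasure lebesgue (cells s A) = ennreal (real (card A) / 2 ^ s)"
proof -
  let ?I = "\<lambda>c. {real_of_int c / 2 ^ s..<(real_of_int c + 1) / 2 ^ s}"
  show "cells s A \<in> sets lebesgue" unfolding cells_eq_UN using assms by auto
  have "disjoint_family_on ?I A"
    unfolding disjoint_family_on_def
  proof (intro ballI impI)
    fix c d :: int assume "c \<noteq> d"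
    have "\<lfloor>x * 2 ^ s\<rfloor> = c" if "x \<in> ?I c" for x c
      using that by (auto simp: floor_eq_iff field_simps)
    with \<open>c \<noteq> d\<close> show "?I c \<inter> ?I d = {}" by blast
  qed
  then have "emeasure lebesgue (cells s A) = (\<Sum>c\<in>A. emeasure lebesgue (?I c))"
    unfolding cells_eq_UN using assms by (intro sum_emeasure[symmetric]) auto
  also have "\<dots> = (\<Sum>c\<in>A. ennreal (1 / 2 ^ s))"
    by (intro sum.cong refl) (simp add: divide_right_mono add_divide_distrib)
  also have "\<dots> = ennreal (real (card A) / 2 ^ s)"
    by (simp add: ennreal_of_nat_eq_real_of_nat flip: ennreal_mult'')
  finally show "emeasure lebesgue (cells s A) = ennreal (real (card A) / 2 ^ s)" .
qed

lemma finite_int_range: "(\<And>c. P c \<Longrightarrow> a \<le> c \<and> c < b) \<Longrightarrow> finite {c::int. P c}"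
  by (rule finite_subset[of _ "{a..<b}"]) auto

text \<open>The Solovay form of a Schnorr test: the \<open>j\<close>-th stage consists of finitely many dyadic cells of
  level \<open>s j\<close> and total length at most \<open>C / 2 ^ j\<close>, and a point is captured if it lies in infinitely
  many stages. Cells are half-open, so that \<open>\<lfloor>t * 2 ^ s j\<rfloor>\<close> is the only one of its level containing \<open>t\<close>.\<close>

definition cell_covered :: "real \<Rightarrow> bool" where
  "cell_covered t \<longleftrightarrow> (\<exists>s D C. effective s \<and> effective (\<lambda>x. D (fst x) (snd x)) \<and>
    (\<forall>j c. D j c \<longrightarrow> - (7 * 2 ^ s j) \<le> c \<and> c < 7 * 2 ^ s j) \<and>
    (\<forall>j. card {c. D j c} * 2 ^ j \<le> C * 2 ^ s j) \<and>
    (\<exists>\<^sub>\<infinity>j. D j \<lfloor>t * 2 ^ s j\<rfloor>))"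

lemma emeasure_UN_le_power_half:
  assumes "\<And>m. B m \<in> sets M" "\<And>m. emeasure M (B m) \<le> ennreal (K / 2 ^ m)" "0 \<le> K"
  shows "emeasure M (\<Union>m\<in>{n..}. B m) \<le> ennreal (2 * K / 2 ^ n)"
proof -
  have eq: "(\<Union>m\<in>{n..}. B m) = (\<Union>i. B (i + n))"
  proof -
    have "{n..} = range (\<lambda>i. i + n)" by (auto simp: image_iff le_iff_add add.commute)
    then show ?thesis by auto
  qed
  have sums: "(\<lambda>i. K / 2 ^ (i + n)) sums (2 * K / 2 ^ n)"
    using sums_mult[OF geometric_sums[of "1/2::real"], of "K / 2 ^ n"]
    by (simp add: power_add power_divide mult.commute)
  have "emeasure M (\<Union>i. B (i + n)) \<le> suminf (\<lambda>i. emeasure M (B (i + n)))"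
    by (rule emeasure_subadditive_countably) (use assms(1) in auto)
  also have "\<dots> \<le> suminf (\<lambda>i. ennreal (K / 2 ^ (i + n)))"
    by (intro suminf_le assms(2)) auto
  also have "\<dots> = ennreal (2 * K / 2 ^ n)"
    using sums assms(3) by (subst suminf_ennreal2) (auto simp: sums_iff)
  finally show ?thesis by (simp add: eq)
qed

text \<open>The \<open>n\<close>-th test set is the union of all stages from \<open>n + b\<close>
  on, every cell being widened to an open interval. Its measure is computable because finitely many
  stages are measured exactly and the remaining ones are controlled by the geometric bound.\<close>

lemma cell_covered_not_schnorr_random:
  assumes "cell_covered t"
  shows "\<not> schnorr_random t"
proof -
  from assms obtain s D C where s: "effective s" and D: "effective (\<lambda>x. D (fst x) (snd x))"
    and range: "\<And>j c. D j c \<Longrightarrow> - (7 * 2 ^ s j) \<le> c \<and> c < 7 * 2 ^ s j"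
    and card: "\<And>j. card {c. D j c} * 2 ^ j \<le> C * 2 ^ s j"
    and inf: "\<exists>\<^sub>\<infinity>j. D j \<lfloor>t * 2 ^ s j\<rfloor>"
    unfolding cell_covered_def by blast
  \<comment> \<open>One neighbouring cell is added on each side. This makes the set open and keeps
    it, up to end points, a union of whole cells.\<close>
  define J where "J m c = {(real_of_int c - 1) / 2 ^ s m<..<(real_of_int c + 2) / 2 ^ s m}" for m c
  define B where "B m = (\<Union>c\<in>{c. D m c}. J m c)" for m
  \<comment> \<open>Widening triples the length and summing the tail doubles it: the total is
    \<open>6 * C / 2 ^ (n + b)\<close>, and \<open>b \<le> 2 ^ b\<close> absorbs the
    constant.\<close>
  define b where "b = 6 * C"
  define V where "V n = (\<Union>m\<in>{n + b..}. B m)" for n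
  have fin: "finite {c. D m c}" for m by (rule finite_int_range) (rule range)
  have B_iff: "x \<in> B m \<longleftrightarrow> (\<exists>c. D m c \<and> real_of_int c - 1 < x * 2 ^ s m \<and> x * 2 ^ s m < real_of_int c + 2)" for x m
    by (auto simp: B_def J_def field_simps)
  have B_sets: "B m \<in> sets lebesgue" for m unfolding B_def J_def using fin by auto
  have B_le: "emeasure lebesgue (B m) \<le> ennreal (3 * real C / 2 ^ m)" for m
  proof -
    have "emeasure lebesgue (B m) \<le> (\<Sum>c\<in>{c. D m c}. emeasure lebesgue (J m c))"
      unfolding B_def using fin by (intro emeasure_subadditive_finite) (auto simp: J_def)
    also have "\<dots> = (\<Sum>c\<in>{c. D m c}. ennreal (3 / 2 ^ s m))"
      unfolding J_def by (intro sum.cong refl) (simp add: divide_right_mono flip: diff_divide_distrib)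
    also have "\<dots> = ennreal (real (card {c. D m c}) * (3 / 2 ^ s m))"
      by (simp add: ennreal_of_nat_eq_real_of_nat flip: ennreal_mult'')
    also have "\<dots> \<le> ennreal (3 * real C / 2 ^ m)"
    proof (rule ennreal_leI)
      have "real (card {c. D m c} * 2 ^ m) \<le> real (C * 2 ^ s m)" using card by (subst of_nat_le_iff)
      then show "real (card {c. D m c}) * (3 / 2 ^ s m) \<le> 3 * real C / 2 ^ m" by (simp add: field_simps)
    qed
    finally show ?thesis .
  qed
  have tail: "emeasure lebesgue (\<Union>m\<in>{n + b..}. B m) \<le> ennreal (1 / 2 ^ n)" for n
  proof -
    have "emeasure lebesgue (\<Union>m\<in>{n + b..}. B m) \<le> ennreal (2 * (3 * real C) / 2 ^ (n + b))"
      by (rule emeasure_UN_le_power_half) (use B_sets B_le in auto)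
    also have "\<dots> \<le> ennreal (1 / 2 ^ n)"
    proof (rule ennreal_leI)
      have "real b \<le> 2 ^ b" by (metis less_exp of_nat_le_numeral_power_cancel_iff less_imp_le)
      then show "2 * (3 * real C) / 2 ^ (n + b) \<le> 1 / 2 ^ n"
        by (simp add: power_add divide_simps b_def)
    qed
    finally show ?thesis .
  qed
  (* U n k is a finite part of V n whose measure is found by counting cells at the common level S n k;
     A n k lists the cells meeting the open triples J. *)
  define M where "M n k = n + Suc k + b" for n k
  \<comment> \<open>A sum in place of a maximum: it dominates every \<open>s m\<close> below
    \<open>M n k\<close>, and its effectivity is immediate.\<close>
  define S where "S n k = (\<Sum>m<M n k. s m)" for n k
  define A where "A n k c \<longleftrightarrow> (- int (8 * 2 ^ S n k) \<le> c \<and> c < int (8 * 2 ^ S n k)) \<and>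
    (\<exists>m<M n k. n + b \<le> m \<and> (D m (c div 2 ^ (S n k - s m)) \<or>
      D m (c div 2 ^ (S n k - s m) - 1) \<or> D m (c div 2 ^ (S n k - s m) + 1)))" for n k c
  define U where "U n k = (\<Union>m\<in>{n + b..<M n k}. B m)" for n k
  have Sge: "s m \<le> S n k" if "m < M n k" for m n k
    unfolding S_def using that by (intro member_le_sum) auto
  have fins: "finite {c. A n k c}" for n k
    by (rule finite_int_range) (auto simp: A_def)
  have U_sub: "U n k \<subseteq> cells (S n k) {c. A n k c}" for n k
  proof
    fix x assume "x \<in> U n k"
    then obtain m c where m: "n + b \<le> m" "m < M n k" and c: "D m c"
      "real_of_int c - 1 < x * 2 ^ s m" "x * 2 ^ s m < real_of_int c + 2"
      unfolding U_def by (auto simp: B_iff)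
    have fl: "\<lfloor>x * 2 ^ S n k\<rfloor> div 2 ^ (S n k - s m) = \<lfloor>x * 2 ^ s m\<rfloor>"
      by (rule floor_div_power2) (rule Sge[OF m(2)])
    have "\<lfloor>x * 2 ^ s m\<rfloor> = c - 1 \<or> \<lfloor>x * 2 ^ s m\<rfloor> = c \<or> \<lfloor>x * 2 ^ s m\<rfloor> = c + 1"
      using c by linarith
    then have "D m \<lfloor>x * 2 ^ s m\<rfloor> \<or> D m (\<lfloor>x * 2 ^ s m\<rfloor> - 1) \<or> D m (\<lfloor>x * 2 ^ s m\<rfloor> + 1)"
      using c(1) by auto
    \<comment> \<open>A widened cell exceeds the window \<open>7\<close> by at most one cell length,
      which is at most \<open>1\<close>; hence the \<open>8\<close> in \<open>A\<close>.\<close>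
    moreover have "- 8 * 2 ^ S n k \<le> x * 2 ^ S n k \<and> x * 2 ^ S n k < 8 * 2 ^ S n k"
    proof -
      have "real_of_int (- (7 * 2 ^ s m)) \<le> real_of_int c" "real_of_int (c + 1) \<le> real_of_int (7 * 2 ^ s m)"
        using range[OF c(1)] unfolding of_int_le_iff by simp_all
      then have "- 7 * 2 ^ s m \<le> real_of_int c" "real_of_int c + 1 \<le> 7 * 2 ^ s m" by simp_all
      moreover have "(1::real) \<le> 2 ^ s m" by simp
      ultimately have "- 8 * 2 ^ s m < x * 2 ^ s m" "x * 2 ^ s m < 8 * 2 ^ s m" using c by linarith+
      then have "- 8 < x" "x < 8" by (simp_all only: mult_less_cancel_right_pos zero_less_power zero_less_numeral)
      then show ?thesis
        using mult_right_mono[of "-8" x "2 ^ S n k"] by (simp del: mult_le_cancel_right)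
    qed
    ultimately show "x \<in> cells (S n k) {c. A n k c}"
      using m unfolding cells_def A_def mem_Collect_eq
      by (auto simp: le_floor_iff floor_less_iff fl intro!: exI[of _ m])
  qed
  \<comment> \<open>This direction fails only at left end points \<open>(c - 1) / 2 ^ s m\<close>,
    because cells are half-open and \<open>J\<close> is open. These points are rational, hence
    negligible.\<close>
  have "cells (S n k) {c. A n k c} \<subseteq> U n k \<union> \<rat>" for n k
  proof
    fix x assume "x \<in> cells (S n k) {c. A n k c}"
    then obtain m where m: "n + b \<le> m" "m < M n k"
      and *: "D m (\<lfloor>x * 2 ^ S n k\<rfloor> div 2 ^ (S n k - s m)) \<or>
        D m (\<lfloor>x * 2 ^ S n k\<rfloor> div 2 ^ (S n k - s m) - 1) \<or>
        D m (\<lfloor>x * 2 ^ S n k\<rfloor> div 2 ^ (S n k - s m) + 1)"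
      unfolding cells_def A_def mem_Collect_eq by blast
    have fl: "\<lfloor>x * 2 ^ S n k\<rfloor> div 2 ^ (S n k - s m) = \<lfloor>x * 2 ^ s m\<rfloor>"
      by (rule floor_div_power2) (rule Sge[OF m(2)])
    have "\<exists>c. D m c \<and> c - 1 \<le> \<lfloor>x * 2 ^ s m\<rfloor> \<and> \<lfloor>x * 2 ^ s m\<rfloor> \<le> c + 1"
      using * unfolding fl by (elim disjE) (rule exI, rule conjI, assumption, simp)+
    then obtain c where c: "D m c" "c - 1 \<le> \<lfloor>x * 2 ^ s m\<rfloor>" "\<lfloor>x * 2 ^ s m\<rfloor> \<le> c + 1" by blast
    have "real_of_int c - 1 \<le> x * 2 ^ s m" "x * 2 ^ s m < real_of_int c + 2"
      using c(2,3) by linarith+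
    then consider "real_of_int c - 1 < x * 2 ^ s m" "x * 2 ^ s m < real_of_int c + 2"
      | "x * 2 ^ s m = real_of_int c - 1" by linarith
    then show "x \<in> U n k \<union> \<rat>"
    proof cases
      case 1
      then show ?thesis using m c(1) by (auto simp: U_def B_iff)
    next
      case 2
      then have "x = (of_int c - 1) / 2 ^ s m" by (simp add: field_simps)
      then show ?thesis by simp
    qed
  qed
  moreover have "(\<rat> :: real set) \<in> null_sets lebesgue"
    by (intro null_sets_completionI countable_imp_null_set_lborel countable_rat)
  moreover have U_sets: "U n k \<in> sets lebesgue" for n k unfolding U_def using B_sets by auto
  ultimately have "emeasure lebesgue (cells (S n k) {c. A n k c}) \<le> emeasure lebesgue (U n k)" for n k
    by (metis emeasure_Un_null_set emeasure_mono null_setsD2 sets.Un)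
  then have U_meas: "emeasure lebesgue (U n k) = ennreal (real (card {c. A n k c}) / 2 ^ S n k)" for n k
    using emeasure_mono[OF U_sub[of n k] sets_cells[OF fins]] emeasure_cells[OF fins, of "S n k" n k]
    by (metis order_antisym)
  have V_sets: "V n \<in> sets lebesgue" for n unfolding V_def using B_sets by auto
  have V_meas: "emeasure lebesgue (V n) = ennreal (measure lebesgue (V n))" for n
    using tail[of n] unfolding V_def[symmetric]
    by (intro emeasure_eq_ennreal_measure) (auto simp: top_unique)
  have approx: "\<bar>real (card {c. A n k c}) / 2 ^ S n k - measure lebesgue (V n)\<bar> < 1 / 2 ^ k" for n k
  proof -
    have "emeasure lebesgue (U n k) \<le> emeasure lebesgue (V n)"
      by (rule emeasure_mono[OF _ V_sets]) (auto simp: U_def V_def)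
    then have 1: "real (card {c. A n k c}) / 2 ^ S n k \<le> measure lebesgue (V n)"
      by (simp add: U_meas V_meas)
    \<comment> \<open>\<open>M n k\<close> is chosen so that the stages left out by
      \<open>U n k\<close> are exactly those of \<open>V (n + Suc k)\<close>.\<close>
    have "V n \<subseteq> U n k \<union> V (n + Suc k)"
    proof -
      have "{n + b..} = {n + b..<M n k} \<union> {n + Suc k + b..}" by (auto simp: M_def)
      then show ?thesis unfolding V_def U_def by blast
    qed
    then have "emeasure lebesgue (V n) \<le> emeasure lebesgue (U n k \<union> V (n + Suc k))"
      using U_sets V_sets by (intro emeasure_mono) auto
    also have "\<dots> \<le> emeasure lebesgue (U n k) + emeasure lebesgue (V (n + Suc k))"
      using U_sets V_sets by (intro emeasure_subadditive)
    also have "\<dots> \<le> ennreal (real (card {c. A n k c}) / 2 ^ S n k) + ennreal (1 / 2 ^ (n + Suc k))"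
      unfolding U_meas V_def by (intro add_left_mono tail)
    also have "\<dots> = ennreal (real (card {c. A n k c}) / 2 ^ S n k + 1 / 2 ^ (n + Suc k))"
      by (rule ennreal_plus[symmetric]) auto
    finally have "measure lebesgue (V n) \<le> real (card {c. A n k c}) / 2 ^ S n k + 1 / 2 ^ (n + Suc k)"
      unfolding V_meas by (subst (asm) ennreal_le_iff) auto
    moreover have "1 / 2 ^ (n + Suc k) < (1 / 2 ^ k :: real)"
      by (intro divide_strict_left_mono power_strict_increasing) auto
    ultimately show ?thesis using 1 by (simp add: abs_if)
  qed
  have M: "effective (\<lambda>x. M (f x) (g x))" if "effective f" "effective g" for f g :: "'x::coded \<Rightarrow> nat"
    unfolding M_def by (intro eff that)
  have S: "effective (\<lambda>x. S (f x) (g x))" if "effective f" "effective g" for f g :: "'x::coded \<Rightarrow> nat"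
    unfolding S_def
    by (intro eff M effective_compose[OF s] effective_compose[OF that(1)] effective_compose[OF that(2)] that)
  have "effective (\<lambda>x. A (fst (fst x)) (snd (fst x)) (snd x))"
    unfolding A_def by (intro eff M S effective_compose[OF s] effective_compose2[OF D])
  then have "effective (\<lambda>x. card {c. A (fst x) (snd x) c})"
    by (rule effective_card_int[where R = "\<lambda>x. 8 * 2 ^ S (fst x) (snd x)"])
       ((intro eff S), simp add: A_def)
  then have "effective_real (\<lambda>x. real (card {c. A (fst x) (snd x) c}) / 2 ^ S (fst x) (snd x))"
    by (intro eff S)
  moreover define q where "q n k = (of_nat (card {c. A n k c}) / 2 ^ S n k :: rat)" for n k
  ultimately have "computable_rat2 q"
    unfolding computable_rat2_iff q_def by (simp add: of_rat_divide of_rat_power)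
  moreover have "\<bar>real_of_rat (q n k) - measure lebesgue (V n)\<bar> < 1 / 2 ^ k" for n k
    using approx[of n k] by (simp add: q_def of_rat_divide of_rat_power)
  ultimately have "computable_real_seq (\<lambda>n. measure lebesgue (V n))"
    unfolding computable_real_seq_def by blast
  moreover have "computable_open_seq V"
  proof -
    \<comment> \<open>An index codes a stage and a cell. If the stage is too early or the cell does
      not belong to it, both end points become \<open>0\<close> and the interval is empty.\<close>
    define m where "m i = fst (prod_decode i)" for i
    define c where "c i = int_decode (snd (prod_decode i))" for i
    define l where "l n i = (if n + b \<le> m i \<and> D (m i) (c i) then (real_of_int (c i) - 1) / 2 ^ s (m i) else 0)" for n i
    define u where "u n i = (if n + b \<le> m i \<and> D (m i) (c i) then (real_of_int (c i) + 2) / 2 ^ s (m i) else 0)" for n i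
    have "effective_real (\<lambda>x. l (fst x) (snd x))" "effective_real (\<lambda>x. u (fst x) (snd x))"
      unfolding l_def u_def m_def c_def by (intro eff effective_compose[OF s] effective_compose2[OF D])+
    then have "computable_open_seq (\<lambda>n. \<Union>i. {l n i<..<u n i})" by (rule computable_open_seq_UN)
    moreover have "(\<Union>i. {l n i<..<u n i}) = V n" for n
    proof
      show "(\<Union>i. {l n i<..<u n i}) \<subseteq> V n"
      proof
        fix x assume "x \<in> (\<Union>i. {l n i<..<u n i})"
        then obtain i where "n + b \<le> m i" "D (m i) (c i)" "x \<in> J (m i) (c i)"
          unfolding l_def u_def J_def by (auto split: if_splits)
        then show "x \<in> V n" unfolding V_def B_def by blast
      qed
      show "V n \<subseteq> (\<Union>i. {l n i<..<u n i})"
      proof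
        fix x assume "x \<in> V n"
        then obtain m' c' where "n + b \<le> m'" "D m' c'" "x \<in> J m' c'" unfolding V_def B_def by auto
        then have "x \<in> {l n (prod_encode (m', int_encode c'))<..<u n (prod_encode (m', int_encode c'))}"
          by (simp add: l_def u_def m_def c_def J_def)
        then show "x \<in> (\<Union>i. {l n i<..<u n i})" by blast
      qed
    qed
    ultimately show ?thesis by simp
  qed
  ultimately have "schnorr_test V"
    unfolding schnorr_test_def using tail by (simp add: V_def)
  moreover have "t \<in> V n" for n
  proof -
    obtain m where m: "m \<ge> n + b" "D m \<lfloor>t * 2 ^ s m\<rfloor>" using inf by (auto simp: INFM_nat_le)
    have "real_of_int \<lfloor>t * 2 ^ s m\<rfloor> - 1 < t * 2 ^ s m" "t * 2 ^ s m < real_of_int \<lfloor>t * 2 ^ s m\<rfloor> + 2"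
      by linarith+
    with m show ?thesis unfolding V_def by (auto simp: B_iff)
  qed
  ultimately show ?thesis unfolding schnorr_random_def by blast
qed

text \<open>Inner approximations of a component by cells are computed from the enumeration of its
  intervals. An enumeration alone never shows how much is still missing; the computable measure
  does, and waiting until little is missing bounds every later addition.\<close>

lemma not_schnorr_random_imp_cell_covered:
  assumes t: "t \<in> {-pi..pi}" and "\<not> schnorr_random t"
  shows "cell_covered t"
proof -
  from assms obtain V where test: "schnorr_test V" and tV: "\<And>n. t \<in> V n"
    unfolding schnorr_random_def by blast
  have V_open: "open (V n)" for n
    using test by (simp add: schnorr_test_def computable_open_seq_def)
  have V_sets: "V n \<in> sets lebesgue" for n using V_open by simp
  have V_le: "emeasure lebesgue (V n) \<le> ennreal (1 / 2 ^ n)" for n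
    using test by (simp add: schnorr_test_def)
  have V_meas: "emeasure lebesgue (V n) = ennreal (measure lebesgue (V n))" for n
    using V_le[of n] by (intro emeasure_eq_ennreal_measure) (auto simp: top_unique)
  obtain q where q: "effective_real (\<lambda>x. real_of_rat (q (fst x) (snd x)))"
    and q_approx: "\<And>n k. \<bar>real_of_rat (q n k) - measure lebesgue (V n)\<bar> < 1 / 2 ^ k"
    using test unfolding schnorr_test_def computable_real_seq_def computable_rat2_iff by blast

  define Z where "Z = {prod_encode (n, m) | n m. m \<in> rat_interval_codes (V n)}"
  have inner: "\<exists>a b. {real_of_rat a..real_of_rat b} \<subseteq> V n \<and> real_of_rat a < x \<and> x < real_of_rat b"
    if xV: "x \<in> V n" for x n
  proof -
    obtain e where e: "e > 0" "ball x e \<subseteq> V n" using V_open xV by (meson open_contains_ball)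
    obtain a where a: "x - e < real_of_rat a" "real_of_rat a < x" using of_rat_dense[of "x - e" x] e by auto
    obtain b where b: "x < real_of_rat b" "real_of_rat b < x + e" using of_rat_dense[of x "x + e"] e by auto
    have "{real_of_rat a..real_of_rat b} \<subseteq> ball x e" using a b by (auto simp: dist_real_def)
    with e a b show ?thesis by blast
  qed
  have code_mem: "prod_encode (n, prod_encode (i, j)) \<in> Z \<longleftrightarrow> nat_to_rat_surj i \<le> nat_to_rat_surj j \<and>
     {real_of_rat (nat_to_rat_surj i)..real_of_rat (nat_to_rat_surj j)} \<subseteq> V n" for n i j
    by (auto simp: Z_def rat_interval_codes_def)
  have code_ex: "\<exists>i j. prod_encode (n, prod_encode (i, j)) \<in> Z \<and>
      real_of_rat (nat_to_rat_surj i) < x \<and> x < real_of_rat (nat_to_rat_surj j)" if xV: "x \<in> V n" for x n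
  proof -
    obtain a b where ab: "{real_of_rat a..real_of_rat b} \<subseteq> V n" "real_of_rat a < x" "x < real_of_rat b"
      using inner[OF xV] by blast
    obtain i j where ij: "a = nat_to_rat_surj i" "b = nat_to_rat_surj j"
      by (metis surj_nat_to_rat_surj surjD)
    have "real_of_rat a < real_of_rat b" using ab by linarith
    then have "a \<le> b" by (simp add: of_rat_less)
    then show ?thesis unfolding code_mem using ab ij by blast
  qed
  have "Z \<noteq> {}" using code_ex[OF tV[of 0]] by blast
  moreover have "computably_enumerable Z"
    using test unfolding schnorr_test_def computable_open_seq_def uniformly_computably_enumerable_def Z_def
    by (elim conjE)
  ultimately obtain g where g: "computable g" and g_range: "range g = Z"
    unfolding computably_enumerable_def by blast
  define ix where "ix w = fst (prod_decode (g w))" for w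
  define lo where "lo w = real_of_rat (nat_to_rat_surj (fst (prod_decode (snd (prod_decode (g w))))))" for w
  define hi where "hi w = real_of_rat (nat_to_rat_surj (snd (prod_decode (snd (prod_decode (g w))))))" for w
  have lohi: "{lo w..hi w} \<subseteq> V (ix w)" for w
  proof -
    obtain n i j where gw: "g w = prod_encode (n, prod_encode (i, j))"
      by (metis prod_decode_inverse surj_pair)
    have "g w \<in> Z" unfolding g_range[symmetric] by simp
    then show ?thesis unfolding gw code_mem by (simp add: ix_def lo_def hi_def gw)
  qed
  have ex_w: "\<exists>w. ix w = n \<and> lo w < x \<and> x < hi w" if xV: "x \<in> V n" for x n
  proof -
    obtain i j where "prod_encode (n, prod_encode (i, j)) \<in> range g"
      "real_of_rat (nat_to_rat_surj i) < x" "x < real_of_rat (nat_to_rat_surj j)"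
      using code_ex[OF xV] unfolding g_range by blast
    moreover from this obtain w where "g w = prod_encode (n, prod_encode (i, j))" by (metis rangeE)
    ultimately show ?thesis unfolding ix_def lo_def hi_def by (intro exI[of _ w]) simp
  qed

  \<comment> \<open>Three bounds grow together with \<open>v\<close>: the fineness of the cells, the
    window \<open>[-v, v)\<close> and the number of enumerated intervals consulted. This makes
    \<open>X n v\<close> increasing in \<open>v\<close> with union \<open>V n\<close>.\<close>
  define good where "good n v a \<longleftrightarrow> (- int (v * 2 ^ v) \<le> a \<and> a < int (v * 2 ^ v)) \<and>
    (\<exists>w<v. ix w = n \<and> lo w \<le> real_of_int a / 2 ^ v \<and> (real_of_int a + 1) / 2 ^ v \<le> hi w)" for n v a
  define X where "X n v = cells v {a. good n v a}" for n v
  have fin: "finite {a. good n v a}" for n v by (rule finite_int_range) (auto simp: good_def)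
  have X_sets: "X n v \<in> sets lebesgue" for n v unfolding X_def by (rule sets_cells[OF fin])
  have X_meas: "emeasure lebesgue (X n v) = ennreal (real (card {a. good n v a}) / 2 ^ v)" for n v
    unfolding X_def by (rule emeasure_cells[OF fin])
  have X_iff: "x \<in> X n v \<longleftrightarrow> good n v \<lfloor>x * 2 ^ v\<rfloor>" for x n v by (simp add: X_def cells_def)
  have X_sub: "X n v \<subseteq> V n" for n v
  proof
    fix x assume "x \<in> X n v"
    then obtain w where w: "ix w = n" "lo w \<le> real_of_int \<lfloor>x * 2 ^ v\<rfloor> / 2 ^ v"
      "(real_of_int \<lfloor>x * 2 ^ v\<rfloor> + 1) / 2 ^ v \<le> hi w"
      unfolding X_iff good_def by blast
    have "real_of_int \<lfloor>x * 2 ^ v\<rfloor> / 2 ^ v \<le> x" "x \<le> (real_of_int \<lfloor>x * 2 ^ v\<rfloor> + 1) / 2 ^ v"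
      using real_of_int_floor_add_one_ge[of "x * 2 ^ v"] by (simp_all add: field_simps)
    with w have "x \<in> {lo w..hi w}" by auto
    with lohi w(1) show "x \<in> V n" by blast
  qed
  have X_incr: "X n v \<subseteq> X n (Suc v)" for n v
  proof
    fix x assume x: "x \<in> X n v"
    define a where "a = \<lfloor>x * 2 ^ v\<rfloor>"
    define a' where "a' = \<lfloor>x * 2 ^ Suc v\<rfloor>"
    have "a' div 2 ^ (Suc v - v) = a" unfolding a_def a'_def by (rule floor_div_power2) simp
    then have a: "a' div 2 = a" by simp
    then have a': "2 * a \<le> a'" "a' \<le> 2 * a + 1" by presburger+
    from x obtain w where w: "w < v" "ix w = n" "lo w \<le> real_of_int a / 2 ^ v"
      "(real_of_int a + 1) / 2 ^ v \<le> hi w" and r: "- int (v * 2 ^ v) \<le> a" "a < int (v * 2 ^ v)"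
      unfolding X_iff good_def a_def[symmetric] by blast
    have "2 * real_of_int a \<le> real_of_int a'" "real_of_int a' \<le> 2 * real_of_int a + 1" using a' by linarith+
    then have "2 * real_of_int a / 2 ^ Suc v \<le> real_of_int a' / 2 ^ Suc v"
      "(real_of_int a' + 1) / 2 ^ Suc v \<le> 2 * (real_of_int a + 1) / 2 ^ Suc v"
      by (intro divide_right_mono; simp)+
    then have "real_of_int a / 2 ^ v \<le> real_of_int a' / 2 ^ Suc v"
      "(real_of_int a' + 1) / 2 ^ Suc v \<le> (real_of_int a + 1) / 2 ^ v"
      unfolding power_Suc mult_divide_mult_cancel_left_if by simp_all
    with w have "lo w \<le> real_of_int a' / 2 ^ Suc v" "(real_of_int a' + 1) / 2 ^ Suc v \<le> hi w" by linarith+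
    moreover have "- int (Suc v * 2 ^ Suc v) \<le> a'" "a' < int (Suc v * 2 ^ Suc v)"
    proof -
      have "int (Suc v * 2 ^ Suc v) = 2 * int (v * 2 ^ v) + 2 * 2 ^ v" by (simp add: algebra_simps)
      moreover have "(0::int) < 2 ^ v" by simp
      ultimately show "- int (Suc v * 2 ^ Suc v) \<le> a'" "a' < int (Suc v * 2 ^ Suc v)"
        using r a' by linarith+
    qed
    ultimately show "x \<in> X n (Suc v)"
      unfolding X_iff good_def a'_def[symmetric] using w by (auto intro!: exI[of _ w])
  qed
  have X_mono: "X n u \<subseteq> X n v" if "u \<le> v" for n u v
    using that by (induction v rule: dec_induct) (use X_incr in blast)+
  have X_ex: "\<exists>v. x \<in> X n v" if xV: "x \<in> V n" for x n
  proof -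
    obtain w where w: "ix w = n" "lo w < x" "x < hi w" using ex_w[OF xV] by blast
    define d where "d = min (x - lo w) (hi w - x)"
    have d: "d > 0" using w by (simp add: d_def)
    obtain k where k: "(1/2) ^ k < d" using real_arch_pow_inv[OF d, of "1/2"] by auto
    obtain m where m: "\<bar>x\<bar> < real m" by (meson reals_Archimedean2)
    define v where "v = Suc w + k + m"
    have "(1/2::real) ^ v \<le> (1/2) ^ k" by (rule power_decreasing) (auto simp: v_def)
    with k have v: "1 / 2 ^ v < d" by (simp add: power_one_over)
    define a where "a = \<lfloor>x * 2 ^ v\<rfloor>"
    have a: "real_of_int a \<le> x * 2 ^ v" "x * 2 ^ v < real_of_int a + 1" unfolding a_def by linarith+
    then have "real_of_int a / 2 ^ v \<le> x" "x < (real_of_int a + 1) / 2 ^ v" by (simp_all add: field_simps)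
    then have "lo w \<le> real_of_int a / 2 ^ v" "(real_of_int a + 1) / 2 ^ v \<le> hi w"
      using v unfolding d_def add_divide_distrib by linarith+
    moreover have "- real v \<le> x" "x < real v" using m by (auto simp: v_def)
    then have "- real v * 2 ^ v \<le> x * 2 ^ v" "x * 2 ^ v < real v * 2 ^ v"
      by (intro mult_right_mono mult_strict_right_mono; simp)+
    then have "- int (v * 2 ^ v) \<le> a" "a < int (v * 2 ^ v)"
      unfolding a_def by (simp_all add: le_floor_iff floor_less_iff)
    ultimately have "x \<in> X n v" unfolding X_iff good_def a_def[symmetric] using w(1)
      by (auto simp: v_def intro!: exI[of _ w])
    then show ?thesis by blast
  qed
  have X_UN: "(\<Union>v. X n v) = V n" for n
  proof
    show "(\<Union>v. X n v) \<subseteq> V n" by (rule UN_least) (rule X_sub)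
    show "V n \<subseteq> (\<Union>v. X n v)" using X_ex by (simp add: subset_eq)
  qed

  (* The stage j codes a pair (n, k). The set Y j is the k-th approximation from inside to the
     component N j of the test, precise to about 2 ^ - r j. The indices are chosen such that stage
     (n, 0), which uses all of Y, and the later differences Y j - Y (prev j) have measure O(2 ^ - j). *)
  define N where "N j = prod_encode (fst (prod_decode j), 0)" for j
  define r where "r j = prod_encode (fst (prod_decode j), Suc (snd (prod_decode j)))" for j
  \<comment> \<open>Requiring \<open>v \<ge> k\<close> at the stage \<open>(n, k)\<close> makes the
    sets \<open>Y\<close> exhaust the component. The margin \<open>2 / 2 ^ r j\<close> exceeds the
    error of \<open>q\<close>, so the search succeeds, and afterwards less than
    \<open>3 / 2 ^ r j\<close> is missing.\<close>
  define stage where "stage j v \<longleftrightarrow> snd (prod_decode j) \<le> v \<and>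
    real_of_rat (q (N j) (r j)) - 2 / 2 ^ r j < real (card {a. good (N j) v a}) / 2 ^ v" for j v
  have stage_ex: "\<exists>v. stage j v" for j
  proof -
    have "(\<lambda>v. emeasure lebesgue (X (N j) v)) \<longlonglongrightarrow> emeasure lebesgue (\<Union>v. X (N j) v)"
      by (rule Lim_emeasure_incseq) (auto simp: incseq_SucI X_incr X_sets)
    then have "(\<lambda>v. ennreal (real (card {a. good (N j) v a}) / 2 ^ v)) \<longlonglongrightarrow> ennreal (measure lebesgue (V (N j)))"
      by (simp only: X_UN X_meas V_meas)
    then have "(\<lambda>v. real (card {a. good (N j) v a}) / 2 ^ v) \<longlonglongrightarrow> measure lebesgue (V (N j))"
      by (subst (asm) tendsto_ennreal_iff) auto
    moreover have "real_of_rat (q (N j) (r j)) - 2 / 2 ^ r j < measure lebesgue (V (N j))"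
    proof -
      have "real_of_rat (q (N j) (r j)) < measure lebesgue (V (N j)) + 1 / 2 ^ r j"
        using q_approx[of "N j" "r j"] by linarith
      moreover have "(1 / 2 ^ r j :: real) < 2 / 2 ^ r j" by (simp add: divide_strict_right_mono)
      ultimately show ?thesis by linarith
    qed
    ultimately have "eventually (\<lambda>v. real_of_rat (q (N j) (r j)) - 2 / 2 ^ r j < real (card {a. good (N j) v a}) / 2 ^ v) sequentially"
      by (rule order_tendstoD)
    then have "eventually (stage j) sequentially"
      unfolding stage_def using eventually_ge_at_top by (rule eventually_elim2) auto
    then show ?thesis by (auto simp: eventually_sequentially)
  qed
  define v where "v j = (LEAST v. stage j v)" for j
  have v: "stage j (v j)" for j unfolding v_def using stage_ex by (rule LeastI_ex)
  define Y where "Y j = X (N j) (v j)" for j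
  have Y_meas: "measure lebesgue (V (N j)) - real (card {a. good (N j) (v j) a}) / 2 ^ v j < 3 / 2 ^ r j" for j
  proof -
    have "(3 / 2 ^ r j :: real) = 1 / 2 ^ r j + 2 / 2 ^ r j" by (simp flip: add_divide_distrib)
    then show ?thesis using q_approx[of "N j" "r j"] v[of j] unfolding stage_def by linarith
  qed
  define prev where "prev j = prod_encode (fst (prod_decode j), snd (prod_decode j) - 1)" for j
  have prev: "N (prev j) = N j" for j by (simp add: N_def prev_def)
  have r_prev: "r (prev j) = j" if "snd (prod_decode j) \<noteq> 0" for j
    using that by (simp add: r_def prev_def)
  define S where "S j = v j + v (prev j)" for j
  define D where "D j c \<longleftrightarrow> (- int (7 * 2 ^ S j) \<le> c \<and> c < int (7 * 2 ^ S j)) \<and>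
    good (N j) (v j) (c div 2 ^ (S j - v j)) \<and>
    (snd (prod_decode j) = 0 \<or> \<not> good (N j) (v (prev j)) (c div 2 ^ (S j - v (prev j))))" for j c
  have D_iff: "D j \<lfloor>x * 2 ^ S j\<rfloor> \<longleftrightarrow> (-7 \<le> x \<and> x < 7) \<and> x \<in> Y j \<and> (snd (prod_decode j) = 0 \<or> x \<notin> Y (prev j))" for j x
  proof -
    have "(-7 \<le> x) \<longleftrightarrow> -7 * 2 ^ S j \<le> x * 2 ^ S j" "x < 7 \<longleftrightarrow> x * 2 ^ S j < 7 * 2 ^ S j"
      by (simp_all only: mult_le_cancel_right_pos mult_less_cancel_right_pos zero_less_power zero_less_numeral)
    then have "(- int (7 * 2 ^ S j) \<le> \<lfloor>x * 2 ^ S j\<rfloor> \<and> \<lfloor>x * 2 ^ S j\<rfloor> < int (7 * 2 ^ S j)) \<longleftrightarrow> (-7 \<le> x \<and> x < 7)"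
      by (simp add: le_floor_iff floor_less_iff)
    moreover have "\<lfloor>x * 2 ^ S j\<rfloor> div 2 ^ (S j - v j) = \<lfloor>x * 2 ^ v j\<rfloor>"
      "\<lfloor>x * 2 ^ S j\<rfloor> div 2 ^ (S j - v (prev j)) = \<lfloor>x * 2 ^ v (prev j)\<rfloor>"
      by (rule floor_div_power2, simp add: S_def)+
    ultimately show ?thesis unfolding D_def Y_def X_iff prev by simp
  qed
  have finD: "finite {c. D j c}" for j by (rule finite_int_range) (auto simp: D_def)
  have cardD: "card {c. D j c} * 2 ^ j \<le> 3 * 2 ^ S j" for j
  proof -
    have eq: "ennreal (real (card {c. D j c}) / 2 ^ S j) = emeasure lebesgue (cells (S j) {c. D j c})"
      by (rule emeasure_cells[OF finD, symmetric])
    have mem: "x \<in> cells (S j) {c. D j c} \<longleftrightarrow> D j \<lfloor>x * 2 ^ S j\<rfloor>" for x by (simp add: cells_def)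
    have Y_V: "Y j \<subseteq> V (N j)" unfolding Y_def by (rule X_sub)
    \<comment> \<open>A stage \<open>(n, 0)\<close> lies inside the component that carries its own
      index \<open>j\<close>. A later stage lies in what the previous one missed, and that one had
      the precision \<open>r (prev j) = j\<close>.\<close>
    have "ennreal (real (card {c. D j c}) / 2 ^ S j) \<le> ennreal (3 / 2 ^ j)"
    proof (cases "snd (prod_decode j) = 0")
      case True
      then have "N j = j" unfolding N_def by (metis prod_decode_inverse prod.collapse)
      have "cells (S j) {c. D j c} \<subseteq> V (N j)" 
      proof
        fix x assume "x \<in> cells (S j) {c. D j c}"
        then have "x \<in> Y j" unfolding mem D_iff by simp
        then show "x \<in> V (N j)" using Y_V by auto
      qed
      then have "ennreal (real (card {c. D j c}) / 2 ^ S j) \<le> emeasure lebesgue (V (N j))"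
        unfolding eq using V_sets by (rule emeasure_mono)
      also have "\<dots> \<le> ennreal (1 / 2 ^ j)" using V_le[of j] \<open>N j = j\<close> by simp
      also have "\<dots> \<le> ennreal (3 / 2 ^ j)" by (intro ennreal_leI divide_right_mono) auto
      finally show ?thesis .
    next
      case False
      have Yp: "Y (prev j) \<subseteq> V (N j)" unfolding Y_def using X_sub[of "N (prev j)"] by (simp add: prev)
      have Yp_sets: "Y (prev j) \<in> sets lebesgue" unfolding Y_def by (rule X_sets)
      have Yp_meas: "emeasure lebesgue (Y (prev j)) =
          ennreal (real (card {a. good (N (prev j)) (v (prev j)) a}) / 2 ^ v (prev j))"
        unfolding Y_def by (rule X_meas)
      have "cells (S j) {c. D j c} \<subseteq> V (N j) - Y (prev j)" 
      proof
        fix x assume "x \<in> cells (S j) {c. D j c}"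
        then have "x \<in> Y j" "x \<notin> Y (prev j)" unfolding mem D_iff using False by simp_all
        then show "x \<in> V (N j) - Y (prev j)" using Y_V by auto
      qed
      then have "ennreal (real (card {c. D j c}) / 2 ^ S j) \<le> emeasure lebesgue (V (N j) - Y (prev j))"
        unfolding eq using V_sets Yp_sets by (intro emeasure_mono) auto
      also have "\<dots> = emeasure lebesgue (V (N j)) - emeasure lebesgue (Y (prev j))"
        by (rule emeasure_Diff) (use V_sets Yp_sets Yp Yp_meas in auto)
      also have "\<dots> = ennreal (measure lebesgue (V (N j)) - real (card {a. good (N (prev j)) (v (prev j)) a}) / 2 ^ v (prev j))"
        unfolding V_meas Yp_meas by (rule ennreal_minus) simp
      also have "\<dots> \<le> ennreal (3 / 2 ^ j)"
        using Y_meas[of "prev j"] by (intro ennreal_leI) (simp add: prev r_prev[OF False])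
      finally show ?thesis .
    qed
    then have "real (card {c. D j c}) / 2 ^ S j \<le> 3 / 2 ^ j" by (subst (asm) ennreal_le_iff) auto
    then have "real (card {c. D j c} * 2 ^ j) \<le> real (3 * 2 ^ S j)" by (simp add: field_simps)
    then show ?thesis by (simp only: of_nat_le_iff)
  qed
  have "\<exists>\<^sub>\<infinity>j. D j \<lfloor>t * 2 ^ S j\<rfloor>"
    unfolding INFM_nat_le
  proof
    fix n
    obtain u where u: "t \<in> X (prod_encode (n, 0)) u" using X_ex[OF tV] by blast
    have "t \<in> Y (prod_encode (n, u))"
      using u X_mono[of u "v (prod_encode (n, u))"] v[of "prod_encode (n, u)"]
      by (auto simp: Y_def N_def stage_def)
    \<comment> \<open>\<open>t\<close> is in the approximation number \<open>k\<close> but, for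
      \<open>k > 0\<close>, not in the one before, hence in the difference that forms the stage
      \<open>(n, k)\<close>. Every \<open>n\<close> yields such a stage, and its code is at least
      \<open>n\<close>.\<close>
    define k where "k = (LEAST k. t \<in> Y (prod_encode (n, k)))"
    have k: "t \<in> Y (prod_encode (n, k))"
      unfolding k_def by (rule LeastI) (rule \<open>t \<in> Y (prod_encode (n, u))\<close>)
    have "k = 0 \<or> t \<notin> Y (prod_encode (n, k - 1))"
      using not_less_Least[of "k - 1" "\<lambda>k. t \<in> Y (prod_encode (n, k))"] unfolding k_def[symmetric] by auto
    moreover have "-7 \<le> t \<and> t < 7" using t pi_less_4 by auto
    ultimately have "D (prod_encode (n, k)) \<lfloor>t * 2 ^ S (prod_encode (n, k))\<rfloor>"
      unfolding D_iff using k by (auto simp: prev_def)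
    then show "\<exists>j\<ge>n. D j \<lfloor>t * 2 ^ S j\<rfloor>" using le_prod_encode_1 by blast
  qed

  have ix: "effective (\<lambda>x. ix (f x))" if "effective f" for f :: "'x::coded \<Rightarrow> nat"
    unfolding ix_def by (intro eff effective_computable[OF g] that)
  have lo: "effective_real (\<lambda>x. lo (f x))" if "effective f" for f :: "'x::coded \<Rightarrow> nat"
    unfolding lo_def by (intro eff effective_computable[OF g] that)
  have hi: "effective_real (\<lambda>x. hi (f x))" if "effective f" for f :: "'x::coded \<Rightarrow> nat"
    unfolding hi_def by (intro eff effective_computable[OF g] that)
  have good: "effective (\<lambda>x. good (a x) (b x) (c x))" if "effective a" "effective b" "effective c"
    for a b and c :: "'x::coded \<Rightarrow> int"
    unfolding good_def
    by (intro eff ix lo hi that effective_compose[OF that(1)] effective_compose[OF that(2)]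
        effective_compose[OF that(3)])
  have N: "effective (\<lambda>x. N (f x))" and r: "effective (\<lambda>x. r (f x))" and prev': "effective (\<lambda>x. prev (f x))"
    if "effective f" for f :: "'x::coded \<Rightarrow> nat"
    unfolding N_def r_def prev_def by (intro eff that)+
  have "effective (\<lambda>x. card {a. good (N (fst x)) (snd x) a})"
    by (rule effective_card_int[where R = "\<lambda>x. snd x * 2 ^ snd x"])
       ((intro eff good N), (intro eff), simp add: good_def)
  then have stage: "effective (\<lambda>x. stage (fst x) (snd x))"
    unfolding stage_def by (intro eff effective_real_compose2[OF q] N r)
  have "surj (enc :: nat \<Rightarrow> nat)" by (simp add: surj_def)
  then have "effective v" unfolding v_def by (rule effective_Least) (rule stage stage_ex)+
  note v' = effective_compose[OF this]
  have S: "effective (\<lambda>x. S (f x))" if "effective f" for f :: "'x::coded \<Rightarrow> nat"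
    unfolding S_def by (intro eff v' prev' that)
  have "effective (\<lambda>x. D (fst x) (snd x))"
    unfolding D_def by (intro eff S v' prev' good N)
  moreover have "effective S" by (intro S eff)
  moreover have "- (7 * 2 ^ S j) \<le> c \<and> c < 7 * 2 ^ S j" if "D j c" for j c
    using that by (simp add: D_def)
  ultimately show ?thesis
    unfolding cell_covered_def using cardD \<open>\<exists>\<^sub>\<infinity>j. D j \<lfloor>t * 2 ^ S j\<rfloor>\<close> by blast
qed

section \<open>Cesaro means and the Fejer kernel\<close>

lemma trig_e_cis: "trig_e n t = cis (of_int n * t)"
  by (simp add: trig_e_def cis_conv_exp mult_ac)

lemma trig_e_0 [simp]: "trig_e 0 t = 1"
  by (simp add: trig_e_cis)

lemma trig_e_add: "trig_e (m + n) t = trig_e m t * trig_e n t"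
  by (simp add: trig_e_cis cis_mult distrib_right)

lemma trig_e_diff_arg: "trig_e n (s - t) = trig_e n s * trig_e (- n) t"
  by (simp add: trig_e_cis cis_mult algebra_simps)

lemma norm_trig_e [simp]: "norm (trig_e n t) = 1"
  by (simp add: trig_e_cis)

lemma cnj_trig_e: "cnj (trig_e n t) = trig_e (- n) t"
  by (simp add: trig_e_cis cis_cnj)

lemma continuous_on_trig_e [continuous_intros]: "continuous_on A (trig_e n)"
  unfolding trig_e_def by (intro continuous_intros)

lemma trig_e_periodic: "trig_e n (t + 2 * pi) = trig_e n t"
proof -
  have "cis (of_int n * (2 * pi)) = 1"
    using cis_multiple_2pi[of "of_int n"] by (simp add: mult_ac)
  then show ?thesis by (simp add: trig_e_cis distrib_left flip: cis_mult)
qed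

lemma continuous_imp_L1: "continuous_on UNIV f \<Longrightarrow> f \<in> L1"
  by (auto intro!: continuous_imp_integrable_real continuous_on_subset[of UNIV])

lemma L1_mult_trig_e:
  assumes "f \<in> L1"
  shows "integrable (lebesgue_on {-pi..pi}) (\<lambda>t. f t * trig_e n t)"
proof -
  have "trig_e n \<in> L1" by (intro continuous_imp_L1 continuous_intros)
  then have "trig_e n \<in> borel_measurable (lebesgue_on {-pi..pi})" by auto
  with assms show ?thesis
    by (auto intro!: Bochner_Integration.integrable_bound[where f = f] simp: norm_mult)
qed

lemma fourier_coeff_eq: "fourier_coeff f n =
    1 / (2 * of_real pi) * (LINT t|lebesgue_on {-pi..pi}. f t * trig_e (- n) t)"
  by (simp add: fourier_coeff_def trig_e_def)

section \<open>The Fejer kernel and the convolution formula\<close>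

text \<open>As a squared modulus the kernel is visibly nonnegative; that it is the mean of the
  Dirichlet kernels is \<open>sum_dirichlet_fejer\<close>. In this normalisation its integral over a
  period is \<open>2 * pi\<close>.\<close>

definition fejer :: "nat \<Rightarrow> real \<Rightarrow> real" where
  "fejer N x = (cmod (\<Sum>k\<le>N. trig_e (int k) x))\<^sup>2 / (real N + 1)"

lemma fejer_nonneg: "fejer N x \<ge> 0"
  by (simp add: fejer_def)

lemma fejer_le: "fejer N x \<le> real N + 1"
proof -
  have "cmod (\<Sum>k\<le>N. trig_e (int k) x) \<le> real N + 1"
    using norm_sum[of "\<lambda>k. trig_e (int k) x" "{..N}"] by simp
  then have "(cmod (\<Sum>k\<le>N. trig_e (int k) x))\<^sup>2 \<le> (real N + 1)\<^sup>2" by (rule power_mono) simp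
  then show ?thesis by (simp add: fejer_def field_simps power2_eq_square)
qed

text \<open>For \<open>\<bar>y\<bar> \<le> 2\<close> the cubic remainder is at most two thirds of
  \<open>\<bar>y\<bar>\<close>. The constant is crude, but the range covers \<open>x / 2\<close> for
  all \<open>\<bar>x\<bar> \<le> pi\<close>.\<close>

lemma abs_sin_ge:
  fixes y :: real
  assumes "\<bar>y\<bar> \<le> 2"
  shows "\<bar>y\<bar> / 3 \<le> \<bar>sin y\<bar>"
proof -
  have "\<bar>sin y - (\<Sum>m<3. sin_coeff m * y ^ m)\<bar> \<le> inverse (fact 3) * \<bar>y\<bar> ^ 3"
    by (rule Maclaurin_sin_bound)
  then have "\<bar>sin y - y\<bar> \<le> \<bar>y\<bar> ^ 3 / 6"
    by (simp add: eval_nat_numeral sin_coeff_def)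
  moreover have "\<bar>y\<bar> ^ 3 \<le> 4 * \<bar>y\<bar>"
  proof -
    have "\<bar>y\<bar> * \<bar>y\<bar> \<le> 2 * 2" using assms by (intro mult_mono) auto
    then have "\<bar>y\<bar> * \<bar>y\<bar> * \<bar>y\<bar> \<le> 4 * \<bar>y\<bar>" by (intro mult_right_mono) auto
    then show ?thesis by (simp add: power3_eq_cube)
  qed
  ultimately show ?thesis by linarith
qed

lemma norm_cis_minus_one_ge: "\<bar>x\<bar> \<le> pi \<Longrightarrow> \<bar>x\<bar> / 3 \<le> norm (cis x - 1)"
proof -
  assume x: "\<bar>x\<bar> \<le> pi"
  have "(norm (cis x - 1))\<^sup>2 = (cos x - 1)\<^sup>2 + (sin x)\<^sup>2" by (simp add: cmod_power2)
  also have "\<dots> = 2 - 2 * cos x" using sin_cos_squared_add[of x] by (simp add: power2_eq_square algebra_simps)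
  also have "\<dots> = (2 * sin (x / 2))\<^sup>2" using cos_double_sin[of "x / 2"] by (simp add: power2_eq_square)
  finally have "sqrt ((norm (cis x - 1))\<^sup>2) = sqrt ((2 * sin (x / 2))\<^sup>2)" by (rule arg_cong)
  then have "norm (cis x - 1) = \<bar>2 * sin (x / 2)\<bar>"
    by (simp only: real_sqrt_abs abs_norm_cancel)
  moreover have "\<bar>x / 2\<bar> / 3 \<le> \<bar>sin (x / 2)\<bar>" using x pi_less_4 by (intro abs_sin_ge) auto
  ultimately show ?thesis by (simp add: abs_mult)
qed

text \<open>Multiplication by \<open>cis x - 1\<close> telescopes the geometric sum to a difference
  of two unit vectors. The sum is thus at most \<open>2 / (\<bar>x\<bar> / 3)\<close>, and squaring
  gives \<open>36\<close>.\<close>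

lemma fejer_le_inverse_square:
  assumes "x \<noteq> 0" "\<bar>x\<bar> \<le> pi"
  shows "fejer N x \<le> 36 / ((real N + 1) * x\<^sup>2)"
proof -
  have "(\<Sum>k\<le>N. trig_e (int k) x) = (\<Sum>k<Suc N. cis x ^ k)"
    by (intro sum.cong) (auto simp: trig_e_cis Complex.DeMoivre)
  then have "(cis x - 1) * (\<Sum>k\<le>N. trig_e (int k) x) = cis x ^ Suc N - 1"
    by (simp only: power_diff_1_eq[symmetric])
  then have "norm (cis x - 1) * cmod (\<Sum>k\<le>N. trig_e (int k) x) = norm (cis x ^ Suc N - 1)"
    by (metis norm_mult)
  also have "\<dots> \<le> norm (cis x ^ Suc N) + norm (1::complex)" by (rule norm_triangle_ineq4)
  also have "\<dots> = 2" by (simp add: norm_power norm_mult)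
  finally have "\<bar>x\<bar> / 3 * cmod (\<Sum>k\<le>N. trig_e (int k) x) \<le> 2"
    using mult_right_mono[OF norm_cis_minus_one_ge[OF assms(2)], of "cmod (\<Sum>k\<le>N. trig_e (int k) x)"] by simp
  then have "cmod (\<Sum>k\<le>N. trig_e (int k) x) \<le> 6 / \<bar>x\<bar>" using assms(1) by (simp add: field_simps)
  then have "(cmod (\<Sum>k\<le>N. trig_e (int k) x))\<^sup>2 \<le> (6 / \<bar>x\<bar>)\<^sup>2" by (rule power_mono) simp
  then have "fejer N x \<le> (6 / \<bar>x\<bar>)\<^sup>2 / (real N + 1)"
    unfolding fejer_def by (rule divide_right_mono) simp
  then show ?thesis by (simp add: power_divide mult.commute)
qed

text \<open>The new frequency turns \<open>A * cnj A\<close> into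
  \<open>(A + e) * cnj (A + e)\<close>. The increment is \<open>1\<close> together with
  \<open>e * cnj A\<close> and its conjugate, and these two are the positive and the negative half
  of the next Dirichlet kernel.\<close>

lemma sum_dirichlet_eq:
  "(\<Sum>M = 0..N. \<Sum>n = - int M..int M. trig_e n x) = of_real ((cmod (\<Sum>k\<le>N. trig_e (int k) x))\<^sup>2)"
proof (induction N)
  case (Suc N)
  define A where "A = (\<Sum>k\<le>N. trig_e (int k) x)"
  define e where "e = trig_e (int (Suc N)) x"
  have e: "e * cnj e = 1" unfolding e_def by (simp add: cnj_trig_e flip: trig_e_add)
  have "{- int (Suc N)..int (Suc N)} = {0} \<union> ({- int (Suc N)..-1} \<union> {1..int (Suc N)})" by auto
  then have "(\<Sum>n = - int (Suc N)..int (Suc N). trig_e n x) =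
      1 + ((\<Sum>n = - int (Suc N)..-1. trig_e n x) + (\<Sum>n = 1..int (Suc N). trig_e n x))"
    by (simp add: sum.union_disjoint)
  also have "(\<Sum>n = 1..int (Suc N). trig_e n x) = e * cnj A"
  proof -
    have "(\<Sum>n = 1..int (Suc N). trig_e n x) = (\<Sum>k\<le>N. trig_e (int (Suc N) - int k) x)"
      by (rule sum.reindex_bij_witness[where i = "\<lambda>k. int (Suc N) - int k" and j = "\<lambda>n. nat (int (Suc N) - n)"]) auto
    also have "\<dots> = (\<Sum>k\<le>N. e * cnj (trig_e (int k) x))"
      unfolding e_def by (simp add: cnj_trig_e diff_conv_add_uminus trig_e_add del: add_uminus_conv_diff of_nat_Suc)
    finally show ?thesis by (simp add: A_def sum_distrib_left)
  qed
  also have "(\<Sum>n = - int (Suc N)..-1. trig_e n x) = cnj e * A"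
  proof -
    have "(\<Sum>n = - int (Suc N)..-1. trig_e n x) = (\<Sum>k\<le>N. trig_e (- int (Suc N) + int k) x)"
      by (rule sum.reindex_bij_witness[where i = "\<lambda>k. - int (Suc N) + int k" and j = "\<lambda>n. nat (int (Suc N) + n)"]) auto
    also have "\<dots> = (\<Sum>k\<le>N. cnj e * trig_e (int k) x)"
      unfolding e_def cnj_trig_e by (intro sum.cong refl trig_e_add)
    finally show ?thesis by (simp add: A_def sum_distrib_left)
  qed
  finally have "(\<Sum>M = 0..Suc N. \<Sum>n = - int M..int M. trig_e n x)
      = A * cnj A + (1 + (cnj e * A + e * cnj A))"
    using Suc unfolding sum.atLeast0_atMost_Suc A_def[symmetric] complex_norm_square by simp
  also have "\<dots> = (A + e) * cnj (A + e)" using e by (simp add: algebra_simps)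
  also have "\<dots> = of_real ((cmod (A + e))\<^sup>2)" by (rule complex_norm_square[symmetric])
  finally show ?case by (simp add: A_def e_def)
qed simp

lemma sum_dirichlet_fejer:
  "1 / (of_nat N + 1) * (\<Sum>M = 0..N. \<Sum>n = - int M..int M. trig_e n x) = complex_of_real (fejer N x)"
  by (simp add: sum_dirichlet_eq fejer_def)

lemma continuous_on_fejer [continuous_intros]: "continuous_on A (fejer N)"
  unfolding fejer_def by (intro continuous_intros) auto

lemma integrable_mult_fejer:
  assumes "f \<in> L1"
  shows "integrable (lebesgue_on {-pi..pi}) (\<lambda>u. f u * of_real (fejer N (t - u)))"
proof -
  have "continuous_on UNIV (\<lambda>u. complex_of_real (fejer N (t - u)))"
    by (intro continuous_intros continuous_on_compose2[OF continuous_on_fejer[of UNIV]]) auto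
  then have "(\<lambda>u. complex_of_real (fejer N (t - u))) \<in> L1" by (rule continuous_imp_L1)
  then have 1: "(\<lambda>u. f u * of_real (fejer N (t - u))) \<in> borel_measurable (lebesgue_on {-pi..pi})"
    using assms by (intro borel_measurable_times) auto
  have 2: "integrable (lebesgue_on {-pi..pi}) (\<lambda>u. of_real (real N + 1) * f u)"
    using assms by simp
  have 3: "norm (f u * of_real (fejer N (t - u))) \<le> norm (of_real (real N + 1) * f u)" for u
  proof -
    have "norm (f u) * fejer N (t - u) \<le> norm (f u) * (real N + 1)"
      by (intro mult_left_mono fejer_le) simp
    then show ?thesis
      unfolding norm_mult norm_of_real using fejer_nonneg[of N "t - u"] by (simp add: mult.commute)
  qed
  show ?thesis by (rule Bochner_Integration.integrable_bound[OF 2 1 AE_I2[OF 3]])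
qed

lemma cesaro_mean_eq_integral:
  assumes "f \<in> L1"
  shows "cesaro_mean N f t =
    1 / (2 * of_real pi) * (LINT u|lebesgue_on {-pi..pi}. f u * of_real (fejer N (t - u)))"
proof -
  have eq: "f u * trig_e n (t - u) = trig_e n t * (f u * trig_e (- n) u)" for n u
    by (simp add: trig_e_diff_arg mult_ac)
  have int: "integrable (lebesgue_on {-pi..pi}) (\<lambda>u. f u * trig_e n (t - u))" for n
    unfolding eq by (intro integrable_mult_right L1_mult_trig_e assms)
  have "fourier_coeff f n * trig_e n t =
      1 / (2 * of_real pi) * (LINT u|lebesgue_on {-pi..pi}. f u * trig_e n (t - u))" for n
    unfolding eq fourier_coeff_eq integral_mult_right_zero by simp
  then have "cesaro_mean N f t = 1 / (2 * of_real pi) * (1 / (of_nat N + 1) *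
      (LINT u|lebesgue_on {-pi..pi}. (\<Sum>M = 0..N. \<Sum>n = - int M..int M. f u * trig_e n (t - u))))"
    using int by (simp add: cesaro_mean_def fourier_sum_def sum_distrib_left mult_ac)
  also have "1 / (of_nat N + 1) *
      (LINT u|lebesgue_on {-pi..pi}. (\<Sum>M = 0..N. \<Sum>n = - int M..int M. f u * trig_e n (t - u))) =
      (LINT u|lebesgue_on {-pi..pi}. f u * of_real (fejer N (t - u)))"
    unfolding sum_dirichlet_fejer[symmetric]
    by (subst integral_mult_right_zero[symmetric]) (simp add: sum_distrib_left mult_ac)
  finally show ?thesis .
qed

lemma cesaro_mean_diff:
  assumes "f \<in> L1" "g \<in> L1"
  shows "cesaro_mean N (\<lambda>t. f t - g t) t = cesaro_mean N f t - cesaro_mean N g t"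
proof -
  have "(\<lambda>t. f t - g t) \<in> L1" using assms by simp
  then show ?thesis
    using assms integrable_mult_fejer[of f N t] integrable_mult_fejer[of g N t]
    by (simp add: cesaro_mean_eq_integral left_diff_distrib right_diff_distrib diff_divide_distrib)
qed

text \<open>The factor \<open>N + 1\<close> is harmless for fixed \<open>N\<close>: the bound serves
  to show that a single mean at a point is continuous in the L1 norm.\<close>

lemma norm_cesaro_mean_le:
  assumes "f \<in> L1"
  shows "norm (cesaro_mean N f t) \<le> (real N + 1) * L1_norm f"
proof -
  have "norm (LINT u|lebesgue_on {-pi..pi}. f u * of_real (fejer N (t - u))) \<le>
      (LINT u|lebesgue_on {-pi..pi}. norm (f u * of_real (fejer N (t - u))))"
    by (rule integral_norm_bound)
  also have "\<dots> \<le> (LINT u|lebesgue_on {-pi..pi}. (real N + 1) * norm (f u))"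
  proof (rule integral_mono)
    show "integrable (lebesgue_on {-pi..pi}) (\<lambda>u. norm (f u * of_real (fejer N (t - u))))"
      by (rule integrable_norm[OF integrable_mult_fejer[OF assms]])
    show "integrable (lebesgue_on {-pi..pi}) (\<lambda>u. (real N + 1) * norm (f u))"
      using assms by simp
    fix u
    have "norm (f u) * fejer N (t - u) \<le> norm (f u) * (real N + 1)"
      by (intro mult_left_mono fejer_le) simp
    then show "norm (f u * of_real (fejer N (t - u))) \<le> (real N + 1) * norm (f u)"
      unfolding norm_mult norm_of_real using fejer_nonneg[of N "t - u"] by (simp add: mult.commute)
  qed
  also have "\<dots> = (real N + 1) * L1_norm f" by (simp add: L1_norm_def)
  finally have 1: "norm (LINT u|lebesgue_on {-pi..pi}. f u * of_real (fejer N (t - u))) \<le> (real N + 1) * L1_norm f" .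
  have "norm (1 / (2 * complex_of_real pi)) \<le> 1" using pi_gt3 by (simp add: norm_divide norm_mult)
  then have "norm (1 / (2 * complex_of_real pi)) * norm (LINT u|lebesgue_on {-pi..pi}. f u * of_real (fejer N (t - u)))
     \<le> 1 * ((real N + 1) * L1_norm f)" using 1 by (intro mult_mono) auto
  then show ?thesis by (simp only: cesaro_mean_eq_integral[OF assms] norm_mult mult_1)
qed

lemma Re_cesaro_mean_nonneg:
  assumes "f \<in> L1" "\<And>t. Re (f t) \<ge> 0"
  shows "Re (cesaro_mean N f t) \<ge> 0"
proof -
  have "Re (LINT u|lebesgue_on {-pi..pi}. f u * of_real (fejer N (t - u))) =
      (LINT u|lebesgue_on {-pi..pi}. Re (f u * of_real (fejer N (t - u))))"
    by (rule integral_Re[symmetric]) (rule integrable_mult_fejer[OF assms(1)])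
  also have "\<dots> \<ge> 0" using assms(2) fejer_nonneg by (intro integral_nonneg_AE AE_I2) simp
  finally show ?thesis by (simp add: cesaro_mean_eq_integral[OF assms(1)] Re_divide_of_real)
qed

lemma integral_trig_e:
  "(LINT t|lebesgue_on {-pi..pi}. trig_e n t) = (if n = 0 then 2 * of_real pi else 0)"
proof -
  have "trig_e n \<in> L1" by (intro continuous_imp_L1 continuous_intros)
  then have "(LINT t|lebesgue_on {-pi..pi}. trig_e n t) = integral {-pi..pi} (trig_e n)"
    by (intro lebesgue_integral_eq_integral) auto
  also have "\<dots> = (if n = 0 then 2 * of_real pi else 0)"
  proof (cases "n = 0")
    case True
    then have "trig_e n = (\<lambda>_. 1)" by auto
    then show ?thesis using True by (simp add: scaleR_conv_of_real)
  next
    case False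
    have "((\<lambda>t. trig_e n t / (\<i> * of_int n)) has_vector_derivative trig_e n t) (at t within {-pi..pi})" for t
    proof -
      have "((\<lambda>z. exp (\<i> * of_int n * z) / (\<i> * of_int n)) has_field_derivative
          exp (\<i> * of_int n * of_real t)) (at (of_real t))"
        using False by (auto intro!: derivative_eq_intros)
      then show ?thesis unfolding trig_e_def by (rule has_vector_derivative_real_field)
    qed
    then have "(trig_e n has_integral (trig_e n pi / (\<i> * of_int n) - trig_e n (-pi) / (\<i> * of_int n))) {-pi..pi}"
      by (intro fundamental_theorem_of_calculus) auto
    moreover have "trig_e n pi = trig_e n (-pi)" using trig_e_periodic[of n "-pi"] by simp
    ultimately show ?thesis using False by (simp add: integral_unique)
  qed
  finally show ?thesis .
qed

section \<open>Trigonometric polynomials with a degree bound\<close>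

text \<open>In contrast to \<open>trig_poly\<close>, the degree bound and the coefficient function
  are separate, so that both can be tracked as effective functions and polynomials of different
  degrees can share one bound.\<close>

definition trig_sum :: "nat \<Rightarrow> (int \<Rightarrow> complex) \<Rightarrow> real \<Rightarrow> complex" where
  "trig_sum d c t = (\<Sum>l = - int d..int d. c l * trig_e l t)"

lemma continuous_on_trig_sum [continuous_intros]: "continuous_on A (trig_sum d c)"
  unfolding trig_sum_def by (intro continuous_intros)

lemma trig_sum_periodic: "trig_sum d c (t + 2 * pi) = trig_sum d c t"
  by (simp add: trig_sum_def trig_e_periodic)

lemma trig_sum_L1: "trig_sum d c \<in> L1"
  by (intro continuous_imp_L1 continuous_intros)

lemma fourier_coeff_trig_sum:
  "fourier_coeff (trig_sum d c) n = (if \<bar>n\<bar> \<le> int d then c n else 0)"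
proof -
  have "integrable (lebesgue_on {-pi..pi}) (trig_e l)" for l
    using continuous_imp_L1[OF continuous_on_trig_e] by simp
  then have "(LINT t|lebesgue_on {-pi..pi}. trig_sum d c t * trig_e (- n) t) =
      (\<Sum>l = - int d..int d. c l * (LINT t|lebesgue_on {-pi..pi}. trig_e (l - n) t))"
    by (simp add: trig_sum_def sum_distrib_right mult.assoc flip: trig_e_add)
  also have "\<dots> = (\<Sum>l = - int d..int d. if l = n then c l * (2 * of_real pi) else 0)"
    by (intro sum.cong) (auto simp: integral_trig_e)
  finally show ?thesis by (auto simp: fourier_coeff_eq)
qed

lemma fourier_sum_trig_sum: "d \<le> M \<Longrightarrow> fourier_sum M (trig_sum d c) t = trig_sum d c t"
  unfolding fourier_sum_def trig_sum_def[of d c t] fourier_coeff_trig_sum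
  by (rule sum.mono_neutral_cong_right) auto

text \<open>From order \<open>d\<close> on all partial sums equal the polynomial. The deviations of
  the earlier ones add up to a fixed \<open>K\<close>, which averaging divides by
  \<open>N + 1\<close>.\<close>

lemma cesaro_mean_trig_sum_tendsto:
  "(\<lambda>N. cesaro_mean N (trig_sum d c) t) \<longlonglongrightarrow> trig_sum d c t"
proof -
  define P where "P = trig_sum d c t"
  define K where "K = (\<Sum>M<d. fourier_sum M (trig_sum d c) t - P)"
  have "cesaro_mean N (trig_sum d c) t = P + K * (1 / (of_nat N + 1))" if "N \<ge> d" for N
  proof -
    have "(\<Sum>M = 0..N. fourier_sum M (trig_sum d c) t - P) = K"
      unfolding K_def using that
      by (intro sum.mono_neutral_right) (auto simp: fourier_sum_trig_sum P_def)
    then have "(\<Sum>M = 0..N. fourier_sum M (trig_sum d c) t) = K + (of_nat N + 1) * P"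
      by (simp add: sum_subtractf algebra_simps)
    moreover have "(of_nat N + 1 :: complex) \<noteq> 0" by (metis of_nat_Suc of_nat_eq_0_iff nat.distinct(1) add.commute)
    ultimately show ?thesis by (simp add: cesaro_mean_def field_simps)
  qed
  then have "eventually (\<lambda>N. P + K * (1 / (of_nat N + 1)) = cesaro_mean N (trig_sum d c) t) sequentially"
    by (auto simp: eventually_sequentially intro!: exI[of _ d])
  moreover have "(\<lambda>N. P + K * (1 / (of_nat N + 1))) \<longlonglongrightarrow> P + K * 0"
    using LIMSEQ_inverse_real_of_nat[THEN tendsto_of_real, where 'a=complex]
    by (intro tendsto_intros) (simp add: inverse_eq_divide add.commute)
  ultimately show ?thesis unfolding P_def[symmetric] by (auto elim: Lim_transform_eventually)
qed

section \<open>Integrals of periodic functions and the maximal bound for the means\<close>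

lemma integral_shift_period:
  fixes g :: "real \<Rightarrow> real"
  assumes "\<And>x. g (x + c) = g x"
  shows "integral {a + c..b + c} g = integral {a..b} g"
proof -
  have "g \<circ> (+) c = g" using assms by (auto simp: add.commute)
  then show ?thesis using integral_shift_Icc_real[of a b g c] by simp
qed

lemma integral_period:
  fixes g :: "real \<Rightarrow> real"
  assumes "continuous_on UNIV g" "\<And>x. g (x + 2 * pi) = g x" "\<bar>t\<bar> \<le> pi"
  shows "integral {t - pi..t + pi} g = integral {-pi..pi} g"
proof -
  have int: "g integrable_on {a..b}" for a b
    by (rule integrable_continuous_real[OF continuous_on_subset[OF assms(1)]]) simp
  show ?thesis
  proof (cases "t \<ge> 0")
    case True
    have "integral {t - pi..pi} g + integral {pi..t + pi} g = integral {t - pi..t + pi} g"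
      using assms(3) True by (intro Henstock_Kurzweil_Integration.integral_combine int) auto
    moreover have "integral {-pi..t - pi} g + integral {t - pi..pi} g = integral {-pi..pi} g"
      using assms(3) True by (intro Henstock_Kurzweil_Integration.integral_combine int) auto
    moreover have "integral {pi..t + pi} g = integral {-pi..t - pi} g"
      using integral_shift_period[of g "2 * pi" "-pi" "t - pi"] assms(2) by (simp add: add.commute)
    ultimately show ?thesis by simp
  next
    case False
    have "integral {t - pi..-pi} g + integral {-pi..t + pi} g = integral {t - pi..t + pi} g"
      using assms(3) False by (intro Henstock_Kurzweil_Integration.integral_combine int) auto
    moreover have "integral {-pi..t + pi} g + integral {t + pi..pi} g = integral {-pi..pi} g"
      using assms(3) False by (intro Henstock_Kurzweil_Integration.integral_combine int) auto
    moreover have "integral {t + pi..pi} g = integral {t - pi..-pi} g"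
      using integral_shift_period[of g "2 * pi" "t - pi" "-pi"] assms(2) by (simp add: add.commute)
    ultimately show ?thesis by simp
  qed
qed

text \<open>Three periods contain \<open>[-8, 8]\<close>, the window on which the step functions
  below are compared with the polynomials.\<close>

lemma integral_three_periods:
  fixes g :: "real \<Rightarrow> real"
  assumes "continuous_on UNIV g" "\<And>x. g (x + 2 * pi) = g x"
  shows "integral {- 3 * pi..3 * pi} g = 3 * integral {-pi..pi} g"
proof -
  have int: "g integrable_on {a..b}" for a b
    by (rule integrable_continuous_real[OF continuous_on_subset[OF assms(1)]]) simp
  have "integral {- 3 * pi..-pi} g + integral {-pi..3 * pi} g = integral {- 3 * pi..3 * pi} g"
    by (intro Henstock_Kurzweil_Integration.integral_combine int) auto
  moreover have "integral {-pi..pi} g + integral {pi..3 * pi} g = integral {-pi..3 * pi} g"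
    by (intro Henstock_Kurzweil_Integration.integral_combine int) auto
  moreover have "integral {pi..3 * pi} g = integral {-pi..pi} g"
    using integral_shift_period[of g "2 * pi" "-pi" "pi"] assms(2) by (simp add: add.commute)
  moreover have "integral {-pi..pi} g = integral {- 3 * pi..-pi} g"
    using integral_shift_period[of g "2 * pi" "-3 * pi" "-pi"] assms(2) by (simp add: add.commute)
  ultimately show ?thesis by simp
qed

lemma fejer_periodic: "fejer N (x + 2 * pi) = fejer N x"
  by (simp add: fejer_def trig_e_periodic)

text \<open>Weight times length of the \<open>j\<close>-th interval is \<open>O(2 ^ - j)\<close> independently of \<open>N\<close>; this makes the
  maximal bound below uniform in \<open>N\<close>.\<close>

lemma fejer_le_dyadic_sum:
  assumes "\<bar>x\<bar> \<le> pi"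
  shows "fejer N x \<le> (\<Sum>j\<le>4 * Suc N. if \<bar>x\<bar> \<le> min (2 ^ j / real (Suc N)) pi
    then 144 * real (Suc N) / 4 ^ j else 0)"
proof -
  define a where "a j = 144 * real (Suc N) / 4 ^ j" for j
  \<comment> \<open>\<open>J\<close> is so large that the last interval is all of
    \<open>[-pi, pi]\<close>.\<close>
  define J where "J = 4 * Suc N"
  define P where "P j \<longleftrightarrow> \<bar>x\<bar> \<le> min (2 ^ j / real (Suc N)) pi" for j
  have "P J"
  proof -
    have "pi * real (Suc N) \<le> 4 * real (Suc N)" using pi_less_4 by (intro mult_right_mono) auto
    also have "\<dots> = real J" by (simp add: J_def)
    also have "\<dots> \<le> 2 ^ J" by (metis less_exp of_nat_le_numeral_power_cancel_iff less_imp_le)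
    finally have "pi \<le> 2 ^ J / real (Suc N)" by (simp add: field_simps)
    then show ?thesis using assms by (simp add: P_def)
  qed
  define j where "j = (LEAST j. P j)"
  have j: "P j" "j \<le> J" unfolding j_def using \<open>P J\<close> by (rule LeastI Least_le)+
  \<comment> \<open>At \<open>j = 0\<close> the bound \<open>N + 1\<close> suffices. Otherwise
    \<open>x\<close> lies outside the previous interval, so
    \<open>\<bar>x\<bar> > 2 ^ (j - 1) / (N + 1)\<close>, and the decay
    \<open>36 / ((N + 1) * x\<^sup>2)\<close> is at most \<open>36 * (N + 1) / 4 ^ (j - 1)\<close>;
    this is where \<open>144\<close> comes from.\<close>
  have "fejer N x \<le> a j"
  proof (cases j)
    case 0
    have "fejer N x \<le> real N + 1" by (rule fejer_le)
    then show ?thesis by (simp add: 0 a_def)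
  next
    case (Suc i)
    then have "\<not> P i" unfolding j_def by (metis lessI not_less_Least)
    then have i: "2 ^ i / real (Suc N) < \<bar>x\<bar>" using assms by (auto simp: P_def)
    then have "0 < \<bar>x\<bar>" by (rule le_less_trans[rotated]) simp
    have "(2 ^ i / real (Suc N))\<^sup>2 \<le> \<bar>x\<bar>\<^sup>2" using i by (intro power_mono) auto
    then have "real (Suc N) * (2 ^ i / real (Suc N))\<^sup>2 \<le> real (Suc N) * x\<^sup>2"
      by (intro mult_left_mono) auto
    moreover have "real (Suc N) * (2 ^ i / real (Suc N))\<^sup>2 = 4 ^ i / real (Suc N)"
      by (simp add: power_divide power2_eq_square power_mult_distrib[symmetric] del: of_nat_Suc)
    moreover have "real (Suc N) = real N + 1" by simp
    ultimately have "4 ^ i / real (Suc N) \<le> (real N + 1) * x\<^sup>2" by (simp only:)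
    then have "36 / ((real N + 1) * x\<^sup>2) \<le> 36 / (4 ^ i / real (Suc N))"
      by (intro divide_left_mono mult_pos_pos) (use \<open>0 < \<bar>x\<bar>\<close> in auto)
    also have "\<dots> = a j" by (simp add: a_def Suc field_simps)
    finally show ?thesis
      using fejer_le_inverse_square[of x N] assms \<open>0 < \<bar>x\<bar>\<close> by simp
  qed
  also have "a j = (if P j then a j else 0)" using j by simp
  also have "\<dots> \<le> (\<Sum>j\<le>J. if P j then a j else 0)"
    using j(2) by (intro member_le_sum) (auto simp: a_def)
  finally show ?thesis unfolding P_def a_def J_def .
qed

text \<open>The last hypothesis bounds a maximal function at \<open>t\<close>; its intervals may
  leave \<open>[-pi, pi]\<close>, whence the periodicity. The \<open>j\<close>-th layer of the
  kernel costs \<open>144 * L / 2 ^ j\<close>, altogether at most \<open>288 * L\<close>, and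
  \<open>1 / (2 * pi) \<le> 1 / 6\<close> leaves \<open>48 * L\<close>.\<close>

lemma norm_cesaro_mean_le_maximal:
  assumes cont: "continuous_on UNIV p" and per: "\<And>x. p (x + 2 * pi) = p x" and t: "\<bar>t\<bar> \<le> pi"
    and max: "\<And>\<rho>. 0 < \<rho> \<Longrightarrow> \<rho> \<le> pi \<Longrightarrow> integral {t - \<rho>..t + \<rho>} (\<lambda>u. norm (p u)) \<le> L * \<rho>"
  shows "norm (cesaro_mean N p t) \<le> 48 * L"
proof -
  define h where "h u = norm (p u) * fejer N (t - u)" for u
  define \<rho> where "\<rho> j = min (2 ^ j / real (Suc N)) pi" for j
  define a where "a j = 144 * real (Suc N) / 4 ^ j" for j
  have L: "0 \<le> L"
  proof -
    have "0 \<le> integral {t - pi..t + pi} (\<lambda>u. norm (p u))"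
      by (intro integral_nonneg integrable_continuous_real continuous_on_norm continuous_on_subset[OF cont]) auto
    then have "0 \<le> L * pi" using max[of pi] by simp
    then show ?thesis by (meson pi_gt_zero mult_neg_pos not_le)
  qed
  have cont_h: "continuous_on UNIV h"
    unfolding h_def
    by (intro continuous_intros cont continuous_on_compose2[OF continuous_on_fejer[of UNIV]]) auto
  have per_h: "h (u + 2 * pi) = h u" for u
    using fejer_periodic[of N "t - (u + 2 * pi)"] by (simp add: h_def per)
  have p: "p \<in> L1" by (rule continuous_imp_L1[OF cont])
  have "norm (LINT u|lebesgue_on {-pi..pi}. p u * of_real (fejer N (t - u))) \<le>
      (LINT u|lebesgue_on {-pi..pi}. norm (p u * of_real (fejer N (t - u))))"
    by (rule integral_norm_bound)
  also have "\<dots> = (LINT u|lebesgue_on {-pi..pi}. h u)"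
    by (simp add: h_def norm_mult fejer_nonneg)
  also have "\<dots> = integral {-pi..pi} h"
    by (intro lebesgue_integral_eq_integral continuous_imp_integrable_real continuous_on_subset[OF cont_h]) auto
  also have "\<dots> = integral {t - pi..t + pi} h"
    by (rule integral_period[symmetric]) (use cont_h per_h t in auto)
  also have "\<dots> \<le> (\<Sum>j\<le>4 * Suc N. a j * (L * \<rho> j))"
  proof -
    define I where "I j = {t - \<rho> j..t + \<rho> j}" for j
    define g where "g j u = a j * (if u \<in> I j then norm (p u) else 0)" for j u
    have \<rho>: "0 < \<rho> j" "\<rho> j \<le> pi" for j by (simp_all add: \<rho>_def)
    have int: "((\<lambda>u. norm (p u)) has_integral integral (I j) (\<lambda>u. norm (p u))) (I j)" for j
      unfolding I_def
      by (intro integrable_integral integrable_continuous_real continuous_on_norm continuous_on_subset[OF cont]) auto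
    have "I j \<subseteq> {t - pi..t + pi}" for j using \<rho>[of j] by (auto simp: I_def)
    then have "((\<lambda>u. if u \<in> I j then norm (p u) else 0) has_integral integral (I j) (\<lambda>u. norm (p u))) {t - pi..t + pi}" for j
      using int by (subst has_integral_restrict) auto
    then have "(g j has_integral a j * integral (I j) (\<lambda>u. norm (p u))) {t - pi..t + pi}" for j
      unfolding g_def by (rule has_integral_mult_right)
    then have sum: "((\<lambda>u. \<Sum>j\<le>4 * Suc N. g j u) has_integral
        (\<Sum>j\<le>4 * Suc N. a j * integral (I j) (\<lambda>u. norm (p u)))) {t - pi..t + pi}"
      by (intro has_integral_sum) auto
    have h_int: "(h has_integral integral {t - pi..t + pi} h) {t - pi..t + pi}"
      by (intro integrable_integral integrable_continuous_real continuous_on_subset[OF cont_h]) auto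
    have h_le: "h u \<le> (\<Sum>j\<le>4 * Suc N. g j u)" if "u \<in> {t - pi..t + pi}" for u
    proof -
      have "\<bar>t - u\<bar> \<le> pi" using that by auto
      then have "fejer N (t - u) \<le> (\<Sum>j\<le>4 * Suc N. if \<bar>t - u\<bar> \<le> \<rho> j then a j else 0)"
        unfolding \<rho>_def a_def by (rule fejer_le_dyadic_sum)
      then have "h u \<le> norm (p u) * (\<Sum>j\<le>4 * Suc N. if \<bar>t - u\<bar> \<le> \<rho> j then a j else 0)"
        unfolding h_def by (rule mult_left_mono) simp
      also have "\<dots> = (\<Sum>j\<le>4 * Suc N. g j u)"
        unfolding sum_distrib_left g_def I_def by (intro sum.cong refl) auto
      finally show ?thesis .
    qed
    have "integral {t - pi..t + pi} h \<le> (\<Sum>j\<le>4 * Suc N. a j * integral (I j) (\<lambda>u. norm (p u)))"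
      by (rule has_integral_le[OF h_int sum h_le])
    also have "\<dots> \<le> (\<Sum>j\<le>4 * Suc N. a j * (L * \<rho> j))"
      unfolding I_def by (intro sum_mono mult_left_mono max \<rho>) (simp add: a_def)
    finally show ?thesis .
  qed
  also have "\<dots> \<le> (\<Sum>j\<le>4 * Suc N. 144 * L * (1 / 2) ^ j)"
  proof (rule sum_mono)
    fix j
    have "a j * \<rho> j \<le> a j * (2 ^ j / real (Suc N))"
      by (intro mult_left_mono) (auto simp: \<rho>_def a_def)
    also have "\<dots> = 144 * (1 / 2) ^ j"
    proof -
      have "(4::real) ^ j = 2 ^ j * 2 ^ j" by (simp flip: power_mult_distrib)
      then show ?thesis by (simp add: a_def power_one_over divide_simps del: of_nat_Suc)
    qed
    finally have "L * (a j * \<rho> j) \<le> L * (144 * (1 / 2) ^ j)" using L by (rule mult_left_mono)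
    then show "a j * (L * \<rho> j) \<le> 144 * L * (1 / 2) ^ j" by (simp add: mult_ac)
  qed
  also have "\<dots> \<le> 144 * L * 2"
  proof -
    have "(\<Sum>j\<le>4 * Suc N. (1 / 2) ^ j) \<le> suminf (\<lambda>j. (1 / 2 :: real) ^ j)" by (intro sum_le_suminf) auto
    also have "\<dots> = 2" by (subst suminf_geometric) auto
    finally show ?thesis unfolding sum_distrib_left[symmetric] using L by (intro mult_left_mono) auto
  qed
  finally have 1: "norm (LINT u|lebesgue_on {-pi..pi}. p u * of_real (fejer N (t - u))) \<le> 288 * L" by simp
  have "norm (1 / (2 * complex_of_real pi)) \<le> 1 / 6" using pi_gt3 by (simp add: norm_divide norm_mult)
  then have "norm (1 / (2 * complex_of_real pi)) * norm (LINT u|lebesgue_on {-pi..pi}. p u * of_real (fejer N (t - u)))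
     \<le> 1 / 6 * (288 * L)" using 1 by (intro mult_mono) auto
  then show ?thesis unfolding cesaro_mean_eq_integral[OF p] norm_mult by simp
qed

section \<open>The dyadic maximal function\<close>

definition block :: "nat \<Rightarrow> int \<Rightarrow> int set" where
  "block d i = {i * 2 ^ d..<(i + 1) * 2 ^ d}"

text \<open>Weak type bound for the dyadic maximal function of the finite sequence \<open>r\<close>, by induction
  on the dyadic tree. The neighbours of heavy blocks are included since balls around a point of
  a block may stick out of it.\<close>

lemma card_near_heavy_blocks_le:
  fixes r :: "int \<Rightarrow> real" and \<mu> :: real
  assumes r: "\<And>c. 0 \<le> r c" and \<mu>: "0 < \<mu>"
  defines "heavy \<equiv> \<lambda>d i. \<mu> * 2 ^ d < sum r (block d i)"
  defines "W \<equiv> \<lambda>D j. {c. \<exists>d\<le>D. \<exists>i. i div 2 ^ (D - d) = j \<and> heavy d i \<and>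
    i - 1 \<le> c div 2 ^ d \<and> c div 2 ^ d \<le> i + 1}"
  shows "finite (W D j)" and "\<mu> * card (W D j) \<le> 3 * sum r (block D j)"
proof -
  \<comment> \<open>A neighbour of a block inside block \<open>j\<close> lies in block
    \<open>j\<close> or in one of its two neighbours.\<close>
  have sub: "W D j \<subseteq> {(j - 1) * 2 ^ D..<(j + 2) * 2 ^ D}" for D j
  proof
    fix c assume "c \<in> W D j"
    then obtain d i where d: "d \<le> D" and j: "i div 2 ^ (D - d) = j"
      and i: "i - 1 \<le> c div 2 ^ d" "c div 2 ^ d \<le> i + 1" unfolding W_def by blast
    define q :: int where "q = 2 ^ (D - d)"
    have q: "q \<ge> 1" by (simp add: q_def)
    have "c div 2 ^ D = c div 2 ^ d div q"
      unfolding q_def using d by (metis le_add_diff_inverse power_add zdiv_zmult2_eq zero_le_numeral zero_le_power)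
    moreover have "(i - 1) div q \<ge> j - 1" "(i + 1) div q \<le> j + 1"
    proof -
      have "(i - q) div q = j - 1" "(i + q) div q = j + 1"
        using q j div_add_self2[of q i] div_add_self2[of q "i - q"] by (auto simp: q_def)
      then show "(i - 1) div q \<ge> j - 1" "(i + 1) div q \<le> j + 1"
        using q zdiv_mono1[of "i - q" "i - 1" q] zdiv_mono1[of "i + 1" "i + q" q] by auto
    qed
    moreover have "(i - 1) div q \<le> c div 2 ^ d div q" "c div 2 ^ d div q \<le> (i + 1) div q"
      using q i by (auto intro!: zdiv_mono1)
    ultimately have "j - 1 \<le> c div 2 ^ D" "c div 2 ^ D \<le> j + 1" by linarith+
    then have *: "(j - 1) * 2 ^ D \<le> c div 2 ^ D * 2 ^ D" "c div 2 ^ D * 2 ^ D \<le> (j + 1) * 2 ^ D"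
      by (intro mult_right_mono; simp)+
    moreover have "c div 2 ^ D * 2 ^ D \<le> c" "c < c div 2 ^ D * 2 ^ D + 2 ^ D"
    proof -
      have "0 \<le> c mod 2 ^ D" "c mod 2 ^ D < 2 ^ D" by simp_all
      then show "c div 2 ^ D * 2 ^ D \<le> c" "c < c div 2 ^ D * 2 ^ D + 2 ^ D"
        using div_mult_mod_eq[of c "2 ^ D"] by linarith+
    qed
    ultimately show "c \<in> {(j - 1) * 2 ^ D..<(j + 2) * 2 ^ D}" by (auto simp: algebra_simps)
  qed
  then show fin: "finite (W D j)" for D j by (rule finite_subset) simp
  show "\<mu> * card (W D j) \<le> 3 * sum r (block D j)"
  proof (induction D arbitrary: j)
    case (Suc D)
    show ?case
    \<comment> \<open>A heavy top block pays for its whole neighbourhood of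
      \<open>3 * 2 ^ Suc D\<close> cells. Under a light one every heavy block lies in one of the two
      halves.\<close>
    proof (cases "heavy (Suc D) j")
      case True
      have "card (W (Suc D) j) \<le> card {(j - 1) * 2 ^ Suc D..<(j + 2) * 2 ^ Suc D}"
        by (rule card_mono[OF _ sub]) simp
      also have "\<dots> = 3 * 2 ^ Suc D" by (simp add: algebra_simps nat_mult_distrib nat_power_eq)
      finally have "real (card (W (Suc D) j)) \<le> real (3 * 2 ^ Suc D)" by (subst of_nat_le_iff)
      then have "\<mu> * card (W (Suc D) j) \<le> \<mu> * (3 * 2 ^ Suc D)" using \<mu> by (intro mult_left_mono) auto
      also have "\<dots> \<le> 3 * sum r (block (Suc D) j)" using True by (simp add: heavy_def)
      finally show ?thesis .
    next
      case False
      have "W (Suc D) j \<subseteq> W D (2 * j) \<union> W D (2 * j + 1)"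
      proof
        fix c assume "c \<in> W (Suc D) j"
        then obtain d i where d: "d \<le> Suc D" and j: "i div 2 ^ (Suc D - d) = j" and h: "heavy d i"
          and i: "i - 1 \<le> c div 2 ^ d" "c div 2 ^ d \<le> i + 1" unfolding W_def by blast
        have "d \<noteq> Suc D" using False h j by auto
        with d have d: "d \<le> D" by simp
        then have "(2::int) ^ (Suc D - d) = 2 ^ (D - d) * 2" by (simp add: Suc_diff_le)
        moreover have "i div (2 ^ (D - d) * 2) = i div 2 ^ (D - d) div 2" by (rule zdiv_zmult2_eq) simp
        ultimately have "i div 2 ^ (D - d) div 2 = j" using j by simp
        moreover have "x div 2 = j \<Longrightarrow> x = 2 * j \<or> x = 2 * j + 1" for x :: int by presburger
        ultimately have "i div 2 ^ (D - d) = 2 * j \<or> i div 2 ^ (D - d) = 2 * j + 1" by blast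
        then show "c \<in> W D (2 * j) \<union> W D (2 * j + 1)" unfolding W_def using d h i by blast
      qed
      then have "card (W (Suc D) j) \<le> card (W D (2 * j)) + card (W D (2 * j + 1))"
        by (meson card_Un_le card_mono fin finite_UnI order_trans)
      then have "real (card (W (Suc D) j)) \<le> real (card (W D (2 * j)) + card (W D (2 * j + 1)))"
        by (subst of_nat_le_iff)
      then have "\<mu> * card (W (Suc D) j) \<le> \<mu> * real (card (W D (2 * j)) + card (W D (2 * j + 1)))"
        using \<mu> by (intro mult_left_mono) auto
      also have "\<dots> \<le> 3 * sum r (block D (2 * j)) + 3 * sum r (block D (2 * j + 1))"
        using Suc[of "2 * j"] Suc[of "2 * j + 1"] by (simp add: distrib_left)
      also have "\<dots> = 3 * sum r (block D (2 * j) \<union> block D (2 * j + 1))"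
        by (subst sum.union_disjoint) (auto simp: block_def)
      also have "block D (2 * j) \<union> block D (2 * j + 1) = block (Suc D) j"
      proof -
        have "(0::int) < 2 ^ D" by simp
        then show ?thesis unfolding block_def by (auto simp: algebra_simps)
      qed
      finally show ?thesis .
    qed
  next
    case 0
    show ?case
    proof (cases "heavy 0 j")
      case True
      have "card (W 0 j) \<le> card {(j - 1) * 2 ^ 0..<(j + 2) * 2 ^ 0}"
        by (rule card_mono[OF _ sub]) simp
      then have "real (card (W 0 j)) \<le> 3" by simp
      then have "\<mu> * card (W 0 j) \<le> \<mu> * 3" using \<mu> by (intro mult_left_mono) auto
      also have "\<dots> \<le> 3 * sum r (block 0 j)" using True by (simp add: heavy_def)
      finally show ?thesis .
    next
      case False
      then have "W 0 j = {}" by (auto simp: W_def)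
      then show ?thesis using r by (simp add: sum_nonneg)
    qed
  qed
qed

text \<open>This is \<open>(1 / (1 - \<i> * x / M)) ^ M\<close>, a rational substitute for \<open>cis x\<close>. Taking the reciprocal of
  \<open>1 - \<i> * x / M\<close> instead of \<open>1 + \<i> * x / M\<close> keeps the base inside the unit disc.\<close>

definition approx_cis :: "nat \<Rightarrow> real \<Rightarrow> complex" where
  "approx_cis M x = Complex (1 / (1 + (x / real M)\<^sup>2)) (x / real M / (1 + (x / real M)\<^sup>2)) ^ M"

text \<open>With \<open>y = x / M\<close> each of the \<open>M\<close> factors errs by at most
  \<open>2 * y\<^sup>2\<close>: once \<open>y\<^sup>2\<close> from the linear Taylor polynomial and
  once from replacing \<open>1 + \<i> * y\<close> by the reciprocal of \<open>1 - \<i> * y\<close>.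
  The factors have modulus at most \<open>1\<close>, so the errors merely add up.\<close>

lemma norm_cis_minus_approx_cis_le:
  assumes "M > 0"
  shows "norm (cis x - approx_cis M x) \<le> 2 * x\<^sup>2 / real M"
proof -
  define y where "y = x / real M"
  define w where "w = Complex (1 / (1 + y\<^sup>2)) (y / (1 + y\<^sup>2))"
  have pos: "1 + y\<^sup>2 > 0" by (simp add: add_pos_nonneg)
  then have w: "w * (1 - \<i> * of_real y) = 1"
    by (simp add: w_def complex_eq_iff field_simps power2_eq_square)
  have ge1: "1 \<le> norm (1 - \<i> * of_real y)"
    using complex_Re_le_cmod[of "1 - \<i> * of_real y"] by simp
  have nw: "norm w * norm (1 - \<i> * of_real y) = 1" using w by (metis norm_mult norm_one)
  have "norm w \<le> norm w * norm (1 - \<i> * of_real y)" using mult_left_mono[OF ge1, of "norm w"] by simp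
  then have w1: "norm w \<le> 1" using nw by simp
  have "norm (exp (\<i> * of_real y) - (\<Sum>i\<le>1. (\<i> * of_real y) ^ i / fact i))
      \<le> exp \<bar>Re (\<i> * of_real y)\<bar> * norm (\<i> * of_real y) ^ Suc 1 / fact 1"
    by (rule Taylor_exp)
  then have taylor: "norm (cis y - 1 - \<i> * of_real y) \<le> y\<^sup>2"
    by (simp add: cis_conv_exp norm_mult power2_eq_square algebra_simps)
  have "cis y - w = (cis y - 1 - \<i> * of_real y) + w * ((1 + \<i> * of_real y) * (1 - \<i> * of_real y) - 1)"
  proof -
    have "w * ((1 + \<i> * of_real y) * (1 - \<i> * of_real y) - 1) =
        (1 + \<i> * of_real y) * (w * (1 - \<i> * of_real y)) - w" by (simp add: algebra_simps)
    then show ?thesis unfolding w by simp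
  qed
  also have "(1 + \<i> * of_real y) * (1 - \<i> * of_real y) - 1 = of_real (y\<^sup>2)"
    by (simp add: algebra_simps power2_eq_square)
  finally have "norm (cis y - w) \<le> norm (cis y - 1 - \<i> * of_real y) + norm (w * of_real (y\<^sup>2))"
    by (metis norm_triangle_ineq)
  also have "\<dots> \<le> y\<^sup>2 + 1 * y\<^sup>2"
  proof (rule add_mono[OF taylor])
    have "norm (w * of_real (y\<^sup>2)) = norm w * y\<^sup>2" by (simp only: norm_mult norm_of_real) simp
    then show "norm (w * of_real (y\<^sup>2)) \<le> 1 * y\<^sup>2" using w1 by (simp add: mult_right_mono mult_left_le_one_le)
  qed
  finally have "norm (cis y - w) \<le> 2 * y\<^sup>2" by simp
  then have "real M * norm (cis y - w) \<le> real M * (2 * y\<^sup>2)" by (rule mult_left_mono) simp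
  moreover have "norm (cis y ^ M - w ^ M) \<le> real M * norm (cis y - w)"
    using w1 by (intro norm_power_diff) auto
  moreover have "cis y ^ M = cis x" using assms by (simp add: Complex.DeMoivre y_def)
  moreover have "real M * (2 * y\<^sup>2) = 2 * x\<^sup>2 / real M"
    using assms by (simp add: y_def power_divide power2_eq_square)
  ultimately show ?thesis by (simp add: approx_cis_def w_def y_def)
qed

lemma effective_approx_cis [eff]:
  assumes "effective M" "effective_real F"
  shows "effective_complex (\<lambda>e. approx_cis (M e) (F e))"
  unfolding approx_cis_def power2_eq_square by (intro eff assms)

section \<open>Comparison of integrals with sums over cells\<close>

lemma integral_le_sum_cells:
  fixes g :: "real \<Rightarrow> real"
  assumes cont: "continuous_on UNIV g" and "A \<le> B"
    and le: "\<And>c u. A \<le> c \<Longrightarrow> c < B \<Longrightarrow> of_int c / 2 ^ s \<le> u \<Longrightarrow> u \<le> of_int (c + 1) / 2 ^ s \<Longrightarrow> g u \<le> r c"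
  shows "integral {of_int A / 2 ^ s..of_int B / 2 ^ s} g \<le> sum r {A..<B} / 2 ^ s"
  using \<open>A \<le> B\<close> le
proof (induction B rule: int_ge_induct)
  case base
  show ?case by simp
next
  case (step B)
  have int: "g integrable_on {a..b}" for a b
    by (rule integrable_continuous_real[OF continuous_on_subset[OF cont]]) simp
  have "integral {of_int B / 2 ^ s..of_int (B + 1) / 2 ^ s} g \<le>
      integral {of_int B / 2 ^ s..of_int (B + 1) / 2 ^ s} (\<lambda>_::real. r B)"
    by (intro integral_le int) (use step in auto)
  also have "\<dots> = r B / 2 ^ s"
    by (simp add: divide_right_mono flip: diff_divide_distrib)
  finally have 1: "integral {of_int B / 2 ^ s..of_int (B + 1) / 2 ^ s} g \<le> r B / 2 ^ s" .
  have "integral {of_int A / 2 ^ s..of_int B / 2 ^ s} g + integral {of_int B / 2 ^ s..of_int (B + 1) / 2 ^ s} g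
      = integral {of_int A / 2 ^ s..of_int (B + 1) / 2 ^ s} g"
    using step.hyps by (intro Henstock_Kurzweil_Integration.integral_combine int divide_right_mono) auto
  moreover have "integral {of_int A / 2 ^ s..of_int B / 2 ^ s} g \<le> sum r {A..<B} / 2 ^ s"
    by (rule step.IH) (use step.prems in auto)
  moreover have "{A..<B + 1} = insert B {A..<B}" using step.hyps by auto
  ultimately show ?case using 1 by (simp add: add_divide_distrib)
qed

lemma sum_cells_le_integral:
  fixes g :: "real \<Rightarrow> real"
  assumes "continuous_on UNIV g" "A \<le> B"
    and "\<And>c u. A \<le> c \<Longrightarrow> c < B \<Longrightarrow> of_int c / 2 ^ s \<le> u \<Longrightarrow> u \<le> of_int (c + 1) / 2 ^ s \<Longrightarrow> r c \<le> g u"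
  shows "sum r {A..<B} / 2 ^ s \<le> integral {of_int A / 2 ^ s..of_int B / 2 ^ s} g"
  using integral_le_sum_cells[of "\<lambda>u. - g u" A B s "\<lambda>c. - r c"] assms
  by (simp add: continuous_on_minus sum_negf)

text \<open>At the least level \<open>e\<close> where blocks are at least as long as
  \<open>\<rho>\<close>, the ball lies in three adjacent blocks, each of length at most
  \<open>2 * \<rho>\<close>, provided \<open>e > 0\<close>. If single cells are already long enough,
  that length bound may fail, but then \<open>g\<close> itself is at most \<open>\<mu>\<close> on
  the ball.\<close>

lemma integral_around_le_of_light_blocks:
  fixes g :: "real \<Rightarrow> real" and \<mu> :: real
  assumes cont: "continuous_on UNIV g" and g0: "\<And>u. 0 \<le> g u" and t: "\<bar>t\<bar> \<le> 4"
    and le: "\<And>c u. - 8 * 2 ^ s \<le> c \<Longrightarrow> c < 8 * 2 ^ s \<Longrightarrow> of_int c / 2 ^ s \<le> u \<Longrightarrow>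
      u \<le> of_int (c + 1) / 2 ^ s \<Longrightarrow> g u \<le> r c"
    and light: "\<And>e i. e \<le> s \<Longrightarrow> \<lfloor>t * 2 ^ s\<rfloor> div 2 ^ e - 1 \<le> i \<Longrightarrow> i \<le> \<lfloor>t * 2 ^ s\<rfloor> div 2 ^ e + 1 \<Longrightarrow>
      sum r (block e i) \<le> \<mu> * 2 ^ e"
    and \<rho>: "0 < \<rho>" "\<rho> \<le> 1"
  shows "integral {t - \<rho>..t + \<rho>} g \<le> 6 * \<mu> * \<rho>"
proof -
  define h :: real where "h = 1 / 2 ^ s"
  have h: "h > 0" "h * 2 ^ s = 1" by (simp_all add: h_def)
  have int: "g integrable_on {a..b}" for a b
    by (rule integrable_continuous_real[OF continuous_on_subset[OF cont]]) simp
  define e where "e = (LEAST e. \<rho> \<le> 2 ^ e * h)"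
  have "\<rho> \<le> 2 ^ s * h" using \<rho> h by (simp add: mult.commute)
  then have e: "\<rho> \<le> 2 ^ e * h" "e \<le> s" unfolding e_def by (rule LeastI Least_le)+
  define a where "a = \<lfloor>t * 2 ^ s\<rfloor> div 2 ^ e"
  have "a = \<lfloor>t * 2 ^ (s - e)\<rfloor>"
    using floor_div_power2[of "s - e" s t] e(2) by (simp add: a_def)
  moreover have t_eq: "t = t * 2 ^ (s - e) * (2 ^ e * h)"
  proof -
    have "(2::real) ^ s = 2 ^ (s - e) * 2 ^ e" using e(2) by (simp flip: power_add)
    then show ?thesis by (simp add: h_def)
  qed
  ultimately have ta: "of_int a * (2 ^ e * h) \<le> t" "t \<le> of_int (a + 1) * (2 ^ e * h)"
    by (subst t_eq, use h in \<open>intro mult_right_mono; simp\<close>)+ 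
  have sub: "{t - \<rho>..t + \<rho>} \<subseteq> {of_int ((a - 1) * 2 ^ e) / 2 ^ s..of_int ((a + 2) * 2 ^ e) / 2 ^ s}"
    using ta e(1) by (auto simp: h_def field_simps)
  \<comment> \<open>The three blocks have length at most \<open>1\<close> each and
    \<open>\<bar>t\<bar> \<le> 4\<close>, so they stay in the window where \<open>r\<close>
    dominates \<open>g\<close>.\<close>
  have range: "- 8 * 2 ^ s \<le> (a - 1) * 2 ^ e" "(a + 2) * 2 ^ e \<le> 8 * 2 ^ s"
  proof -
    have 1: "2 ^ e * h \<le> 1" using e(2) by (simp add: h_def power_increasing)
    have "of_int (a - 1) * (2 ^ e * h) \<ge> - 8" "of_int (a + 2) * (2 ^ e * h) \<le> 8"
      using ta 1 t by (auto simp: algebra_simps abs_le_iff)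
    then have "real_of_int (- 8 * 2 ^ s) \<le> real_of_int ((a - 1) * 2 ^ e)"
      "real_of_int ((a + 2) * 2 ^ e) \<le> real_of_int (8 * 2 ^ s)"
      by (simp_all add: h_def field_simps)
    then show "- 8 * 2 ^ s \<le> (a - 1) * 2 ^ e" "(a + 2) * 2 ^ e \<le> 8 * 2 ^ s"
      by (simp_all only: of_int_le_iff)
  qed
  have r0: "0 \<le> r c" if "- 8 * 2 ^ s \<le> c" "c < 8 * 2 ^ s" for c
  proof -
    have "g (of_int c / 2 ^ s) \<le> r c" using that by (intro le) (auto simp: divide_right_mono)
    then show ?thesis using g0[of "of_int c / 2 ^ s"] by linarith
  qed
  have block0: "block 0 c = {c}" for c by (auto simp: block_def)
  have blocks: "{(a - 1) * 2 ^ e..<(a + 2) * 2 ^ e} = block e (a - 1) \<union> (block e a \<union> block e (a + 1))"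
  proof -
    have "(0::int) < 2 ^ e" by simp
    then show ?thesis unfolding block_def by (auto simp: algebra_simps)
  qed
  show ?thesis
  proof (cases e)
    case 0
    have "g u \<le> \<mu>" if "u \<in> {t - \<rho>..t + \<rho>}" for u
    proof -
      define c where "c = \<lfloor>u * 2 ^ s\<rfloor>"
      have u: "of_int (a - 1) / 2 ^ s \<le> u" "u \<le> of_int (a + 2) / 2 ^ s"
        using sub that unfolding 0 by auto
      have "a = \<lfloor>t * 2 ^ s\<rfloor>" by (simp add: a_def 0)
      have \<mu>le: "r c \<le> \<mu>" if "a - 1 \<le> c" "c \<le> a + 1" for c
        using light[of 0 c] that by (simp add: block0 \<open>a = \<lfloor>t * 2 ^ s\<rfloor>\<close>)
      have "\<exists>c. a - 1 \<le> c \<and> c \<le> a + 1 \<and> of_int c / 2 ^ s \<le> u \<and> u \<le> of_int (c + 1) / 2 ^ s"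
      proof (cases "u \<le> of_int (a + 1) / 2 ^ s")
        case True
        have "of_int (min c a) / 2 ^ s \<le> u" "a - 1 \<le> min c a" "u \<le> of_int (min c a + 1) / 2 ^ s"
          unfolding c_def using u True
          by (auto simp: field_simps min_def le_floor_iff) linarith+
        then show ?thesis by (intro exI[of _ "min c a"]) auto
      next
        case False
        then show ?thesis using u by (intro exI[of _ "a + 1"]) (auto simp: add.commute)
      qed
      then obtain c where c: "a - 1 \<le> c" "c \<le> a + 1" "of_int c / 2 ^ s \<le> u" "u \<le> of_int (c + 1) / 2 ^ s" by blast
      have "g u \<le> r c" using c range unfolding 0 by (intro le) auto
      with \<mu>le[OF c(1,2)] show ?thesis by linarith
    qed
    then have "integral {t - \<rho>..t + \<rho>} g \<le> integral {t - \<rho>..t + \<rho>} (\<lambda>_. \<mu>)"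
      by (intro integral_le int) auto
    also have "\<dots> = 2 * \<mu> * \<rho>" using \<rho> by simp
    also have "\<dots> \<le> 6 * \<mu> * \<rho>"
    proof -
      have "0 \<le> \<mu>" using light[of 0 "\<lfloor>t * 2 ^ s\<rfloor>"] r0[of "\<lfloor>t * 2 ^ s\<rfloor>"] range
        by (simp add: block0 0 a_def)
      then show ?thesis using \<rho> by (intro mult_right_mono) auto
    qed
    finally show ?thesis .
  next
    case (Suc k)
    then have "\<not> \<rho> \<le> 2 ^ k * h" unfolding e_def by (metis lessI not_less_Least)
    then have k: "2 ^ e * h \<le> 2 * \<rho>" by (simp add: Suc)
    have \<mu>0: "0 \<le> \<mu> * 2 ^ e"
    proof -
      have "0 \<le> sum r (block e a)"
        by (rule sum_nonneg, rule r0) (use range blocks in \<open>auto simp: block_def algebra_simps\<close>)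
      then show ?thesis using light[of e a] e(2) by (simp add: a_def)
    qed
    have "integral {t - \<rho>..t + \<rho>} g \<le> integral {of_int ((a - 1) * 2 ^ e) / 2 ^ s..of_int ((a + 2) * 2 ^ e) / 2 ^ s} g"
      using sub int g0 by (intro integral_subset_le) auto
    also have "\<dots> \<le> sum r {(a - 1) * 2 ^ e..<(a + 2) * 2 ^ e} / 2 ^ s"
      by (rule integral_le_sum_cells[OF cont]) (use range in \<open>auto intro!: le\<close>)
    also have "sum r {(a - 1) * 2 ^ e..<(a + 2) * 2 ^ e} = sum r (block e (a - 1)) + (sum r (block e a) + sum r (block e (a + 1)))"
    proof -
      have fin: "finite (block e i)" for i by (simp add: block_def)
      have disj: "block e i \<inter> block e j = {}" if "i < j" for i j
      proof -
        have "(i + 1) * 2 ^ e \<le> j * 2 ^ e" using that by (intro mult_right_mono) auto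
        then show ?thesis by (auto simp: block_def)
      qed
      show ?thesis unfolding blocks using fin disj by (simp add: sum.union_disjoint Int_Un_distrib)
    qed
    also have "\<dots> \<le> \<mu> * 2 ^ e + (\<mu> * 2 ^ e + \<mu> * 2 ^ e)"
      using e(2) by (intro add_mono light) (auto simp: a_def)
    finally have "integral {t - \<rho>..t + \<rho>} g \<le> 3 * (\<mu> * 2 ^ e) / 2 ^ s"
      by (simp add: divide_right_mono)
    also have "\<dots> = 3 * \<mu> * (2 ^ e * h)" by (simp add: h_def)
    also have "\<dots> \<le> 3 * \<mu> * (2 * \<rho>)"
    proof -
      have "0 \<le> \<mu>" using \<mu>0 by (meson mult_neg_pos not_le zero_less_numeral zero_less_power)
      then show ?thesis using k by (intro mult_left_mono) auto
    qed
    finally show ?thesis by simp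
  qed
qed

lemma effective_real_bounded_by_nat:
  assumes "effective_real F"
  obtains B where "effective B" "\<And>e. F e \<le> real (B e)"
proof -
  obtain a b where 1: "effective a" "effective b" "\<And>e. b e > 0" "\<And>e. F e = of_int (a e) / real (b e)"
    using assms by (rule effective_realE) (rule that; simp)
  have "F e \<le> real (nat \<bar>a e\<bar>)" for e
  proof -
    have "of_int (a e) \<le> real (nat \<bar>a e\<bar>) * 1" by simp
    also have "\<dots> \<le> real (nat \<bar>a e\<bar>) * real (b e)"
      using 1(3)[of e] by (intro mult_left_mono) auto
    finally show ?thesis using 1(3)[of e] by (simp add: 1(4) divide_le_eq)
  qed
  moreover have "effective (\<lambda>e. nat \<bar>a e\<bar>)" by (intro eff 1)
  ultimately show ?thesis using that by blast
qed

lemma sum_symmetric_int: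
  "(\<Sum>l = - int d..int d. f l) = (\<Sum>i<Suc (2 * d). f (int i - int d))"
  by (rule sum.reindex_bij_witness[where i = "\<lambda>i. int i - int d" and j = "\<lambda>l. nat (l + int d)"]) auto

lemma le_div_iff_mult_le_int:
  fixes a c q :: int
  assumes "0 < q"
  shows "a \<le> c div q \<longleftrightarrow> a * q \<le> c"
proof
  assume "a \<le> c div q"
  then have "a * q \<le> c div q * q" using assms by (intro mult_right_mono) auto
  also have "\<dots> \<le> c" using div_mult_mod_eq[of c q] pos_mod_sign[OF assms, of c] by linarith
  finally show "a * q \<le> c" .
next
  assume "a * q \<le> c"
  then show "a \<le> c div q" using zdiv_mono1[of "a * q" c q] assms by simp
qed

lemma norm_cis_diff_le: "norm (cis a - cis b) \<le> \<bar>a - b\<bar>"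
proof -
  have "cis a - cis b = cis b * (cis (a - b) - 1)"
    by (simp add: right_diff_distrib cis_mult)
  then have "norm (cis a - cis b) = norm (cis (a - b) - 1)" by (simp add: norm_mult)
  also have "\<dots> = 2 * \<bar>sin ((a - b) / 2)\<bar>"
    using dist_exp_i_1[of "a - b"] by (simp add: cis_conv_exp)
  also have "\<dots> \<le> \<bar>a - b\<bar>" using abs_sin_x_le_abs_x[of "(a - b) / 2"] by simp
  finally show ?thesis .
qed

text \<open>The value at the left end point of a cell, computed with \<^const>\<open>approx_cis\<close>, is accurate on the whole
  cell by the Lipschitz bound, once the cells are small compared with degree and coefficients.\<close>

lemma effective_step_majorant:
  fixes coef :: "nat \<Rightarrow> int \<Rightarrow> complex" and d K :: "nat \<Rightarrow> nat"
  assumes coef: "effective_complex (\<lambda>x. coef (fst x) (snd x))" and d: "effective d" and K: "effective K"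
    and K0: "\<And>n. K n > 0"
  obtains s r where "effective s" "effective_real (\<lambda>x. r (fst x) (snd x))" "\<And>n c. 0 \<le> r n c"
    "\<And>n c u. - 8 * 2 ^ s n \<le> c \<Longrightarrow> c < 8 * 2 ^ s n \<Longrightarrow> of_int c / 2 ^ s n \<le> u \<Longrightarrow> u \<le> of_int (c + 1) / 2 ^ s n \<Longrightarrow>
      norm (trig_sum (d n) (coef n) u) \<le> r n c \<and> r n c \<le> 2 * norm (trig_sum (d n) (coef n) u) + 1 / real (K n)"
proof -
  note coef' = effective_complex_compose2[OF coef] and d' = effective_compose[OF d] and K' = effective_compose[OF K]
  define S where "S n = (\<Sum>i<Suc (2 * d n). \<bar>Re (coef n (int i - int (d n)))\<bar> + \<bar>Im (coef n (int i - int (d n)))\<bar>)" for n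
  have "effective_real S" unfolding S_def by (intro eff d d' coef')
  then obtain A where A: "effective A" and SA: "\<And>n. S n \<le> real (A n)"
    by (rule effective_real_bounded_by_nat) blast
  note A' = effective_compose[OF A]
  \<comment> \<open>Either parameter keeps its share of the error below
    \<open>1 / (8 * K n)\<close>. As an exponent \<open>s n\<close> is used through
    \<open>s n < 2 ^ s n\<close>; in \<open>1024 = 8 * 128\<close> the factor
    \<open>128 = 2 * 8\<^sup>2\<close> comes from \<open>\<bar>x\<bar> \<le> 8\<close> in the bound
    for \<open>approx_cis\<close>.\<close>
  define s where "s n = 8 * K n * (A n * d n)" for n
  define M where "M n = Suc (1024 * K n * (A n * (d n * d n)))" for n
  have s: "effective s" unfolding s_def by (intro eff K A d)
  note s' = effective_compose[OF s]
  define P where "P n c = (\<Sum>i<Suc (2 * d n). coef n (int i - int (d n)) *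
    approx_cis (M n) (real_of_int (int i - int (d n)) * (real_of_int c / 2 ^ s n)))" for n c
  \<comment> \<open>The modulus of a complex number with rational parts need not be rational;
    \<open>\<bar>Re\<bar> + \<bar>Im\<bar>\<close> is, and it loses at most a factor
    \<open>2\<close>. The last summand covers the approximation error.\<close>
  define r where "r n c = \<bar>Re (P n c)\<bar> + \<bar>Im (P n c)\<bar> + 1 / (4 * real (K n))" for n c
  have "effective_complex (\<lambda>x. P (fst x) (snd x))"
    unfolding P_def M_def by (intro eff d' K' A' s' coef')
  then have "effective_real (\<lambda>x. r (fst x) (snd x))" unfolding r_def by (intro eff K')
  moreover have "0 \<le> r n c" for n c by (simp add: r_def)
  moreover have "norm (trig_sum (d n) (coef n) u) \<le> r n c \<and> r n c \<le> 2 * norm (trig_sum (d n) (coef n) u) + 1 / real (K n)"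
    if c: "- 8 * 2 ^ s n \<le> c" "c < 8 * 2 ^ s n" and u: "of_int c / 2 ^ s n \<le> u" "u \<le> of_int (c + 1) / 2 ^ s n"
    for n c u
  proof -
    define x where "x = real_of_int c / 2 ^ s n"
    have "real_of_int (- 8 * 2 ^ s n) \<le> of_int c" "real_of_int c \<le> of_int (8 * 2 ^ s n)"
      using c unfolding of_int_le_iff by simp_all
    then have x8: "\<bar>x\<bar> \<le> 8" by (simp add: x_def field_simps abs_le_iff)
    have "u - x \<le> 1 / 2 ^ s n" "0 \<le> u - x" using u by (simp_all add: x_def add_divide_distrib)
    then have ux: "\<bar>u - x\<bar> \<le> 1 / 2 ^ s n" by simp
    define E where "E = real (d n) / 2 ^ s n + 128 * (real (d n))\<^sup>2 / real (M n)"
    have term_le: "norm (trig_e l u - approx_cis (M n) (real_of_int l * x)) \<le> E" if l: "\<bar>l\<bar> \<le> int (d n)" for l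
    proof -
      have l': "\<bar>real_of_int l\<bar> \<le> real (d n)" using l by linarith
      have "norm (trig_e l u - cis (real_of_int l * x)) \<le> \<bar>real_of_int l * u - real_of_int l * x\<bar>"
        unfolding trig_e_cis by (rule norm_cis_diff_le)
      also have "\<dots> = \<bar>real_of_int l\<bar> * \<bar>u - x\<bar>" by (simp add: abs_mult flip: right_diff_distrib)
      also have "\<dots> \<le> real (d n) * (1 / 2 ^ s n)" using l' ux by (intro mult_mono) auto
      finally have 1: "norm (trig_e l u - cis (real_of_int l * x)) \<le> real (d n) / 2 ^ s n" by simp
      have "norm (cis (real_of_int l * x) - approx_cis (M n) (real_of_int l * x)) \<le> 2 * (real_of_int l * x)\<^sup>2 / real (M n)"
        by (rule norm_cis_minus_approx_cis_le) (simp add: M_def)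
      also have "\<dots> \<le> 2 * (real (d n) * 8)\<^sup>2 / real (M n)"
      proof (intro divide_right_mono mult_left_mono)
        have "\<bar>real_of_int l * x\<bar> \<le> real (d n) * 8" unfolding abs_mult using l' x8 by (intro mult_mono) auto
        then show "(real_of_int l * x)\<^sup>2 \<le> (real (d n) * 8)\<^sup>2" by (metis abs_le_square_iff abs_of_nonneg abs_ge_zero order_trans)
      qed auto
      finally have 2: "norm (cis (real_of_int l * x) - approx_cis (M n) (real_of_int l * x)) \<le> 128 * (real (d n))\<^sup>2 / real (M n)"
        by (simp add: power_mult_distrib)
      show ?thesis unfolding E_def using 1 2
        by (smt (verit) norm_triangle_ineq diff_add_cancel add_diff_eq)
    qed
    have "norm (trig_sum (d n) (coef n) u - P n c) \<le> (\<Sum>i<Suc (2 * d n). norm (coef n (int i - int (d n)) *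
        (trig_e (int i - int (d n)) u - approx_cis (M n) (real_of_int (int i - int (d n)) * x))))"
      unfolding trig_sum_def sum_symmetric_int P_def x_def sum_subtractf[symmetric] right_diff_distrib
      by (rule norm_sum)
    also have "\<dots> \<le> (\<Sum>i<Suc (2 * d n). (\<bar>Re (coef n (int i - int (d n)))\<bar> + \<bar>Im (coef n (int i - int (d n)))\<bar>) * E)"
      unfolding norm_mult by (intro sum_mono mult_mono cmod_le term_le) auto
    also have "\<dots> = S n * E" unfolding S_def by (rule sum_distrib_right[symmetric])
    also have "\<dots> \<le> real (A n) * E" using SA[of n] by (intro mult_right_mono) (auto simp: E_def)
    also have "\<dots> \<le> 1 / (8 * real (K n)) + 1 / (8 * real (K n))"
      unfolding E_def distrib_left
    proof (rule add_mono)
      have "s n < 2 ^ s n" by simp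
      then have "real (s n) \<le> 2 ^ s n" by (metis less_imp_le of_nat_le_numeral_power_cancel_iff)
      then have "8 * real (K n) * (real (A n) * real (d n)) \<le> 2 ^ s n" by (simp add: s_def)
      then show "real (A n) * (real (d n) / 2 ^ s n) \<le> 1 / (8 * real (K n))"
        using K0[of n] by (simp add: field_simps)
      have "M n > 0" by (simp add: M_def)
      then have "real (M n) > 0" by simp
      moreover have "1024 * real (K n) * (real (A n) * (real (d n) * real (d n))) \<le> real (M n)"
        by (simp add: M_def)
      ultimately show "real (A n) * (128 * (real (d n))\<^sup>2 / real (M n)) \<le> 1 / (8 * real (K n))"
        using K0[of n] by (simp add: field_simps power2_eq_square)
    qed
    finally have *: "norm (trig_sum (d n) (coef n) u - P n c) \<le> 1 / (4 * real (K n))" by simp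
    have "norm (trig_sum (d n) (coef n) u) \<le> norm (P n c) + 1 / (4 * real (K n))"
      using * norm_triangle_ineq2[of "trig_sum (d n) (coef n) u" "P n c"] by linarith
    then have 1: "norm (trig_sum (d n) (coef n) u) \<le> r n c" using cmod_le[of "P n c"] by (simp add: r_def)
    have "norm (P n c) \<le> norm (trig_sum (d n) (coef n) u) + 1 / (4 * real (K n))"
      using * norm_triangle_ineq2[of "P n c" "trig_sum (d n) (coef n) u"] by (simp add: norm_minus_commute)
    then have "r n c \<le> 2 * norm (trig_sum (d n) (coef n) u) + 3 * (1 / (4 * real (K n)))"
      using abs_Re_le_cmod[of "P n c"] abs_Im_le_cmod[of "P n c"] unfolding r_def by linarith
    also have "\<dots> \<le> 2 * norm (trig_sum (d n) (coef n) u) + 1 / real (K n)"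
      using K0[of n] by (simp add: field_simps)
    finally show ?thesis using 1 by simp
  qed
  ultimately show ?thesis by (rule that[OF s])
qed

text \<open>Off the listed cells all blocks near \<open>t\<close> have averages at most
  \<open>2 ^ - n\<close>. This controls the integrals over balls around \<open>t\<close>, and every
  mean is at most \<open>48 * 6 / 2 ^ n\<close>. The step function is given the precision
  \<open>4 ^ - n\<close>, which matches the norm of the polynomial.\<close>

lemma large_cesaro_means_imp_cell_covered:
  fixes coef :: "nat \<Rightarrow> int \<Rightarrow> complex" and d :: "nat \<Rightarrow> nat"
  assumes coef: "effective_complex (\<lambda>x. coef (fst x) (snd x))" and d: "effective d"
    and norm: "\<And>n. L1_norm (trig_sum (d n) (coef n)) \<le> 2 / 4 ^ n"
    and t: "t \<in> {-pi..pi}"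
    and inf: "\<exists>\<^sub>\<infinity>n. \<exists>N. norm (cesaro_mean N (trig_sum (d n) (coef n)) t) > 288 / 2 ^ n"
  shows "cell_covered t"
proof -
  have "effective (\<lambda>n::nat. 4 ^ n :: nat)" by (intro eff)
  then obtain s r where s: "effective s" and r: "effective_real (\<lambda>x. r (fst x) (snd x))" and r0: "\<And>n c. 0 \<le> r n c"
    and r_eq: "\<And>n c u. - 8 * 2 ^ s n \<le> c \<Longrightarrow> c < 8 * 2 ^ s n \<Longrightarrow> of_int c / 2 ^ s n \<le> u \<Longrightarrow> u \<le> of_int (c + 1) / 2 ^ s n \<Longrightarrow>
      norm (trig_sum (d n) (coef n) u) \<le> r n c \<and> r n c \<le> 2 * norm (trig_sum (d n) (coef n) u) + 1 / real (4 ^ n)"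
    by (rule effective_step_majorant[OF coef d]) auto
  note s' = effective_compose[OF s]
  define p where "p n = trig_sum (d n) (coef n)" for n
  define g where "g n u = norm (p n u)" for n u
  have cont_p: "continuous_on UNIV (p n)" for n unfolding p_def by (rule continuous_on_trig_sum)
  then have cont: "continuous_on UNIV (g n)" for n unfolding g_def by (rule continuous_on_norm)
  have per_p: "p n (u + 2 * pi) = p n u" for n u by (simp add: p_def trig_sum_periodic)
  then have per: "g n (u + 2 * pi) = g n u" for n u by (simp add: g_def)
  have int: "g n integrable_on {a..b}" for n a b
    by (rule integrable_continuous_real[OF continuous_on_subset[OF cont]]) simp
  have norm_g: "integral {-pi..pi} (g n) \<le> 2 / 4 ^ n" for n
  proof -
    have "L1_norm (p n) = integral {-pi..pi} (g n)"
      unfolding L1_norm_def g_def[symmetric]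
      by (intro lebesgue_integral_eq_integral continuous_imp_integrable_real continuous_on_subset[OF cont]) auto
    then show ?thesis using norm[of n] by (simp add: p_def)
  qed
  define heavy where "heavy n e i \<longleftrightarrow> 2 ^ e / 2 ^ n < sum (r n) (block e i)" for n e i
  define D where "D n c \<longleftrightarrow> (- int (7 * 2 ^ s n) \<le> c \<and> c < int (7 * 2 ^ s n)) \<and>
    (\<exists>e\<le>s n. heavy n e (c div 2 ^ e - 1) \<or> heavy n e (c div 2 ^ e) \<or> heavy n e (c div 2 ^ e + 1))" for n c
  have "effective (\<lambda>x. D (fst x) (snd x))"
  proof -
    have "sum (r n) (block e i) = (\<Sum>m<2 ^ e. r n (i * 2 ^ e + int m))" for n e i
      by (rule sum.reindex_bij_witness[where i = "\<lambda>m. i * 2 ^ e + int m" and j = "\<lambda>c. nat (c - i * 2 ^ e)"])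
         (auto simp: block_def algebra_simps nat_less_iff)
    then have "heavy n e i \<longleftrightarrow> 2 ^ e / 2 ^ n < (\<Sum>m<2 ^ e. r n (i * 2 ^ e + int m))" for n e i
      by (simp add: heavy_def)
    then show ?thesis unfolding D_def by (simp only:) (intro eff s' effective_real_compose2[OF r])
  qed
  moreover have "- (7 * 2 ^ s n) \<le> c \<and> c < 7 * 2 ^ s n" if "D n c" for n c using that by (simp add: D_def)
  moreover have "card {c. D n c} * 2 ^ n \<le> 84 * 2 ^ s n" for n
  proof -
    \<comment> \<open>Blocks of level \<open>s n\<close> are unit intervals, so sixteen dyadic trees
      cover the window \<open>[-8, 8)\<close>.\<close>
    define W where "W j = {c. \<exists>e\<le>s n. \<exists>i. i div 2 ^ (s n - e) = j \<and> 1 / 2 ^ n * 2 ^ e < sum (r n) (block e i) \<and>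
      i - 1 \<le> c div 2 ^ e \<and> c div 2 ^ e \<le> i + 1}" for j :: int
    have W: "finite (W j)" "1 / 2 ^ n * card (W j) \<le> 3 * sum (r n) (block (s n) j)" for j
      unfolding W_def by (rule card_near_heavy_blocks_le; use r0 in simp)+
    have "{c. D n c} \<subseteq> (\<Union>j\<in>{-8..<8}. W j)"
    proof
      fix c assume "c \<in> {c. D n c}"
      then have "D n c" by simp
      then obtain e where c: "- (7 * 2 ^ s n) \<le> c" "c < 7 * 2 ^ s n" and e: "e \<le> s n"
        and h: "heavy n e (c div 2 ^ e - 1) \<or> heavy n e (c div 2 ^ e) \<or> heavy n e (c div 2 ^ e + 1)"
        unfolding D_def by auto
      have "\<exists>i. heavy n e i \<and> i - 1 \<le> c div 2 ^ e \<and> c div 2 ^ e \<le> i + 1"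
        using h by (elim disjE) (rule exI, rule conjI, assumption, simp)+
      then obtain i where i: "heavy n e i" "i - 1 \<le> c div 2 ^ e" "c div 2 ^ e \<le> i + 1" by blast
      have eq: "(2::int) ^ s n = 2 ^ (s n - e) * 2 ^ e" using e by (simp flip: power_add)
      have "- 7 * 2 ^ (s n - e) \<le> c div 2 ^ e"
        using c eq by (subst le_div_iff_mult_le_int) (simp_all add: mult.assoc)
      moreover have "\<not> 7 * 2 ^ (s n - e) \<le> c div 2 ^ e"
        using c eq by (subst le_div_iff_mult_le_int) (simp_all add: mult.assoc)
      moreover have "(1::int) \<le> 2 ^ (s n - e)" by simp
      ultimately have "- 8 * 2 ^ (s n - e) \<le> i" "i < 8 * 2 ^ (s n - e)" using i by linarith+
      then have "- 8 \<le> i div 2 ^ (s n - e)" "\<not> 8 \<le> i div 2 ^ (s n - e)"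
        by (subst le_div_iff_mult_le_int; simp)+
      moreover have "c \<in> W (i div 2 ^ (s n - e))"
        unfolding W_def using e i by (auto simp: heavy_def)
      ultimately show "c \<in> (\<Union>j\<in>{-8..<8}. W j)" by auto
    qed
    then have "card {c. D n c} \<le> card (\<Union>j\<in>{-8..<8}. W j)" using W(1) by (intro card_mono) auto
    also have "\<dots> \<le> (\<Sum>j\<in>{-8..<8}. card (W j))" by (rule card_UN_le) simp
    finally have "real (card {c. D n c}) \<le> (\<Sum>j\<in>{-8..<8}. real (card (W j)))"
      by (metis of_nat_le_iff of_nat_sum)
    then have "1 / 2 ^ n * real (card {c. D n c}) \<le> 1 / 2 ^ n * (\<Sum>j\<in>{-8..<8}. real (card (W j)))"
      by (rule mult_left_mono) simp
    also have "\<dots> \<le> (\<Sum>j\<in>{-8..<8}. 3 * sum (r n) (block (s n) j))"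
      unfolding sum_distrib_left[of "1 / 2 ^ n"] by (intro sum_mono W(2))
    also have "\<dots> = 3 * sum (r n) (\<Union>j\<in>{-8..<8}. block (s n) j)"
    proof -
      have disj: "block (s n) i \<inter> block (s n) j = {}" if "i < j" for i j
      proof -
        have "(i + 1) * 2 ^ s n \<le> j * 2 ^ s n" using that by (intro mult_right_mono) auto
        then show ?thesis by (auto simp: block_def)
      qed
      have "\<forall>i\<in>{-8..<8}. \<forall>j\<in>{-8..<8}. i \<noteq> j \<longrightarrow> block (s n) i \<inter> block (s n) j = {}"
        using disj by (metis Int_commute linorder_neqE)
      then show ?thesis by (subst sum.UNION_disjoint) (auto simp: sum_distrib_left block_def)
    qed
    also have "\<dots> \<le> 3 * sum (r n) {- 8 * 2 ^ s n..<8 * 2 ^ s n}"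
    proof (intro mult_left_mono sum_mono2)
      show "(\<Union>j\<in>{-8..<8}. block (s n) j) \<subseteq> {- 8 * 2 ^ s n..<8 * 2 ^ s n}"
      proof
        fix c assume "c \<in> (\<Union>j\<in>{-8..<8}. block (s n) j)"
        then obtain j where j: "-8 \<le> j" "j + 1 \<le> 8" "j * 2 ^ s n \<le> c" "c < (j + 1) * 2 ^ s n" by (auto simp: block_def)
        then have "- 8 * 2 ^ s n \<le> j * 2 ^ s n" "(j + 1) * 2 ^ s n \<le> 8 * 2 ^ s n" by (intro mult_right_mono; simp)+
        then show "c \<in> {- 8 * 2 ^ s n..<8 * 2 ^ s n}" using j unfolding atLeastLessThan_iff by linarith
      qed
    qed (use r0 in auto)
    finally have 1: "1 / 2 ^ n * real (card {c. D n c}) \<le> 3 * sum (r n) {- 8 * 2 ^ s n..<8 * 2 ^ s n}" .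
    \<comment> \<open>The outcome is \<open>28 = 2 * 3 * 2 + 16\<close>: twice the norm bound
      \<open>2 / 4 ^ n\<close> over three periods, plus the precision \<open>1 / 4 ^ n\<close> on an
      interval of length \<open>16\<close>. The weak type factor \<open>3\<close> turns this into
      \<open>84\<close>.\<close>
    have "sum (r n) {- 8 * 2 ^ s n..<8 * 2 ^ s n} / 2 ^ s n \<le>
        integral {of_int (- 8 * 2 ^ s n) / 2 ^ s n..of_int (8 * 2 ^ s n) / 2 ^ s n} (\<lambda>u. 2 * g n u + 1 / real (4 ^ n))"
      by (rule sum_cells_le_integral) (use r_eq cont in \<open>auto intro!: continuous_intros simp: g_def p_def\<close>)
    also have "\<dots> = 2 * integral {-8..8} (g n) + 16 / 4 ^ n"
    proof -
      have "integral {-8..8} (\<lambda>u. 2 * g n u + 1 / real (4 ^ n)) =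
          integral {-8..8} (\<lambda>u. 2 * g n u) + integral {-8..8} (\<lambda>u::real. 1 / real (4 ^ n))"
        by (intro Henstock_Kurzweil_Integration.integral_add integrable_on_mult_right int integrable_const_ivl)
      then show ?thesis by simp
    qed
    also have "integral {-8..8} (g n) \<le> integral {- 3 * pi..3 * pi} (g n)"
      using pi_gt3 by (intro integral_subset_le int) (auto simp: g_def)
    also have "\<dots> = 3 * integral {-pi..pi} (g n)" by (rule integral_three_periods[OF cont per])
    finally have "sum (r n) {- 8 * 2 ^ s n..<8 * 2 ^ s n} / 2 ^ s n \<le> 28 / 4 ^ n"
      using norm_g[of n] by (simp add: add_divide_distrib)
    then have "sum (r n) {- 8 * 2 ^ s n..<8 * 2 ^ s n} \<le> 28 / 4 ^ n * 2 ^ s n" by (simp add: divide_le_eq)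
    with 1 have 2: "1 / 2 ^ n * real (card {c. D n c}) \<le> 84 / 4 ^ n * 2 ^ s n" by simp
    have "(4::real) ^ n = 2 ^ n * 2 ^ n" by (simp flip: power_mult_distrib)
    with 2 have "real (card {c. D n c} * 2 ^ n) \<le> real (84 * 2 ^ s n)" by (simp add: field_simps)
    then show ?thesis by (simp only: of_nat_le_iff)
  qed
  moreover have "\<exists>\<^sub>\<infinity>n. D n \<lfloor>t * 2 ^ s n\<rfloor>"
    using inf
  proof (rule INFM_mono)
    fix n assume large: "\<exists>N. norm (cesaro_mean N (trig_sum (d n) (coef n)) t) > 288 / 2 ^ n"
    have t4: "\<bar>t\<bar> \<le> pi" "\<bar>t\<bar> \<le> 4" "\<bar>t\<bar> < 7" using t pi_less_4 by auto
    show "D n \<lfloor>t * 2 ^ s n\<rfloor>"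
    proof (rule ccontr)
      assume notD: "\<not> D n \<lfloor>t * 2 ^ s n\<rfloor>"
      have "- 7 \<le> t" "t < 7" using t4 by auto
      then have "- 7 * 2 ^ s n \<le> t * 2 ^ s n" "t * 2 ^ s n < 7 * 2 ^ s n"
        by (intro mult_right_mono mult_strict_right_mono; simp)+
      then have "- int (7 * 2 ^ s n) \<le> \<lfloor>t * 2 ^ s n\<rfloor> \<and> \<lfloor>t * 2 ^ s n\<rfloor> < int (7 * 2 ^ s n)"
        by (simp add: le_floor_iff floor_less_iff)
      with notD have light: "sum (r n) (block e i) \<le> 1 / 2 ^ n * 2 ^ e"
        if "e \<le> s n" "\<lfloor>t * 2 ^ s n\<rfloor> div 2 ^ e - 1 \<le> i" "i \<le> \<lfloor>t * 2 ^ s n\<rfloor> div 2 ^ e + 1" for e i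
      proof -
        have "i = \<lfloor>t * 2 ^ s n\<rfloor> div 2 ^ e - 1 \<or> i = \<lfloor>t * 2 ^ s n\<rfloor> div 2 ^ e \<or> i = \<lfloor>t * 2 ^ s n\<rfloor> div 2 ^ e + 1"
          using that by linarith
        then have "\<not> heavy n e i"
          using notD that(1) \<open>- int (7 * 2 ^ s n) \<le> \<lfloor>t * 2 ^ s n\<rfloor> \<and> \<lfloor>t * 2 ^ s n\<rfloor> < int (7 * 2 ^ s n)\<close>
          unfolding D_def by auto
        then show ?thesis by (simp add: heavy_def)
      qed
      \<comment> \<open>Blocks only reach up to length \<open>1\<close>; larger balls are handled by
        the norm over a full period.\<close>
      have max: "integral {t - \<rho>..t + \<rho>} (g n) \<le> 6 * (1 / 2 ^ n) * \<rho>" if "0 < \<rho>" "\<rho> \<le> pi" for \<rho>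
      proof (cases "\<rho> \<le> 1")
        case True
        show ?thesis
          by (rule integral_around_le_of_light_blocks[OF cont _ t4(2) _ light that(1) True])
             (use r_eq in \<open>auto simp: g_def p_def\<close>)
      next
        case False
        have "integral {t - \<rho>..t + \<rho>} (g n) \<le> integral {t - pi..t + pi} (g n)"
          using that by (intro integral_subset_le int) (auto simp: g_def)
        also have "\<dots> = integral {-pi..pi} (g n)" by (rule integral_period[OF cont per t4(1)])
        also have "\<dots> \<le> 2 / 4 ^ n" by (rule norm_g)
        also have "\<dots> \<le> 6 / 2 ^ n * 1"
          by (simp add: frac_le power_mono)
        also have "\<dots> \<le> 6 / 2 ^ n * \<rho>" using False by (intro mult_left_mono) auto
        finally show ?thesis by simp
      qed
      have "norm (cesaro_mean N (p n) t) \<le> 48 * (6 * (1 / 2 ^ n))" for N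
        by (rule norm_cesaro_mean_le_maximal[OF cont_p per_p t4(1) max[unfolded g_def]])
      then show False using large by (auto simp: p_def not_less[symmetric])
    qed
  qed
  ultimately show ?thesis unfolding cell_covered_def using s by blast
qed

section \<open>Convergence at Schnorr random points\<close>

lemma trig_eval_eq_trig_sum:
  assumes "trig_degree \<tau> \<le> d"
  shows "trig_eval \<tau> = trig_sum d (Poly_Mapping.lookup \<tau>)"
proof
  fix t
  have "nat \<bar>l\<bar> \<le> d" if "l \<in> Poly_Mapping.keys \<tau>" for l
  proof -
    have "nat \<bar>l\<bar> \<le> trig_degree \<tau>" unfolding trig_degree_def using that by (intro Max_ge) auto
    with assms show ?thesis by simp
  qed
  then have "Poly_Mapping.keys \<tau> \<subseteq> {- int d..int d}" by fastforce
  then show "trig_eval \<tau> t = trig_sum d (Poly_Mapping.lookup \<tau>) t"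
    unfolding trig_eval_def trig_sum_def by (intro sum.mono_neutral_left) (auto simp: in_keys_iff)
qed

lemma trig_eval_L1: "trig_eval \<tau> \<in> L1"
  unfolding trig_eval_eq_trig_sum[OF order_refl] by (rule trig_sum_L1)

lemma trig_sum_diff: "trig_sum d b t - trig_sum d c t = trig_sum d (\<lambda>l. b l - c l) t"
  by (simp add: trig_sum_def left_diff_distrib sum_subtractf)

lemma computable_trig_poly_seq_effective:
  assumes "computable_trig_poly_seq \<tau>"
  shows "effective (\<lambda>n. trig_degree (\<tau> n))"
    and "effective_complex (\<lambda>x. Poly_Mapping.lookup (\<tau> (fst x)) (snd x))"
proof -
  show "effective (\<lambda>n. trig_degree (\<tau> n))"
    using assms effective_computable[OF _ effective_id] unfolding computable_trig_poly_seq_def by blast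
  from assms obtain a b where ab: "effective_real (\<lambda>x. real_of_rat (a (fst x) (snd x)))"
    "effective_real (\<lambda>x. real_of_rat (b (fst x) (snd x)))"
    and "\<forall>n j. Poly_Mapping.lookup (\<tau> n) (int_decode j) = Complex (real_of_rat (a n j)) (real_of_rat (b n j))"
    unfolding computable_trig_poly_seq_def computable_rat2_iff by blast
  then have "Poly_Mapping.lookup (\<tau> n) l =
      Complex (real_of_rat (a n (int_encode l))) (real_of_rat (b n (int_encode l)))" for n l
    by (metis int_encode_inverse)
  then show "effective_complex (\<lambda>x. Poly_Mapping.lookup (\<tau> (fst x)) (snd x))"
    by (simp only:) (intro eff effective_real_compose2[OF ab(1)] effective_real_compose2[OF ab(2)])
qed

lemma computable_trig_poly_seq_compose:
  assumes "computable_trig_poly_seq \<tau>" "effective f"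
  shows "computable_trig_poly_seq (\<lambda>n. \<tau> (f n))"
proof -
  from assms(1) obtain a b where ab: "effective_real (\<lambda>x. real_of_rat (a (fst x) (snd x)))"
    "effective_real (\<lambda>x. real_of_rat (b (fst x) (snd x)))"
    and eq: "\<And>n j. Poly_Mapping.lookup (\<tau> n) (int_decode j) = Complex (real_of_rat (a n j)) (real_of_rat (b n j))"
    and \<tau>: "\<And>n. rational_trig_poly (\<tau> n)"
    unfolding computable_trig_poly_seq_def computable_rat2_iff by blast
  have "computable (\<lambda>n. trig_degree (\<tau> (f n)))"
    by (intro effective_imp_computable
        effective_compose[OF computable_trig_poly_seq_effective(1)[OF assms(1)] assms(2)])
  moreover have "computable_rat2 (\<lambda>n. a (f n))" "computable_rat2 (\<lambda>n. b (f n))"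
    unfolding computable_rat2_iff
    by (intro eff effective_real_compose2[OF ab(1)] effective_real_compose2[OF ab(2)] effective_compose[OF assms(2)])+
  ultimately show ?thesis unfolding computable_trig_poly_seq_def using eq \<tau> by blast
qed

lemma L1_norm_triangle:
  assumes "f \<in> L1" "g \<in> L1" "h \<in> L1"
  shows "L1_norm (\<lambda>t. f t - h t) \<le> L1_norm (\<lambda>t. f t - g t) + L1_norm (\<lambda>t. g t - h t)"
proof -
  have "L1_norm (\<lambda>t. f t - h t) \<le> (LINT t|lebesgue_on {-pi..pi}. norm (f t - g t) + norm (g t - h t))"
    unfolding L1_norm_def using assms
    by (intro integral_mono) (auto intro: norm_triangle_le norm_diff_triangle_ineq norm_diff_triangle_le)
  also have "\<dots> = L1_norm (\<lambda>t. f t - g t) + L1_norm (\<lambda>t. g t - h t)"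
    unfolding L1_norm_def using assms by (intro Bochner_Integration.integral_add) auto
  finally show ?thesis .
qed

lemma L1_norm_minus_commute: "L1_norm (\<lambda>t. f t - g t) = L1_norm (\<lambda>t. g t - f t)"
  by (simp add: L1_norm_def norm_minus_commute)

lemma cesaro_mean_L1_tendsto:
  assumes "f \<in> L1" "\<And>n. g n \<in> L1" "(\<lambda>n. L1_norm (\<lambda>t. g n t - f t)) \<longlonglongrightarrow> 0"
  shows "(\<lambda>n. cesaro_mean N (g n) t) \<longlonglongrightarrow> cesaro_mean N f t"
proof -
  have le: "norm (cesaro_mean N (g n) t - cesaro_mean N f t) \<le> (real N + 1) * L1_norm (\<lambda>t. g n t - f t)" for n
  proof -
    have "(\<lambda>t. g n t - f t) \<in> L1" using assms(1) assms(2)[of n] by simp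
    from norm_cesaro_mean_le[OF this, of N t] show ?thesis
      by (simp add: cesaro_mean_diff[OF assms(2,1)])
  qed
  have "(\<lambda>n. (real N + 1) * L1_norm (\<lambda>t. g n t - f t)) \<longlonglongrightarrow> 0"
    using tendsto_mult_left[OF assms(3), of "real N + 1"] by simp
  then have "(\<lambda>n. cesaro_mean N (g n) t - cesaro_mean N f t) \<longlonglongrightarrow> 0"
    by (rule Lim_null_comparison[OF always_eventually[OF allI[OF le]]])
  then show ?thesis by (simp add: LIM_zero_iff)
qed

text \<open>The values need no covering of their own: each is the limit of the Cesaro means of the
  same polynomial and inherits their bound. The factor \<open>2\<close> in the norm hypothesis
  serves the comparison of two names, whose members of index \<open>2 * n\<close> are both within
  \<open>4 ^ - n\<close> of the vector.\<close>

lemma schnorr_random_cesaro_diff_le: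
  assumes t: "t \<in> {-pi..pi}" "schnorr_random t"
    and \<tau>: "computable_trig_poly_seq \<tau>" and \<rho>: "computable_trig_poly_seq \<rho>"
    and norm: "\<And>n. L1_norm (\<lambda>t. trig_eval (\<tau> n) t - trig_eval (\<rho> n) t) \<le> 2 / 4 ^ n"
  shows "\<exists>m. \<forall>n\<ge>m. (\<forall>N. norm (cesaro_mean N (trig_eval (\<tau> n)) t - cesaro_mean N (trig_eval (\<rho> n)) t) \<le> 288 / 2 ^ n) \<and>
    norm (trig_eval (\<tau> n) t - trig_eval (\<rho> n) t) \<le> 288 / 2 ^ n"
proof -
  define d where "d n = trig_degree (\<tau> n) + trig_degree (\<rho> n)" for n
  define coef where "coef n l = Poly_Mapping.lookup (\<tau> n) l - Poly_Mapping.lookup (\<rho> n) l" for n l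
  have eq: "trig_sum (d n) (coef n) = (\<lambda>t. trig_eval (\<tau> n) t - trig_eval (\<rho> n) t)" for n
    using trig_eval_eq_trig_sum[of "\<tau> n" "d n"] trig_eval_eq_trig_sum[of "\<rho> n" "d n"]
    by (simp add: d_def trig_sum_diff coef_def[abs_def])
  have "effective d" unfolding d_def
    by (intro eff computable_trig_poly_seq_effective(1) \<tau> \<rho>)
  moreover have "effective_complex (\<lambda>x. coef (fst x) (snd x))" unfolding coef_def
    by (intro eff computable_trig_poly_seq_effective(2) \<tau> \<rho>)
  moreover have "\<not> cell_covered t" using cell_covered_not_schnorr_random t(2) by blast
  ultimately have "\<not> (\<exists>\<^sub>\<infinity>n. \<exists>N. norm (cesaro_mean N (trig_sum (d n) (coef n)) t) > 288 / 2 ^ n)"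
    using large_cesaro_means_imp_cell_covered[of coef d t] norm t(1) unfolding eq by blast
  then obtain m where m: "\<And>n N. n \<ge> m \<Longrightarrow> norm (cesaro_mean N (trig_sum (d n) (coef n)) t) \<le> 288 / 2 ^ n"
    by (auto simp: INFM_nat_le not_less)
  have "norm (trig_sum (d n) (coef n) t) \<le> 288 / 2 ^ n" if "n \<ge> m" for n
    by (rule tendsto_upperbound[OF tendsto_norm[OF cesaro_mean_trig_sum_tendsto]])
       (use m[OF that] in auto)
  with m show ?thesis
    unfolding eq by (auto simp: cesaro_mean_diff[OF trig_eval_L1 trig_eval_L1])
qed

text \<open>The subtracted term is what makes the induction close: the right-hand side is the exact
  geometric sum of the step bounds.\<close>

lemma cauchy_name_norm_diff:
  assumes "cauchy_name \<tau> f"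
  shows "L1_norm (\<lambda>t. trig_eval (\<tau> n) t - trig_eval (\<tau> (n + k)) t) \<le> 1 / 2 ^ n - 1 / 2 ^ (n + k)"
proof (induction k)
  case 0
  show ?case by (simp add: L1_norm_def)
next
  case (Suc k)
  have "L1_norm (\<lambda>t. trig_eval (\<tau> (n + k)) t - trig_eval (\<tau> (n + k + 1)) t) \<le> 1 / 2 ^ (n + k + 1)"
    using assms unfolding cauchy_name_def by (auto intro: less_imp_le)
  moreover have "1 / 2 ^ (n + k) = 1 / 2 ^ (n + k + 1) + (1 / 2 ^ (n + k + 1) :: real)"
    by (simp add: field_simps)
  ultimately show ?case
    using L1_norm_triangle[OF trig_eval_L1[of "\<tau> n"] trig_eval_L1[of "\<tau> (n + k)"] trig_eval_L1[of "\<tau> (n + Suc k)"]] Suc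
    by simp
qed

lemma cauchy_name_norm_limit:
  assumes "cauchy_name \<tau> f" "f \<in> L1"
  shows "L1_norm (\<lambda>t. trig_eval (\<tau> n) t - f t) \<le> 1 / 2 ^ n"
proof -
  have "(\<lambda>k. L1_norm (\<lambda>t. trig_eval (\<tau> k) t - f t)) \<longlonglongrightarrow> 0"
    using assms(1) unfolding cauchy_name_def by blast
  then have "(\<lambda>k. L1_norm (\<lambda>t. trig_eval (\<tau> (k + n)) t - f t)) \<longlonglongrightarrow> 0" by (rule LIMSEQ_ignore_initial_segment)
  then have lim: "(\<lambda>k. 1 / 2 ^ n + L1_norm (\<lambda>t. trig_eval (\<tau> (k + n)) t - f t)) \<longlonglongrightarrow> 1 / 2 ^ n + 0"
    by (intro tendsto_intros)
  have "L1_norm (\<lambda>t. trig_eval (\<tau> n) t - f t) \<le> 1 / 2 ^ n + L1_norm (\<lambda>t. trig_eval (\<tau> (k + n)) t - f t)" for k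
  proof -
    have "(0::real) \<le> 1 / 2 ^ (n + k)" by simp
    then show ?thesis
      using L1_norm_triangle[OF trig_eval_L1[of "\<tau> n"] trig_eval_L1[of "\<tau> (k + n)"] assms(2)]
        cauchy_name_norm_diff[OF assms(1), of n k]
      unfolding add.commute[of k n] by linarith
  qed
  then show ?thesis using tendsto_lowerbound[OF lim] by (auto intro: always_eventually)
qed

lemma norm_diff_le_of_geometric_steps:
  fixes a :: "nat \<Rightarrow> 'a::real_normed_vector"
  assumes "\<And>i. i \<ge> n \<Longrightarrow> norm (a (Suc i) - a i) \<le> C / 2 ^ i" "0 \<le> C"
  shows "norm (a (n + k) - a n) \<le> 2 * C / 2 ^ n"
proof -
  have "norm (a (n + k) - a n) \<le> 2 * C / 2 ^ n - 2 * C / 2 ^ (n + k)"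
  proof (induction k)
    case (Suc k)
    have "norm (a (n + Suc k) - a n) \<le> norm (a (Suc (n + k)) - a (n + k)) + norm (a (n + k) - a n)"
      using norm_triangle_ineq[of "a (Suc (n + k)) - a (n + k)" "a (n + k) - a n"] by simp
    also have "\<dots> \<le> C / 2 ^ (n + k) + (2 * C / 2 ^ n - 2 * C / 2 ^ (n + k))"
      by (intro add_mono assms(1) Suc) simp
    also have "\<dots> = 2 * C / 2 ^ n - 2 * C / 2 ^ (n + Suc k)" by simp
    finally show ?case .
  qed simp
  also have "\<dots> \<le> 2 * C / 2 ^ n" using assms(2) by simp
  finally show ?thesis .
qed

lemma computable_vector_imp_cauchy_name:
  assumes "computable_vector f"
  obtains \<tau> where "computable_cauchy_name \<tau> f"
proof -
  from assms obtain \<rho> where f: "f \<in> L1" and \<rho>: "computable_trig_poly_seq \<rho>"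
    and norm: "\<And>k. L1_norm (\<lambda>t. f t - trig_eval (\<rho> k) t) < 1 / 2 ^ k"
    unfolding computable_vector_def by blast
  \<comment> \<open>After a shift by two, consecutive members are each within
    \<open>2 ^ - (n + 2)\<close> of \<open>f\<close>, which yields the step bound
    \<open>2 ^ - (n + 1)\<close> of a Cauchy name.\<close>
  define \<tau> where "\<tau> n = \<rho> (n + 2)" for n
  have \<tau>: "computable_trig_poly_seq \<tau>" unfolding \<tau>_def
    by (rule computable_trig_poly_seq_compose[OF \<rho>]) (intro eff)
  have norm': "L1_norm (\<lambda>t. trig_eval (\<tau> n) t - f t) < 1 / 2 ^ (n + 2)" for n
    using norm[of "n + 2"] unfolding \<tau>_def by (subst L1_norm_minus_commute)
  have "(\<lambda>n. L1_norm (\<lambda>t. trig_eval (\<tau> n) t - f t)) \<longlonglongrightarrow> 0"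
  proof (rule tendsto_sandwich[OF _ _ tendsto_const])
    show "eventually (\<lambda>n. 0 \<le> L1_norm (\<lambda>t. trig_eval (\<tau> n) t - f t)) sequentially"
      by (simp add: L1_norm_def)
    show "eventually (\<lambda>n. L1_norm (\<lambda>t. trig_eval (\<tau> n) t - f t) \<le> (1 / 2) ^ (n + 2)) sequentially"
      using less_imp_le[OF norm'] by (simp add: power_one_over)
    show "(\<lambda>n. (1 / 2 :: real) ^ (n + 2)) \<longlonglongrightarrow> 0"
      by (intro LIMSEQ_ignore_initial_segment LIMSEQ_realpow_zero) auto
  qed
  moreover have "L1_norm (\<lambda>t. trig_eval (\<tau> n) t - trig_eval (\<tau> (n + 1)) t) < 1 / 2 ^ (n + 1)" for n
  proof -
    have "L1_norm (\<lambda>t. f t - trig_eval (\<tau> (n + 1)) t) < 1 / 2 ^ (n + 2)"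
      using norm'[of "n + 1"] by (subst L1_norm_minus_commute) (erule less_trans, simp add: divide_strict_left_mono)
    moreover have "1 / 2 ^ (n + 2) + 1 / 2 ^ (n + 2) = (1 / 2 ^ (n + 1) :: real)" by simp
    ultimately show ?thesis
      using L1_norm_triangle[OF trig_eval_L1[of "\<tau> n"] f trig_eval_L1[of "\<tau> (n + 1)"]] norm'[of n] by linarith
  qed
  ultimately have "computable_cauchy_name \<tau> f"
    using \<tau> unfolding computable_cauchy_name_def cauchy_name_def computable_trig_poly_seq_def by blast
  then show ?thesis by (rule that)
qed

lemma schnorr_random_imp_cesaro_tendsto:
  assumes t: "t \<in> {-pi..pi}" "schnorr_random t" and f: "computable_vector f"
  shows "\<exists>\<alpha>. canonical_value f t \<alpha> \<and> (\<lambda>N. cesaro_mean N f t) \<longlonglongrightarrow> \<alpha>"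
proof -
  obtain \<tau> where name: "computable_cauchy_name \<tau> f" using f by (rule computable_vector_imp_cauchy_name)
  then have \<tau>: "cauchy_name \<tau> f" "computable_trig_poly_seq \<tau>" unfolding computable_cauchy_name_def by auto
  have fL1: "f \<in> L1" using f unfolding computable_vector_def by blast
  have four: "(4::real) ^ n = 2 ^ (2 * n)" for n by (simp add: power_mult)
  have seq: "computable_trig_poly_seq (\<lambda>n. \<rho> (2 * n))" "computable_trig_poly_seq (\<lambda>n. \<rho> (2 * Suc n))"
    if "computable_trig_poly_seq \<rho>" for \<rho>
    by (rule computable_trig_poly_seq_compose[OF that], intro eff)+
  have "L1_norm (\<lambda>t. trig_eval (\<tau> (2 * Suc n)) t - trig_eval (\<tau> (2 * n)) t) \<le> 2 / 4 ^ n" for n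
  proof -
    have "L1_norm (\<lambda>t. trig_eval (\<tau> (2 * n)) t - trig_eval (\<tau> (2 * n + 2)) t) \<le> 1 / 2 ^ (2 * n) - 1 / 2 ^ (2 * n + 2)"
      by (rule cauchy_name_norm_diff[OF \<tau>(1)])
    also have "\<dots> \<le> 2 / 4 ^ n" unfolding four by (simp add: divide_simps)
    finally show ?thesis by (subst L1_norm_minus_commute) simp
  qed
  from schnorr_random_cesaro_diff_le[OF t seq(2)[OF \<tau>(2)] seq(1)[OF \<tau>(2)] this]
  obtain m where
    ces: "\<And>n N. n \<ge> m \<Longrightarrow> norm (cesaro_mean N (trig_eval (\<tau> (2 * Suc n))) t - cesaro_mean N (trig_eval (\<tau> (2 * n))) t) \<le> 288 / 2 ^ n"
    and val: "\<And>n. n \<ge> m \<Longrightarrow> norm (trig_eval (\<tau> (2 * Suc n)) t - trig_eval (\<tau> (2 * n)) t) \<le> 288 / 2 ^ n"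
    by blast
  have small: "(\<lambda>n. C / 2 ^ n) \<longlonglongrightarrow> 0" for C :: real
    using tendsto_mult[OF tendsto_const LIMSEQ_realpow_zero[of "1/2"], of C] by (simp add: power_one_over)
  have "summable (\<lambda>n. trig_eval (\<tau> (2 * Suc n)) t - trig_eval (\<tau> (2 * n)) t)"
  proof (rule summable_comparison_test_ev)
    show "eventually (\<lambda>n. norm (trig_eval (\<tau> (2 * Suc n)) t - trig_eval (\<tau> (2 * n)) t) \<le> 288 * (1 / 2) ^ n) sequentially"
      using val by (auto simp: eventually_sequentially power_one_over)
    show "summable (\<lambda>n. 288 * (1 / 2 :: real) ^ n)" by (intro summable_mult summable_geometric) auto
  qed
  then have "convergent (\<lambda>n. \<Sum>i<n. trig_eval (\<tau> (2 * Suc i)) t - trig_eval (\<tau> (2 * i)) t)"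
    by (simp add: summable_iff_convergent)
  then have "convergent (\<lambda>n. trig_eval (\<tau> (2 * n)) t - trig_eval (\<tau> (2 * 0)) t)"
    by (simp only: sum_lessThan_telescope[of "\<lambda>i. trig_eval (\<tau> (2 * i)) t"])
  then obtain \<beta> where "(\<lambda>n. trig_eval (\<tau> (2 * n)) t - trig_eval (\<tau> (2 * 0)) t) \<longlonglongrightarrow> \<beta>"
    unfolding convergent_def by blast
  from tendsto_add[OF this tendsto_const[of "trig_eval (\<tau> (2 * 0)) t"]]
  obtain \<alpha> where \<alpha>: "(\<lambda>n. trig_eval (\<tau> (2 * n)) t) \<longlonglongrightarrow> \<alpha>" by auto
  have "canonical_value f t \<alpha>"
    unfolding canonical_value_def assigns_value_def
  proof (intro conjI impI allI)
    show "\<exists>\<tau>. computable_cauchy_name \<tau> f \<and> (\<lambda>n. trig_eval (\<tau> (2 * n)) t) \<longlonglongrightarrow> \<alpha>" using name \<alpha> by blast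
    fix \<rho> assume "computable_cauchy_name \<rho> f"
    then have \<rho>: "cauchy_name \<rho> f" "computable_trig_poly_seq \<rho>" unfolding computable_cauchy_name_def by auto
    have "L1_norm (\<lambda>t. trig_eval (\<rho> (2 * n)) t - trig_eval (\<tau> (2 * n)) t) \<le> 2 / 4 ^ n" for n
    proof -
      have "L1_norm (\<lambda>t. f t - trig_eval (\<tau> (2 * n)) t) \<le> 1 / 2 ^ (2 * n)"
        using cauchy_name_norm_limit[OF \<tau>(1) fL1, of "2 * n"] by (subst L1_norm_minus_commute)
      moreover have "1 / 2 ^ (2 * n) + 1 / 2 ^ (2 * n) = (2 / 4 ^ n :: real)" unfolding four by simp
      ultimately show ?thesis
        using L1_norm_triangle[OF trig_eval_L1[of "\<rho> (2 * n)"] fL1 trig_eval_L1[of "\<tau> (2 * n)"]]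
          cauchy_name_norm_limit[OF \<rho>(1) fL1, of "2 * n"] by linarith
    qed
    from schnorr_random_cesaro_diff_le[OF t seq(1)[OF \<rho>(2)] seq(1)[OF \<tau>(2)] this]
    obtain k where k: "\<And>n. n \<ge> k \<Longrightarrow> norm (trig_eval (\<rho> (2 * n)) t - trig_eval (\<tau> (2 * n)) t) \<le> 288 / 2 ^ n" by blast
    have "(\<lambda>n. trig_eval (\<rho> (2 * n)) t - trig_eval (\<tau> (2 * n)) t) \<longlonglongrightarrow> 0"
      by (rule Lim_null_comparison[OF _ small[of 288]]) (use k in \<open>auto simp: eventually_sequentially\<close>)
    from tendsto_add[OF this \<alpha>] show "(\<lambda>n. trig_eval (\<rho> (2 * n)) t) \<longlonglongrightarrow> \<alpha>" by simp
  qed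
  moreover have "(\<lambda>N. cesaro_mean N f t) \<longlonglongrightarrow> \<alpha>"
  proof (rule LIMSEQ_I)
    fix e :: real assume e: "e > 0"
    have "eventually (\<lambda>n. 576 / 2 ^ n < e / 3) sequentially"
      using order_tendstoD(2)[OF small[of 576], of "e / 3"] e by simp
    then obtain n0 where n0: "\<And>n. n \<ge> n0 \<Longrightarrow> 576 / 2 ^ n < e / 3" by (auto simp: eventually_sequentially)
    \<comment> \<open>The polynomial of index \<open>2 * n\<close> mediates. Its value is within
      \<open>2 * 288 / 2 ^ n\<close> of \<open>\<alpha>\<close>, and its means are equally close to
      those of \<open>f\<close>, uniformly in the order \<open>N\<close>. Only after
      \<open>n\<close> is fixed is \<open>N\<close> taken large.\<close>
    define n where "n = max m n0"
    have n: "n \<ge> m" "576 / 2 ^ n < e / 3" using n0 by (auto simp: n_def)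
    have "(\<lambda>k. trig_eval (\<tau> (2 * (k + n))) t) \<longlonglongrightarrow> \<alpha>"
      by (rule LIMSEQ_ignore_initial_segment[OF \<alpha>])
    then have "(\<lambda>k. norm (trig_eval (\<tau> (2 * (n + k))) t - trig_eval (\<tau> (2 * n)) t)) \<longlonglongrightarrow> norm (\<alpha> - trig_eval (\<tau> (2 * n)) t)"
      by (intro tendsto_intros) (simp add: add.commute)
    moreover have "norm (trig_eval (\<tau> (2 * (n + k))) t - trig_eval (\<tau> (2 * n)) t) \<le> 2 * 288 / 2 ^ n" for k
      by (rule norm_diff_le_of_geometric_steps) (use val n in auto)
    ultimately have 1: "norm (\<alpha> - trig_eval (\<tau> (2 * n)) t) \<le> 2 * 288 / 2 ^ n"
      by (intro tendsto_upperbound) auto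
    have 2: "norm (cesaro_mean N f t - cesaro_mean N (trig_eval (\<tau> (2 * n))) t) \<le> 2 * 288 / 2 ^ n" for N
    proof -
      have "(\<lambda>k. L1_norm (\<lambda>t. trig_eval (\<tau> k) t - f t)) \<longlonglongrightarrow> 0"
        using \<tau>(1) unfolding cauchy_name_def by blast
      then have "(\<lambda>k. L1_norm (\<lambda>t. trig_eval (\<tau> (2 * (n + k))) t - f t)) \<longlonglongrightarrow> 0"
        by (rule filterlim_compose) (rule filterlim_subseq, simp add: strict_mono_def)
      then have "(\<lambda>k. cesaro_mean N (trig_eval (\<tau> (2 * (n + k)))) t) \<longlonglongrightarrow> cesaro_mean N f t"
        by (intro cesaro_mean_L1_tendsto fL1 trig_eval_L1)
      then have "(\<lambda>k. norm (cesaro_mean N (trig_eval (\<tau> (2 * (n + k)))) t - cesaro_mean N (trig_eval (\<tau> (2 * n))) t))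
          \<longlonglongrightarrow> norm (cesaro_mean N f t - cesaro_mean N (trig_eval (\<tau> (2 * n))) t)"
        by (intro tendsto_intros)
      moreover have "norm (cesaro_mean N (trig_eval (\<tau> (2 * (n + k)))) t - cesaro_mean N (trig_eval (\<tau> (2 * n))) t) \<le> 2 * 288 / 2 ^ n" for k
        by (rule norm_diff_le_of_geometric_steps[where a = "\<lambda>n. cesaro_mean N (trig_eval (\<tau> (2 * n))) t"])
           (use ces n in auto)
      ultimately show ?thesis by (intro tendsto_upperbound) auto
    qed
    have "(\<lambda>N. cesaro_mean N (trig_eval (\<tau> (2 * n))) t) \<longlonglongrightarrow> trig_eval (\<tau> (2 * n)) t"
      unfolding trig_eval_eq_trig_sum[OF order_refl] by (rule cesaro_mean_trig_sum_tendsto)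
    from LIMSEQ_D[OF this, of "e / 3"] e
    obtain N0 where N0: "\<And>N. N \<ge> N0 \<Longrightarrow> norm (cesaro_mean N (trig_eval (\<tau> (2 * n))) t - trig_eval (\<tau> (2 * n)) t) < e / 3" by auto
    have "norm (cesaro_mean N f t - \<alpha>) < e" if "N \<ge> N0" for N
    proof -
      have "cesaro_mean N f t - \<alpha> = (cesaro_mean N f t - cesaro_mean N (trig_eval (\<tau> (2 * n))) t) +
          ((cesaro_mean N (trig_eval (\<tau> (2 * n))) t - trig_eval (\<tau> (2 * n)) t) - (\<alpha> - trig_eval (\<tau> (2 * n)) t))" by simp
      also have "norm \<dots> \<le> norm (cesaro_mean N f t - cesaro_mean N (trig_eval (\<tau> (2 * n))) t) +
          (norm (cesaro_mean N (trig_eval (\<tau> (2 * n))) t - trig_eval (\<tau> (2 * n)) t) + norm (\<alpha> - trig_eval (\<tau> (2 * n)) t))"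
        by (intro norm_triangle_le add_left_mono norm_triangle_ineq4)
      finally show ?thesis using 1 2[of N] N0[OF that] n(2) by linarith
    qed
    then show "\<exists>no. \<forall>N\<ge>no. norm (cesaro_mean N f t - \<alpha>) < e" by blast
  qed
  ultimately show ?thesis by blast
qed

section \<open>Divergence at points that are not Schnorr random\<close>

text \<open>Frequency \<open>l\<close> occurs in the Dirichlet kernels of orders
  \<open>\<bar>l\<bar>\<close> to \<open>N\<close>, and counting them gives the triangular weights.
  Their rationality is what the bumps rely on.\<close>

lemma fejer_eq_trig_sum:
  "complex_of_real (fejer N x) = trig_sum N (\<lambda>l. of_real ((real N + 1 - \<bar>real_of_int l\<bar>) / (real N + 1))) x"
proof -
  have count: "(\<Sum>M = 0..N. if \<bar>l\<bar> \<le> int M then 1 else 0) = complex_of_real (real N + 1 - \<bar>real_of_int l\<bar>)"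
    if "l \<in> {- int N..int N}" for l
  proof -
    have eq: "{0..N} \<inter> {M. \<bar>l\<bar> \<le> int M} = {nat \<bar>l\<bar>..N}" by auto
    have "int (Suc N - nat \<bar>l\<bar>) = int N + 1 - \<bar>l\<bar>" using that by auto
    then have "real_of_int (int (Suc N - nat \<bar>l\<bar>)) = real_of_int (int N + 1 - \<bar>l\<bar>)" by (rule arg_cong)
    then have card: "real (card {nat \<bar>l\<bar>..N}) = real N + 1 - \<bar>real_of_int l\<bar>"
      by (simp only: card_atLeastAtMost of_int_of_nat_eq of_int_diff of_int_add of_int_1 of_int_abs)
    have "(\<Sum>M = 0..N. if \<bar>l\<bar> \<le> int M then 1 else 0) = (of_nat (card {nat \<bar>l\<bar>..N}) :: complex)"
      unfolding eq[symmetric] by (simp add: sum.If_cases)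
    also have "\<dots> = of_real (real (card {nat \<bar>l\<bar>..N}))" by (rule of_real_of_nat_eq[symmetric])
    finally show ?thesis unfolding card .
  qed
  have "(\<Sum>M = 0..N. \<Sum>n = - int M..int M. trig_e n x) =
      (\<Sum>M = 0..N. \<Sum>n = - int N..int N. if \<bar>n\<bar> \<le> int M then trig_e n x else 0)"
  proof (rule sum.cong[OF refl])
    fix M assume "M \<in> {0..N}"
    then show "(\<Sum>n = - int M..int M. trig_e n x) = (\<Sum>n = - int N..int N. if \<bar>n\<bar> \<le> int M then trig_e n x else 0)"
      by (intro sum.mono_neutral_cong_left) auto
  qed
  also have "\<dots> = (\<Sum>n = - int N..int N. \<Sum>M = 0..N. if \<bar>n\<bar> \<le> int M then trig_e n x else 0)"
    by (rule sum.swap)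
  also have "\<dots> = (\<Sum>n = - int N..int N. complex_of_real (real N + 1 - \<bar>real_of_int n\<bar>) * trig_e n x)"
  proof (rule sum.cong[OF refl])
    fix n assume n: "n \<in> {- int N..int N}"
    have "(\<Sum>M = 0..N. if \<bar>n\<bar> \<le> int M then trig_e n x else 0) =
        (\<Sum>M = 0..N. if \<bar>n\<bar> \<le> int M then 1 else 0) * trig_e n x"
      unfolding sum_distrib_right by (intro sum.cong) auto
    then show "(\<Sum>M = 0..N. if \<bar>n\<bar> \<le> int M then trig_e n x else 0) =
        complex_of_real (real N + 1 - \<bar>real_of_int n\<bar>) * trig_e n x" unfolding count[OF n] .
  qed
  finally show ?thesis
    unfolding sum_dirichlet_fejer[symmetric] trig_sum_def by (simp add: sum_distrib_left)
qed

text \<open>All phases \<open>k * x\<close> with \<open>k \<le> N\<close> stay in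
  \<open>[0, 1]\<close>, where the cosine is at least \<open>1 / 2\<close>, so the summands cannot
  cancel.\<close>

lemma fejer_ge:
  assumes "0 \<le> x" "x * real N \<le> 1"
  shows "(real N + 1) / 4 \<le> fejer N x"
proof -
  have "cos y \<ge> 1 / 2" if "0 \<le> y" "y \<le> 1" for y :: real
  proof -
    have "cos y = 1 - 2 * (sin (y / 2))\<^sup>2" using cos_double_sin[of "y / 2"] by simp
    moreover have "(sin (y / 2))\<^sup>2 \<le> (1 / 2)\<^sup>2"
    proof -
      have "\<bar>sin (y / 2)\<bar> \<le> \<bar>1 / 2\<bar>" using abs_sin_x_le_abs_x[of "y / 2"] that by simp
      then show ?thesis by (rule abs_le_square_iff[THEN iffD1])
    qed
    ultimately show ?thesis by (simp add: power2_eq_square)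
  qed
  moreover have "real k * x \<le> 1" if "k \<le> N" for k
    using assms that by (smt (verit) mult.commute mult_left_mono of_nat_le_iff)
  ultimately have "(\<Sum>k\<le>N. 1 / 2) \<le> (\<Sum>k\<le>N. cos (real k * x))"
    using assms(1) by (intro sum_mono) auto
  also have "\<dots> = Re (\<Sum>k\<le>N. trig_e (int k) x)" by (simp add: trig_e_cis)
  also have "\<dots> \<le> cmod (\<Sum>k\<le>N. trig_e (int k) x)" by (rule complex_Re_le_cmod)
  finally have "(real N + 1) / 2 \<le> cmod (\<Sum>k\<le>N. trig_e (int k) x)" by (simp add: add.commute)
  then have "((real N + 1) / 2)\<^sup>2 \<le> (cmod (\<Sum>k\<le>N. trig_e (int k) x))\<^sup>2" by (intro power_mono) auto
  then have "((real N + 1) / 2)\<^sup>2 / (real N + 1) \<le> fejer N x" unfolding fejer_def by (intro divide_right_mono) auto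
  moreover have "((real N + 1) / 2)\<^sup>2 / (real N + 1) = (real N + 1) / 4"
  proof -
    have "(a / 2)\<^sup>2 / a = a / 4" if "a \<noteq> 0" for a :: real using that by (simp add: power2_eq_square)
    then show ?thesis by (metis add_nonneg_pos less_irrefl of_nat_0_le_iff zero_less_one)
  qed
  ultimately show ?thesis by simp
qed

text \<open>\<open>bump S c\<close> approximates the Fejer kernel of order \<open>2 ^ S - 1\<close> centred at \<open>c / 2 ^ S\<close> and scaled
  to height about \<open>1\<close>. Its Fourier coefficients are rational; the constant \<open>1 / 2 ^ S\<close> is added in
  order to restore positivity of the real part.\<close>

definition bump_coeff :: "nat \<Rightarrow> int \<Rightarrow> int \<Rightarrow> complex" where
  "bump_coeff S c l = (if \<bar>l\<bar> < 2 ^ S then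
     of_real ((2 ^ S - \<bar>real_of_int l\<bar>) / 4 ^ S) * approx_cis (256 * 8 ^ S) (- (real_of_int l * real_of_int c / 2 ^ S)) +
     of_real (if l = 0 then 1 / 2 ^ S else 0) else 0)"

definition bump :: "nat \<Rightarrow> int \<Rightarrow> real \<Rightarrow> complex" where
  "bump S c = trig_sum (2 ^ S) (bump_coeff S c)"

text \<open>The order \<open>256 * 8 ^ S\<close> bounds the error of each exponential by
  \<open>2 * (8 * 2 ^ S)\<^sup>2 / (256 * 8 ^ S) = 1 / (2 * 2 ^ S)\<close>. Fewer than
  \<open>2 * 2 ^ S\<close> terms of weight at most \<open>1 / 2 ^ S\<close> then contribute at most
  \<open>1 / 2 ^ S\<close>.\<close>

lemma norm_bump_minus_fejer_le:
  assumes c: "\<bar>c\<bar> \<le> 8 * 2 ^ S"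
  shows "norm (bump S c t - of_real (fejer (2 ^ S - 1) (t - of_int c / 2 ^ S) / 2 ^ S + 1 / 2 ^ S)) \<le> 1 / 2 ^ S"
proof -
  define N where "N = (2 ^ S - 1 :: nat)"
  have N1: "real N + 1 = 2 ^ S" by (simp add: N_def of_nat_diff)
  have N: "int N = 2 ^ S - 1" by (simp add: N_def of_nat_diff)
  define x where "x = real_of_int c / 2 ^ S"
  have "real_of_int \<bar>c\<bar> \<le> real_of_int (8 * 2 ^ S)" using c by (subst of_int_le_iff)
  then have x: "\<bar>x\<bar> \<le> 8" by (simp add: x_def divide_le_eq)
  define w where "w l = (2 ^ S - \<bar>real_of_int l\<bar>) / 4 ^ S" for l
  have four: "(4::real) ^ S = 2 ^ S * 2 ^ S" by (simp flip: power_mult_distrib)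
  have w: "0 \<le> w l" "w l \<le> 1 / 2 ^ S" if "l \<in> {- int N..int N}" for l
  proof -
    have "\<bar>l\<bar> \<le> 2 ^ S" using that N by auto
    then have "real_of_int \<bar>l\<bar> \<le> real_of_int (2 ^ S)" by (subst of_int_le_iff)
    then show "0 \<le> w l" by (simp add: w_def)
    show "w l \<le> 1 / 2 ^ S" unfolding w_def four by (simp add: field_simps)
  qed
  have "bump S c t = (\<Sum>l = - int N..int N. (of_real (w l) * approx_cis (256 * 8 ^ S) (- (real_of_int l * x)) +
      of_real (if l = 0 then 1 / 2 ^ S else 0)) * trig_e l t)"
    unfolding bump_def trig_sum_def
    by (rule sum.mono_neutral_cong_right) (auto simp: N bump_coeff_def w_def x_def)
  also have "\<dots> = (\<Sum>l = - int N..int N. of_real (w l) * approx_cis (256 * 8 ^ S) (- (real_of_int l * x)) * trig_e l t) +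
      (\<Sum>l = - int N..int N. if l = 0 then of_real (1 / 2 ^ S) else 0)"
    unfolding sum.distrib[symmetric] by (intro sum.cong) (auto simp: distrib_right)
  also have "(\<Sum>l = - int N..int N. if l = 0 then of_real (1 / 2 ^ S) else 0) = complex_of_real (1 / 2 ^ S)"
    by simp
  finally have bump: "bump S c t = (\<Sum>l = - int N..int N. of_real (w l) * approx_cis (256 * 8 ^ S) (- (real_of_int l * x)) * trig_e l t) +
      of_real (1 / 2 ^ S)" .
  have "of_real (fejer N (t - x) / 2 ^ S) = complex_of_real (fejer N (t - x)) / of_real (2 ^ S)" by simp
  also have "\<dots> = (\<Sum>l = - int N..int N. of_real (w l) * cis (- (real_of_int l * x)) * trig_e l t)"
    unfolding fejer_eq_trig_sum trig_sum_def sum_divide_distrib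
  proof (rule sum.cong[OF refl])
    fix l
    have "trig_e l (t - x) = cis (- (real_of_int l * x)) * trig_e l t"
      by (simp add: trig_e_cis cis_mult algebra_simps)
    then show "of_real ((real N + 1 - \<bar>real_of_int l\<bar>) / (real N + 1)) * trig_e l (t - x) / of_real (2 ^ S) =
        of_real (w l) * cis (- (real_of_int l * x)) * trig_e l t"
      by (simp add: w_def N1 four)
  qed
  finally have "bump S c t - of_real (fejer N (t - x) / 2 ^ S + 1 / 2 ^ S) =
      (\<Sum>l = - int N..int N. of_real (w l) * (approx_cis (256 * 8 ^ S) (- (real_of_int l * x)) - cis (- (real_of_int l * x))) * trig_e l t)"
    by (simp add: bump right_diff_distrib left_diff_distrib sum_subtractf)
  also have "norm \<dots> \<le> (\<Sum>l = - int N..int N. 1 / 2 ^ S * (1 / (2 * 2 ^ S)))"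
  proof (rule sum_norm_le)
    fix l assume l: "l \<in> {- int N..int N}"
    have "\<bar>l\<bar> \<le> 2 ^ S" using l N by auto
    then have "real_of_int \<bar>l\<bar> \<le> real_of_int (2 ^ S)" by (subst of_int_le_iff)
    then have "\<bar>- (real_of_int l * x)\<bar> \<le> 2 ^ S * 8" unfolding abs_minus_cancel abs_mult using x by (intro mult_mono) auto
    then have sq: "(- (real_of_int l * x))\<^sup>2 \<le> (2 ^ S * 8)\<^sup>2"
      by (metis abs_le_square_iff abs_of_nonneg abs_ge_zero order_trans)
    have "norm (approx_cis (256 * 8 ^ S) (- (real_of_int l * x)) - cis (- (real_of_int l * x)))
        \<le> 2 * (- (real_of_int l * x))\<^sup>2 / real (256 * 8 ^ S)"
      by (subst norm_minus_commute, rule norm_cis_minus_approx_cis_le) simp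
    also have "\<dots> \<le> 2 * (2 ^ S * 8)\<^sup>2 / real (256 * 8 ^ S)"
      using sq by (intro divide_right_mono mult_left_mono) auto
    also have "\<dots> = 1 / (2 * 2 ^ S)"
    proof -
      have "(8::real) ^ S = 2 ^ S * 2 ^ S * 2 ^ S" by (simp flip: power_mult_distrib)
      then show ?thesis by (simp add: power2_eq_square field_simps)
    qed
    finally have "w l * norm (approx_cis (256 * 8 ^ S) (- (real_of_int l * x)) - cis (- (real_of_int l * x)))
        \<le> 1 / 2 ^ S * (1 / (2 * 2 ^ S))" using w[OF l] by (intro mult_mono) auto
    then show "norm (of_real (w l) * (approx_cis (256 * 8 ^ S) (- (real_of_int l * x)) - cis (- (real_of_int l * x))) * trig_e l t)
        \<le> 1 / 2 ^ S * (1 / (2 * 2 ^ S))" using w(1)[OF l] by (simp add: norm_mult)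
  qed
  also have "\<dots> = (2 * real N + 1) * (1 / 2 ^ S * (1 / (2 * 2 ^ S)))" by simp
  also have "\<dots> \<le> (2 * 2 ^ S) * (1 / 2 ^ S * (1 / (2 * 2 ^ S)))"
    using N1 by (intro mult_right_mono) auto
  also have "\<dots> = 1 / 2 ^ S" by simp
  finally show ?thesis by (simp add: N_def x_def)
qed

lemma Re_bump_ge:
  assumes "\<bar>c\<bar> \<le> 8 * 2 ^ S"
  shows "fejer (2 ^ S - 1) (t - of_int c / 2 ^ S) / 2 ^ S \<le> Re (bump S c t)"
  using norm_bump_minus_fejer_le[OF assms, of t]
    abs_Re_le_cmod[of "bump S c t - of_real (fejer (2 ^ S - 1) (t - of_int c / 2 ^ S) / 2 ^ S + 1 / 2 ^ S)"]
  by simp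

lemma Re_bump_nonneg: "\<bar>c\<bar> \<le> 8 * 2 ^ S \<Longrightarrow> 0 \<le> Re (bump S c t)"
  by (rule order_trans[OF _ Re_bump_ge]) (simp_all add: fejer_nonneg)

text \<open>\<open>t\<close> lies at most one cell length to the right of the centre, close enough
  for \<open>fejer_ge\<close>; the height \<open>2 ^ S / 4\<close> obtained there is scaled back by
  \<open>2 ^ S\<close>.\<close>

lemma Re_bump_cell_ge:
  assumes "\<bar>\<lfloor>t * 2 ^ S\<rfloor>\<bar> \<le> 8 * 2 ^ S"
  shows "1 / 4 \<le> Re (bump S \<lfloor>t * 2 ^ S\<rfloor> t)"
proof -
  define x where "x = t - of_int \<lfloor>t * 2 ^ S\<rfloor> / 2 ^ S"
  have N1: "real (2 ^ S - 1) + 1 = 2 ^ S" by (simp add: of_nat_diff)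
  have "0 \<le> t * 2 ^ S - of_int \<lfloor>t * 2 ^ S\<rfloor>" "t * 2 ^ S - of_int \<lfloor>t * 2 ^ S\<rfloor> \<le> 1" by linarith+
  moreover have "x * 2 ^ S = t * 2 ^ S - of_int \<lfloor>t * 2 ^ S\<rfloor>" by (simp add: x_def left_diff_distrib)
  ultimately have "0 \<le> x * 2 ^ S" and x2: "x * 2 ^ S \<le> 1" by simp_all
  then have x: "0 \<le> x" by (meson mult_neg_pos not_le zero_less_numeral zero_less_power)
  have "x * real (2 ^ S - 1) \<le> x * 2 ^ S" using x N1 by (intro mult_left_mono) auto
  then have "(real (2 ^ S - 1) + 1) / 4 \<le> fejer (2 ^ S - 1) x" using x x2 by (intro fejer_ge) auto
  then have "2 ^ S / 4 / 2 ^ S \<le> fejer (2 ^ S - 1) x / 2 ^ S" unfolding N1 by (rule divide_right_mono) simp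
  also have "\<dots> \<le> Re (bump S \<lfloor>t * 2 ^ S\<rfloor> t)" unfolding x_def by (rule Re_bump_ge[OF assms])
  finally show ?thesis by simp
qed

text \<open>Being nonnegative, the kernel has its integral as norm, and this is read off from the
  zeroth Fourier coefficient. The added constant and the approximation error contribute
  \<open>2 / 2 ^ S\<close> over a period, and \<open>6 * pi \<le> 24\<close>.\<close>

lemma L1_norm_bump_le:
  assumes "\<bar>c\<bar> \<le> 8 * 2 ^ S"
  shows "L1_norm (bump S c) \<le> 24 / 2 ^ S"
proof -
  define N where "N = (2 ^ S - 1 :: nat)"
  define x where "x = real_of_int c / 2 ^ S"
  define k where "k = trig_sum N (\<lambda>l. of_real ((real N + 1 - \<bar>real_of_int l\<bar>) / (real N + 1)) * trig_e (- l) x)"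
  have k: "complex_of_real (fejer N (t - x)) = k t" for t
    unfolding fejer_eq_trig_sum k_def trig_sum_def
    by (intro sum.cong refl) (simp add: trig_e_diff_arg mult_ac)
  have kint: "integrable (lebesgue_on {-pi..pi}) k" using trig_sum_L1 by (simp add: k_def)
  have "fourier_coeff k 0 = 1" unfolding k_def fourier_coeff_trig_sum by simp
  then have "(LINT t|lebesgue_on {-pi..pi}. k t) = 2 * of_real pi"
    unfolding fourier_coeff_eq by (simp add: field_simps)
  moreover have "(LINT t|lebesgue_on {-pi..pi}. fejer N (t - x)) = Re (LINT t|lebesgue_on {-pi..pi}. k t)"
    unfolding k[symmetric] integral_complex_of_real by simp
  ultimately have int: "(LINT t|lebesgue_on {-pi..pi}. fejer N (t - x)) = 2 * pi" by simp
  have fint: "integrable (lebesgue_on {-pi..pi}) (\<lambda>t. fejer N (t - x))"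
    using integrable_Re[OF kint] unfolding k[symmetric] by simp
  have le: "norm (bump S c t) \<le> fejer N (t - x) / 2 ^ S + 2 / 2 ^ S" for t
  proof -
    have "norm (bump S c t) \<le> norm (complex_of_real (fejer N (t - x) / 2 ^ S + 1 / 2 ^ S)) + 1 / 2 ^ S"
      using norm_bump_minus_fejer_le[OF assms, of t]
        norm_triangle_ineq2[of "bump S c t" "of_real (fejer N (t - x) / 2 ^ S + 1 / 2 ^ S)"]
      unfolding N_def x_def by linarith
    moreover have "norm (complex_of_real (fejer N (t - x) / 2 ^ S + 1 / 2 ^ S)) = fejer N (t - x) / 2 ^ S + 1 / 2 ^ S"
      unfolding norm_of_real by (simp add: fejer_nonneg)
    ultimately show ?thesis by simp
  qed
  have const: "integrable (lebesgue_on {-pi..pi}) (\<lambda>t. b :: real)" "(LINT t|lebesgue_on {-pi..pi}. b) = 2 * pi * b" for b :: real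
  proof -
    show "integrable (lebesgue_on {-pi..pi}) (\<lambda>t. b)" by (intro continuous_imp_integrable_real continuous_intros)
    then have "(LINT t|lebesgue_on {-pi..pi}. b) = integral {-pi..pi} (\<lambda>t. b)"
      by (intro lebesgue_integral_eq_integral) auto
    then show "(LINT t|lebesgue_on {-pi..pi}. b) = 2 * pi * b" by simp
  qed
  have "L1_norm (bump S c) \<le> (LINT t|lebesgue_on {-pi..pi}. fejer N (t - x) / 2 ^ S + 2 / 2 ^ S)"
    unfolding L1_norm_def using trig_sum_L1 fint const
    by (intro integral_mono le) (auto simp: bump_def)
  also have "\<dots> = (LINT t|lebesgue_on {-pi..pi}. fejer N (t - x) / 2 ^ S) + (LINT t|lebesgue_on {-pi..pi}. 2 / 2 ^ S)"
    by (intro Bochner_Integration.integral_add integrable_divide fint const)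
  also have "\<dots> = 2 * pi / 2 ^ S + 2 * pi * (2 / 2 ^ S)"
    unfolding const using int by simp
  also have "\<dots> \<le> 24 / 2 ^ S" using pi_less_4 by (simp add: field_simps)
  finally show ?thesis .
qed

lemma effective_complex_zero [eff]: "effective_complex (\<lambda>e. 0)"
  by (simp add: effective_complex_def effective_real_numerals)

lemma effective_bump_coeff [eff]:
  assumes "effective S" "effective c" "effective l"
  shows "effective_complex (\<lambda>e. bump_coeff (S e) (c e) (l e))"
proof -
  have "effective (\<lambda>e. \<bar>l e\<bar> < int (2 ^ S e))" by (intro eff assms)
  then have 1: "effective (\<lambda>e. \<bar>l e\<bar> < 2 ^ S e)" by simp
  show ?thesis unfolding bump_coeff_def by (intro eff 1 assms)
qed

section \<open>L1 limits and computable polynomial sequences\<close>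

text \<open>\<open>F\<close> is the pointwise sum, which exists almost everywhere because the sum of
  the norms has finite integral. The explicit rate is what makes the limit a computable vector later
  on.\<close>

lemma L1_series:
  fixes f :: "nat \<Rightarrow> 'a \<Rightarrow> complex"
  assumes f: "\<And>i. integrable M (f i)" and le: "\<And>i. (\<integral>x. norm (f i x) \<partial>M) \<le> K / 2 ^ i" and K: "0 \<le> K"
  obtains F where "integrable M F" "\<And>J. (\<integral>x. norm (F x - (\<Sum>i<J. f i x)) \<partial>M) \<le> 2 * K / 2 ^ J"
proof -
  have geo: "(\<lambda>i. K / 2 ^ (i + J)) sums (2 * K / 2 ^ J)" for J
    using sums_mult[OF geometric_sums[of "1/2::real"], of "K / 2 ^ J"]
    by (simp add: power_add power_divide mult.commute)
  have nn: "0 \<le> (\<integral>x. norm (f i x) \<partial>M)" for i by simp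
  have summ: "summable (\<lambda>i. \<integral>x. norm (f (i + J) x) \<partial>M)" for J
    by (rule summable_comparison_test'[OF sums_summable[OF geo[of J]], of 0]) (use le in auto)
  have "(\<integral>\<^sup>+x. suminf (\<lambda>i. ennreal (norm (f i x))) \<partial>M) = suminf (\<lambda>i. \<integral>\<^sup>+x. ennreal (norm (f i x)) \<partial>M)"
    using f by (intro nn_integral_suminf) auto
  also have "\<dots> = suminf (\<lambda>i. ennreal (\<integral>x. norm (f i x) \<partial>M))"
    using f by (intro suminf_cong nn_integral_eq_integral) auto
  also have "\<dots> = ennreal (suminf (\<lambda>i. \<integral>x. norm (f i x) \<partial>M))"
    using summ[of 0] by (intro suminf_ennreal2) auto
  also have "\<dots> < \<infinity>" by simp
  finally have fin: "(\<integral>\<^sup>+x. suminf (\<lambda>i. ennreal (norm (f i x))) \<partial>M) \<noteq> \<infinity>" by simp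
  have "AE x in M. suminf (\<lambda>i. ennreal (norm (f i x))) \<noteq> \<infinity>"
    by (rule nn_integral_noteq_infinite[OF _ fin]) (use f in auto)
  then have ae: "AE x in M. summable (\<lambda>i. norm (f i x))"
    by (rule AE_mp) (auto intro!: AE_I2 summable_suminf_not_top)
  define F where "F x = suminf (\<lambda>i. f i x)" for x
  have "integrable M F"
    unfolding F_def using f ae summ[of 0] by (intro integrable_suminf) auto
  moreover have "(\<integral>x. norm (F x - (\<Sum>i<J. f i x)) \<partial>M) \<le> 2 * K / 2 ^ J" for J
  proof -
    have aeJ: "AE x in M. summable (\<lambda>i. norm (f (i + J) x))"
      using ae by (rule AE_mp) (auto intro!: AE_I2 summable_ignore_initial_segment)
    have int: "integrable M (\<lambda>x. suminf (\<lambda>i. norm (f (i + J) x)))"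
      using f aeJ summ[of J] by (intro integrable_suminf) auto
    have "(\<integral>x. norm (F x - (\<Sum>i<J. f i x)) \<partial>M) \<le> (\<integral>x. suminf (\<lambda>i. norm (f (i + J) x)) \<partial>M)"
    proof (rule integral_mono_AE)
      show "integrable M (\<lambda>x. norm (F x - (\<Sum>i<J. f i x)))" using \<open>integrable M F\<close> f by simp
      show "integrable M (\<lambda>x. suminf (\<lambda>i. norm (f (i + J) x)))" by (rule int)
      show "AE x in M. norm (F x - (\<Sum>i<J. f i x)) \<le> suminf (\<lambda>i. norm (f (i + J) x))"
        using ae
      proof (rule AE_mp, intro AE_I2 impI)
        fix x assume s: "summable (\<lambda>i. norm (f i x))"
        have "F x - (\<Sum>i<J. f i x) = suminf (\<lambda>i. f (i + J) x)"
          using suminf_split_initial_segment[OF summable_norm_cancel[OF s], of J] by (simp add: F_def)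
        also have "norm \<dots> \<le> suminf (\<lambda>i. norm (f (i + J) x))"
          by (rule summable_norm[OF summable_ignore_initial_segment[OF s]])
        finally show "norm (F x - (\<Sum>i<J. f i x)) \<le> suminf (\<lambda>i. norm (f (i + J) x))" .
      qed
    qed
    also have "\<dots> = suminf (\<lambda>i. \<integral>x. norm (f (i + J) x) \<partial>M)"
      using f aeJ summ[of J] by (intro integral_suminf) auto
    also have "\<dots> \<le> suminf (\<lambda>i. K / 2 ^ (i + J))"
      by (rule suminf_le[OF le summ sums_summable[OF geo]])
    also have "\<dots> = 2 * K / 2 ^ J" using geo by (rule sums_unique[symmetric])
    finally show ?thesis .
  qed
  ultimately show ?thesis by (rule that)
qed

lemma trig_degree_eq_Least:
  "trig_degree \<tau> = (LEAST m. \<forall>l. Poly_Mapping.lookup \<tau> l \<noteq> 0 \<longrightarrow> nat \<bar>l\<bar> \<le> m)"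
  unfolding trig_degree_def
  by (rule Least_equality[symmetric]) (auto simp: in_keys_iff intro!: Max_ge Max.boundedI)

lemma ex_computable_rat2:
  assumes "effective_real (\<lambda>x. F (fst x) (snd x))"
  obtains q where "computable_rat2 q" "\<And>m n. real_of_rat (q m n) = F m n"
proof -
  have "\<exists>r. real_of_rat r = F m n" for m n
    using effective_real_Rats[OF assms, of "(m, n)"] by (auto elim: Rats_cases)
  then obtain q where q: "\<And>m n. real_of_rat (q m n) = F m n" by metis
  then have "computable_rat2 q" using assms unfolding computable_rat2_iff by simp
  with q show ?thesis by (rule that[rotated])
qed

text \<open>The algorithm has to output the exact degree, while \<open>d\<close> is only a bound.
  Since the coefficients are exact rationals, testing them for zero is decidable and the degree is
  found by search.\<close>

lemma computable_trig_poly_seqI: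
  fixes coef :: "nat \<Rightarrow> int \<Rightarrow> complex"
  assumes coef: "effective_complex (\<lambda>x. coef (fst x) (snd x))" and d: "effective d"
    and supp: "\<And>n l. int (d n) < \<bar>l\<bar> \<Longrightarrow> coef n l = 0"
  shows "computable_trig_poly_seq (\<lambda>n. Abs_poly_mapping (coef n))"
    and "trig_eval (Abs_poly_mapping (coef n)) = trig_sum (d n) (coef n)"
proof -
  have "finite {l. coef n l \<noteq> 0}" for n
    by (rule finite_subset[of _ "{- int (d n)..int (d n)}"]) (use supp in \<open>auto, (meson not_le abs_le_iff minus_le_iff)+\<close>)
  then have lookup: "Poly_Mapping.lookup (Abs_poly_mapping (coef n)) = coef n" for n
    by (simp add: Abs_poly_mapping_inverse)
  note coef' = effective_complex_compose2[OF coef]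
  define P where "P n m \<longleftrightarrow> (\<forall>i<Suc (2 * d n). coef n (int i - int (d n)) \<noteq> 0 \<longrightarrow> nat \<bar>int i - int (d n)\<bar> \<le> m)" for n m
  have P: "P n m \<longleftrightarrow> (\<forall>l. coef n l \<noteq> 0 \<longrightarrow> nat \<bar>l\<bar> \<le> m)" for n m
  proof
    assume P: "P n m"
    show "\<forall>l. coef n l \<noteq> 0 \<longrightarrow> nat \<bar>l\<bar> \<le> m"
    proof (intro allI impI)
      fix l assume l: "coef n l \<noteq> 0"
      then have "\<bar>l\<bar> \<le> int (d n)" using supp by (meson not_le)
      then have "nat (l + int (d n)) < Suc (2 * d n)" "int (nat (l + int (d n))) - int (d n) = l" by auto
      with P l show "nat \<bar>l\<bar> \<le> m" unfolding P_def by metis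
    qed
  qed (simp add: P_def)
  have deg: "trig_degree (Abs_poly_mapping (coef n)) = (LEAST m. P n m)" for n
    unfolding trig_degree_eq_Least lookup P ..
  have nz: "coef n l \<noteq> 0 \<longleftrightarrow> \<not> (Re (coef n l) = 0 \<and> Im (coef n l) = 0)" for n l by (simp add: complex_eq_iff)
  have Pd: "P n (d n)" for n using supp unfolding P by (metis nat_le_iff not_le)
  have "effective (\<lambda>n. LEAST m. P n m)"
  proof (rule effective_Least)
    show "surj (enc :: nat \<Rightarrow> nat)" by (simp add: surj_def)
    show "effective (\<lambda>x. P (fst x) (snd x))" unfolding P_def nz by (intro eff effective_compose[OF d] coef')
  qed (use Pd in blast)
  then have "computable (\<lambda>n. trig_degree (Abs_poly_mapping (coef n)))"
    unfolding deg by (rule effective_imp_computable)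
  moreover have "rational_trig_poly (Abs_poly_mapping (coef n))" for n
  proof -
    have re: "effective_real (\<lambda>x. Re (coef (fst x) (snd x)))" and im: "effective_real (\<lambda>x. Im (coef (fst x) (snd x)))"
      by (intro eff coef)+
    show ?thesis unfolding rational_trig_poly_def lookup
      using effective_real_Rats[OF re, of "(n, _)"] effective_real_Rats[OF im, of "(n, _)"] by simp
  qed
  moreover obtain a where "computable_rat2 a" "\<And>n j. real_of_rat (a n j) = Re (coef n (int_decode j))"
    by (rule ex_computable_rat2[of "\<lambda>n j. Re (coef n (int_decode j))"]) (intro eff coef', blast)
  moreover obtain b where "computable_rat2 b" "\<And>n j. real_of_rat (b n j) = Im (coef n (int_decode j))"
    by (rule ex_computable_rat2[of "\<lambda>n j. Im (coef n (int_decode j))"]) (intro eff coef', blast)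
  moreover from calculation(4,6)
  have "coef n (int_decode j) = Complex (real_of_rat (a n j)) (real_of_rat (b n j))" for n j
    by (simp add: complex_eq_iff)
  ultimately show "computable_trig_poly_seq (\<lambda>n. Abs_poly_mapping (coef n))"
    unfolding computable_trig_poly_seq_def lookup by blast
  have "trig_degree (Abs_poly_mapping (coef n)) \<le> d n" unfolding deg using Pd[of n] by (rule Least_le)
  from trig_eval_eq_trig_sum[OF this] show "trig_eval (Abs_poly_mapping (coef n)) = trig_sum (d n) (coef n)"
    unfolding lookup .
qed

lemma trig_sum_enlarge:
  assumes "d \<le> d'" "\<And>l. int d < \<bar>l\<bar> \<Longrightarrow> c l = 0"
  shows "trig_sum d c = trig_sum d' c"
  unfolding trig_sum_def using assms by (intro ext sum.mono_neutral_left) auto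

lemma trig_sum_sum: "trig_sum d (\<lambda>l. \<Sum>j\<in>A. c j l) t = (\<Sum>j\<in>A. trig_sum d (c j) t)"
  unfolding trig_sum_def sum_distrib_right by (rule sum.swap)

section \<open>A computable vector with unbounded means\<close>

lemma cell_covered_imp_divergent:
  assumes "cell_covered t"
  obtains f where "computable_vector f" "\<not> convergent (\<lambda>N. cesaro_mean N f t)"
proof -
  from assms obtain s D C where s: "effective s" and D: "effective (\<lambda>x. D (fst x) (snd x))"
    and range: "\<And>j c. D j c \<Longrightarrow> - (7 * 2 ^ s j) \<le> c \<and> c < 7 * 2 ^ s j"
    and card: "\<And>j. card {c. D j c} * 2 ^ j \<le> C * 2 ^ s j"
    and inf: "\<exists>\<^sub>\<infinity>j. D j \<lfloor>t * 2 ^ s j\<rfloor>"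
    unfolding cell_covered_def by blast
  note s' = effective_compose[OF s] and D' = effective_compose2[OF D]
  have fin: "finite {c. D j c}" for j by (rule finite_int_range) (rule range)
  have range8: "\<bar>c\<bar> \<le> 8 * 2 ^ s j" if "D j c" for j c using range[OF that] by auto

  \<comment> \<open>One bump per cell: \<open>O(2 ^ s j / 2 ^ j)\<close> cells with norm
    \<open>O(1 / 2 ^ s j)\<close> each give a total norm \<open>O(2 ^ - j)\<close>, however fine the
    level is.\<close>
  define H where "H j u = (\<Sum>c\<in>{c. D j c}. bump (s j) c u)" for j u
  define h where "h j l = (\<Sum>c\<in>{c. D j c}. bump_coeff (s j) c l)" for j l
  have h0: "h j l = 0" if "2 ^ s j < \<bar>l\<bar>" for j l
    using that by (simp add: h_def bump_coeff_def)
  have H_eq: "H j = trig_sum (2 ^ s j) (h j)" for j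
    unfolding H_def h_def bump_def trig_sum_sum[symmetric] ..
  have H_L1: "H j \<in> L1" for j unfolding H_eq by (rule trig_sum_L1)
  have H_Re: "0 \<le> Re (H j u)" for j u
    unfolding H_def Re_sum by (intro sum_nonneg Re_bump_nonneg) (auto intro: range8)
  have H_norm: "L1_norm (H j) \<le> real (24 * C) / 2 ^ j" for j
  proof -
    have int: "integrable (lebesgue_on {-pi..pi}) (bump S c)" for S c
      using trig_sum_L1 by (simp add: bump_def)
    have "L1_norm (H j) \<le> (LINT u|lebesgue_on {-pi..pi}. (\<Sum>c\<in>{c. D j c}. norm (bump (s j) c u)))"
      unfolding L1_norm_def using H_L1[of j] int
      by (intro integral_mono) (auto simp: H_def intro!: norm_sum)
    also have "\<dots> = (\<Sum>c\<in>{c. D j c}. L1_norm (bump (s j) c))"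
      unfolding L1_norm_def using int by (intro Bochner_Integration.integral_sum) auto
    also have "\<dots> \<le> (\<Sum>c\<in>{c. D j c}. 24 / 2 ^ s j)"
      by (intro sum_mono L1_norm_bump_le range8) simp
    also have "\<dots> = 24 * (real (card {c. D j c}) / 2 ^ s j)" by simp
    also have "real (card {c. D j c}) / 2 ^ s j \<le> real C / 2 ^ j"
    proof -
      have "real (card {c. D j c} * 2 ^ j) \<le> real (C * 2 ^ s j)" using card by (subst of_nat_le_iff)
      then show ?thesis by (simp add: field_simps)
    qed
    finally show ?thesis by simp
  qed

  obtain f where f_int: "integrable (lebesgue_on {-pi..pi}) f"
    and f_tail: "\<And>J. (LINT u|lebesgue_on {-pi..pi}. norm (f u - (\<Sum>j<J. H j u))) \<le> 2 * real (24 * C) / 2 ^ J"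
    by (rule L1_series[of "lebesgue_on {-pi..pi}" H "real (24 * C)"]) (use H_L1 H_norm[unfolded L1_norm_def] in auto)
  define G where "G J u = (\<Sum>j<J. H j u)" for J u
  define d where "d J = (\<Sum>j<J. 2 ^ s j :: nat)" for J
  define g where "g J l = (\<Sum>j<J. h j l)" for J l
  have d_ge: "2 ^ s j \<le> d J" if "j < J" for j J unfolding d_def using that by (intro member_le_sum) auto
  have d_ge': "2 ^ s j \<le> int (d J)" if "j < J" for j J
    using d_ge[OF that] by (metis of_nat_le_iff of_nat_numeral of_nat_power)
  have G_eq: "G J = trig_sum (d J) (g J)" for J
  proof
    fix u
    have "G J u = (\<Sum>j<J. trig_sum (d J) (h j) u)"
      unfolding G_def H_eq
      by (intro sum.cong refl fun_cong[OF trig_sum_enlarge]) (auto intro: d_ge h0)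
    then show "G J u = trig_sum (d J) (g J) u" by (simp add: g_def[abs_def] trig_sum_sum)
  qed
  have G_L1: "G J \<in> L1" for J unfolding G_eq by (rule trig_sum_L1)
  have g0: "g J l = 0" if "int (d J) < \<bar>l\<bar>" for J l
    unfolding g_def
  proof (intro sum.neutral ballI h0)
    fix j assume "j \<in> {..<J}"
    then have "2 ^ s j \<le> int (d J)" by (intro d_ge') simp
    with that show "2 ^ s j < \<bar>l\<bar>" by linarith
  qed
  have f_G: "L1_norm (\<lambda>u. f u - G J u) \<le> real (48 * C) / 2 ^ J" for J
    using f_tail[of J] by (simp add: L1_norm_def G_def)

  \<comment> \<open>This is the index shift that removes the constant:
    \<open>b / 2 ^ (k + b) < 1 / 2 ^ k\<close> because \<open>b < 2 ^ b\<close>.\<close>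
  define b where "b = 48 * C"
  have "effective_complex (\<lambda>x. h (fst x) (snd x))"
  proof -
    \<comment> \<open>A set of cells is not a coded object, so the sum runs over the whole window
      with the membership test inside.\<close>
    have "h j l = (\<Sum>i<14 * 2 ^ s j. if D j (int i - 7 * 2 ^ s j) then bump_coeff (s j) (int i - 7 * 2 ^ s j) l else 0)" for j l
    proof -
      have less: "int i < 14 * 2 ^ s j" if "i < 14 * 2 ^ s j" for i :: nat
        using of_nat_less_iff[of i "14 * 2 ^ s j", where 'a = int] that by simp
      have "h j l = (\<Sum>c = - 7 * 2 ^ s j..<7 * 2 ^ s j. if D j c then bump_coeff (s j) c l else 0)"
        unfolding h_def by (rule sum.mono_neutral_cong_left) (auto dest: range)
      also have "\<dots> = (\<Sum>i<14 * 2 ^ s j. if D j (int i - 7 * 2 ^ s j) then bump_coeff (s j) (int i - 7 * 2 ^ s j) l else 0)"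
        by (rule sum.reindex_bij_witness[where i = "\<lambda>i. int i - 7 * 2 ^ s j" and j = "\<lambda>c. nat (c + 7 * 2 ^ s j)"])
           (auto simp: nat_less_iff less)
      finally show ?thesis .
    qed
    then show ?thesis by (simp only:) (intro eff s' D')
  qed
  note h' = effective_complex_compose2[OF this]
  have g: "effective_complex (\<lambda>x. g (fst x + b) (snd x))" unfolding g_def by (intro eff h')
  have d: "effective (\<lambda>n. d (n + b))" unfolding d_def by (intro eff s')
  note poly = computable_trig_poly_seqI[OF g d g0]
  have "L1_norm (\<lambda>u. f u - trig_eval (Abs_poly_mapping (g (k + b))) u) < 1 / 2 ^ k" for k
  proof -
    have "trig_eval (Abs_poly_mapping (g (k + b))) = G (k + b)" unfolding G_eq by (rule poly(2)) 
    then have "L1_norm (\<lambda>u. f u - trig_eval (Abs_poly_mapping (g (k + b))) u) \<le> real b / 2 ^ (k + b)"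
      using f_G[of "k + b"] by (simp add: b_def)
    also have "\<dots> = real b / 2 ^ b * (1 / 2 ^ k)" by (simp add: power_add)
    also have "\<dots> < 1 * (1 / 2 ^ k)"
      by (intro mult_strict_right_mono) (simp_all add: of_nat_less_two_power)
    finally show ?thesis by simp
  qed
  then have "computable_vector f"
    unfolding computable_vector_def using f_int poly(1) by blast

  moreover have "\<not> convergent (\<lambda>N. cesaro_mean N f t)"
  proof
    assume "convergent (\<lambda>N. cesaro_mean N f t)"
    then obtain K where K: "\<And>N. norm (cesaro_mean N f t) \<le> K"
      by (rule convergent_imp_Bseq[THEN BseqE]) blast
    \<comment> \<open>Every stage that captures \<open>t\<close> contributes at least
      \<open>1 / 4\<close>, so more than \<open>4 * K\<close> of them lift a partial sum above the
      assumed bound \<open>K\<close>.\<close>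
    obtain n where n: "K < real n / 4" using reals_Archimedean2[of "4 * K"] by (auto simp: field_simps)
    obtain A where A: "finite A" "card A = n" "A \<subseteq> {j. D j \<lfloor>t * 2 ^ s j\<rfloor>}"
      using inf infinite_arbitrarily_large unfolding INFM_iff_infinite by blast
    obtain J where J: "A \<subseteq> {..<J}" using A(1) finite_nat_iff_bounded by auto
    have "real n / 4 = (\<Sum>j\<in>A. 1 / 4)" using A(2) by simp
    also have "\<dots> \<le> (\<Sum>j\<in>A. Re (H j t))"
    proof (rule sum_mono)
      fix j assume "j \<in> A"
      then have Dj: "D j \<lfloor>t * 2 ^ s j\<rfloor>" using A(3) by blast
      have "1 / 4 \<le> Re (bump (s j) \<lfloor>t * 2 ^ s j\<rfloor> t)" by (rule Re_bump_cell_ge[OF range8[OF Dj]])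
      also have "\<dots> \<le> (\<Sum>c\<in>{c. D j c}. Re (bump (s j) c t))"
        by (rule member_le_sum) (use Dj fin in \<open>auto intro: Re_bump_nonneg range8\<close>)
      finally show "1 / 4 \<le> Re (H j t)" by (simp add: H_def)
    qed
    also have "\<dots> \<le> Re (G J t)"
      unfolding G_def Re_sum using J H_Re by (intro sum_mono2) auto
    finally have "K < Re (G J t)" using n by simp
    moreover have "(\<lambda>N. Re (cesaro_mean N (G J) t)) \<longlonglongrightarrow> Re (G J t)"
      unfolding G_eq by (intro tendsto_Re cesaro_mean_trig_sum_tendsto)
    ultimately have "eventually (\<lambda>N. K < Re (cesaro_mean N (G J) t)) sequentially" by (rule order_tendstoD(1)[rotated])
    \<comment> \<open>The order \<open>N\<close> is fixed for the polynomial \<open>G J\<close>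
      before passing to \<open>f\<close>. All further terms have nonnegative real part, so for this
      \<open>N\<close> the passage can only increase the real part of the mean.\<close>
    then obtain N where N: "K < Re (cesaro_mean N (G J) t)" by (auto simp: eventually_sequentially)
    have "(\<lambda>J. L1_norm (\<lambda>u. G J u - f u)) \<longlonglongrightarrow> 0"
    proof (rule tendsto_sandwich[OF _ _ tendsto_const])
      show "eventually (\<lambda>J. 0 \<le> L1_norm (\<lambda>u. G J u - f u)) sequentially" by (simp add: L1_norm_def)
      show "eventually (\<lambda>J. L1_norm (\<lambda>u. G J u - f u) \<le> real (48 * C) * (1 / 2) ^ J) sequentially"
        using f_G by (subst L1_norm_minus_commute) (simp add: power_one_over)
      show "(\<lambda>J. real (48 * C) * (1 / 2) ^ J) \<longlonglongrightarrow> 0"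
        by (intro tendsto_mult_right_zero LIMSEQ_realpow_zero) auto
    qed
    then have lim: "(\<lambda>J. Re (cesaro_mean N (G J) t)) \<longlonglongrightarrow> Re (cesaro_mean N f t)"
      using f_int by (intro tendsto_Re cesaro_mean_L1_tendsto G_L1) auto
    have "Re (cesaro_mean N (G J) t) \<le> Re (cesaro_mean N (G J') t)" if "J \<le> J'" for J'
    proof -
      have "0 \<le> Re (cesaro_mean N (\<lambda>u. G J' u - G J u) t)"
      proof (rule Re_cesaro_mean_nonneg)
        show "(\<lambda>u. G J' u - G J u) \<in> L1" using G_L1[of J] G_L1[of J'] by simp
        fix u
        have "Re (G J u) \<le> Re (G J' u)"
          unfolding G_def Re_sum using that H_Re by (intro sum_mono2) auto
        then show "0 \<le> Re (G J' u - G J u)" by simp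
      qed
      then show ?thesis by (simp add: cesaro_mean_diff[OF G_L1 G_L1])
    qed
    then have "Re (cesaro_mean N (G J) t) \<le> Re (cesaro_mean N f t)"
      by (intro tendsto_lowerbound[OF lim]) (auto simp: eventually_sequentially)
    then show False using N K[of N] complex_Re_le_cmod[of "cesaro_mean N f t"] by linarith
  qed
  ultimately show ?thesis by (rule that)
qed

theorem theorem6p1:
  fixes t0 :: real
  assumes "t0 \<in> {-pi..pi}"
  shows "schnorr_random t0 \<longleftrightarrow>
    (\<forall>f. computable_vector f \<longrightarrow>
      (\<exists>\<alpha>. canonical_value f t0 \<alpha> \<and> (\<lambda>N. cesaro_mean N f t0) \<longlonglongrightarrow> \<alpha>))"
proof
  assume "schnorr_random t0"
  with assms show "\<forall>f. computable_vector f \<longrightarrow>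
      (\<exists>\<alpha>. canonical_value f t0 \<alpha> \<and> (\<lambda>N. cesaro_mean N f t0) \<longlonglongrightarrow> \<alpha>)"
    using schnorr_random_imp_cesaro_tendsto by blast
next
  assume *: "\<forall>f. computable_vector f \<longrightarrow>
      (\<exists>\<alpha>. canonical_value f t0 \<alpha> \<and> (\<lambda>N. cesaro_mean N f t0) \<longlonglongrightarrow> \<alpha>)"
  show "schnorr_random t0"
  proof (rule ccontr)
    assume "\<not> schnorr_random t0"
    with assms have "cell_covered t0" by (rule not_schnorr_random_imp_cell_covered)
    then obtain f where "computable_vector f" "\<not> convergent (\<lambda>N. cesaro_mean N f t0)"
      by (rule cell_covered_imp_divergent)
    \<comment> \<open>Without a limit no \<open>\<alpha>\<close> qualifies, whichever values the
      names of \<open>f\<close> assign at \<open>t0\<close>.\<close>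
    with * show False unfolding convergent_def by blast
  qed
qed

end
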